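(* Let $G=A\ast_C B$ be a free product of free groups $A$ and $B$ of finite rank with amalgamated finitely generated subgroup $C$. Then the Conjugacy Search Problem in $G$ is decidable for cyclically reduced regular elements and their conjugates, i.e. it is decidable for arbitrary pairs from $CR\times G$, where $CR$ is the set of elements of $G$ that are conjugate in $G$ to cyclically reduced regular elements.
   Context: $A=F(X)$, $B=F(Y)$ with $X,Y$ finite; $C$ is generated by a finite set $Z$ and embedded in $A$ and $B$ by monomorphisms $\phi,\psi$; $G=\langle X\cup Y\mid z^\phi=z^\psi\ (z\in Z)\rangle$; $A,B$ are identified with subgroups of $G$ and $C=A\cap B$. Elements are given as words in $X\cup Y$. Conjugation: $h^g=g^{-1}hg$, $K^g=g^{-1}Kg$. $N^*_G(C)=\{g\in G\mid C\cap C^g\neq1\}$ and $Z_G(C)=\bigcup_{g\in N^*_G(C)\smallsetminus C}\left(C^{g^{-1}}\cap C\right)$. An element of $G$ is singular if it lies in $BH=(N^*_G(C)\smallsetminus C)\cup Z_G(C)$, and regular otherwise. Reduced form: $g=cg_1\cdots g_n$ with $c\in C$, $g_i\in(A\cup B)\smallsetminus C$ and consecutive $g_i$ in different factors; $n=l(g)$ depends only on $g$. The element $g$ is cyclically reduced if $n=0$; or $n=1$ and $g$ is not conjugate in $G$ to an element of $C$; or $n\ge2$ and $g_1,g_n$ lie in different factors. Conjugacy Search Problem: given $u,v$, decide whether they are conjugate in $G$ and, if so, find a conjugator. It is decidable on a set $\Phi$ of pairs if there is a partial algorithm which halts at least on all inputs in $\Phi$ and solves the problem correctly on every input on which it halts.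 *)

theory Defs
  imports "HOL-Algebra.Generated_Groups" "HOL-Library.Nat_Bijection"
begin

section \<open>Words and group presentations\<close>

text \<open>The letter \<open>(x, False)\<close> stands for the generator \<open>x\<close> and \<open>(x, True)\<close> for its formal inverse.\<close>

type_synonym 'a word = "('a \<times> bool) list"

abbreviation words :: "'a set \<Rightarrow> 'a word set" where
  "words S \<equiv> lists (S \<times> UNIV)"

text \<open>The least congruence on the monoid of words over \<open>S\<close> that contains the relations
  \<open>x x\<^sup>-\<^sup>1 = x\<^sup>-\<^sup>1 x = 1\<close> and all \<open>r = s\<close> with \<open>(r, s) \<in> R\<close>.\<close>

inductive_set pres_rel :: "'a set \<Rightarrow> ('a word \<times> 'a word) set \<Rightarrow> ('a word \<times> 'a word) set"
  for S :: "'a set" and R :: "('a word \<times> 'a word) set" where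
  refl: "w \<in> words S \<Longrightarrow> (w, w) \<in> pres_rel S R"
| sym: "(u, v) \<in> pres_rel S R \<Longrightarrow> (v, u) \<in> pres_rel S R"
| trans: "(u, v) \<in> pres_rel S R \<Longrightarrow> (v, w) \<in> pres_rel S R \<Longrightarrow> (u, w) \<in> pres_rel S R"
| cong: "(u, u') \<in> pres_rel S R \<Longrightarrow> (v, v') \<in> pres_rel S R \<Longrightarrow> (u @ v, u' @ v') \<in> pres_rel S R"
| cancel: "x \<in> S \<Longrightarrow> ([(x, b), (x, \<not> b)], []) \<in> pres_rel S R"
| relation: "(r, s) \<in> R \<Longrightarrow> r \<in> words S \<Longrightarrow> s \<in> words S \<Longrightarrow> (r, s) \<in> pres_rel S R"

text \<open>The element of \<open>\<langle>S | R\<rangle>\<close> represented by a word.\<close>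

definition word_elem :: "'a set \<Rightarrow> ('a word \<times> 'a word) set \<Rightarrow> 'a word \<Rightarrow> 'a word set" where
  "word_elem S R w = pres_rel S R `` {w}"

definition presented_group ::
  "'a set \<Rightarrow> ('a word \<times> 'a word) set \<Rightarrow> 'a word set monoid" where
  "presented_group S R =
     \<lparr>carrier = words S // pres_rel S R,
      monoid.mult = (\<lambda>U V. pres_rel S R `` {u @ v | u v. u \<in> U \<and> v \<in> V}),
      monoid.one = word_elem S R []\<rparr>"

definition free_group :: "'a set \<Rightarrow> 'a word set monoid" where
  "free_group X = presented_group X {}"

lemma equiv_pres_rel: "equiv (words S) (pres_rel S R)"
proof -
  have "u \<in> words S \<and> v \<in> words S" if "(u, v) \<in> pres_rel S R" for u v
    using that by induction auto
  then show ?thesis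
    by (auto simp: equiv_def refl_on_def sym_def trans_def
        intro: pres_rel.refl pres_rel.sym pres_rel.trans)
qed

lemma carrier_presented_group: "carrier (presented_group S R) = word_elem S R ` words S"
  by (auto simp: presented_group_def quotient_def word_elem_def)

lemma mult_word_elem:
  assumes "u \<in> words S" "v \<in> words S"
  shows "word_elem S R u \<otimes>\<^bsub>presented_group S R\<^esub> word_elem S R v = word_elem S R (u @ v)"
  using assms
  by (auto simp: presented_group_def word_elem_def
      intro: pres_rel.refl pres_rel.trans pres_rel.cong)

lemma inverse_word:
  assumes "u \<in> words S"
  shows "(rev (map (\<lambda>(x, b). (x, \<not> b)) u) @ u, []) \<in> pres_rel S R"
  using assms
proof (induction u rule: lists.induct)
  case (Cons p u)
  obtain x b where p: "p = (x, b)" by force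
  let ?w = "rev (map (\<lambda>(x, b). (x, \<not> b)) u)"
  have x: "x \<in> S" and us: "u \<in> words S" using Cons.hyps p by auto
  have w: "?w \<in> words S" using us by auto
  have "([(x, \<not> b), (x, b)] @ u, [] @ u) \<in> pres_rel S R"
    using pres_rel.cong[OF pres_rel.cancel[OF x, of "\<not> b" R] pres_rel.refl[OF us]] by simp
  from pres_rel.cong[OF pres_rel.refl[OF w] this] Cons.IH
  show ?case using p by (auto intro: pres_rel.trans)
qed (auto intro: pres_rel.refl)

lemma group_presented_group: "group (presented_group S R)"
proof (rule groupI)
  have one: "\<one>\<^bsub>presented_group S R\<^esub> = word_elem S R []"
    by (simp add: presented_group_def)
  show "\<one>\<^bsub>presented_group S R\<^esub> \<in> carrier (presented_group S R)"
    unfolding one carrier_presented_group by auto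
  fix a assume "a \<in> carrier (presented_group S R)"
  then obtain u where u: "u \<in> words S" "a = word_elem S R u"
    unfolding carrier_presented_group by auto
  show "\<one>\<^bsub>presented_group S R\<^esub> \<otimes>\<^bsub>presented_group S R\<^esub> a = a"
    using mult_word_elem[of "[]" S u R] u one by simp
  define u' where "u' = rev (map (\<lambda>(x, b). (x, \<not> b)) u)"
  have u': "u' \<in> words S" using u(1) by (auto simp: u'_def)
  have "(u' @ u, []) \<in> pres_rel S R"
    unfolding u'_def by (rule inverse_word[OF u(1)])
  then have "word_elem S R (u' @ u) = word_elem S R []"
    unfolding word_elem_def by (rule equiv_class_eq[OF equiv_pres_rel])
  then show "\<exists>b\<in>carrier (presented_group S R).
      b \<otimes>\<^bsub>presented_group S R\<^esub> a = \<one>\<^bsub>presented_group S R\<^esub>"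
    using mult_word_elem[OF u' u(1), of R] u' unfolding u(2) one carrier_presented_group
    by (intro bexI[of _ "word_elem S R u'"]) simp_all
  fix b assume "b \<in> carrier (presented_group S R)"
  then obtain v where v: "v \<in> words S" "b = word_elem S R v"
    unfolding carrier_presented_group by auto
  have uv: "u @ v \<in> words S" using u v by (rule_tac append_in_lists_conv[THEN iffD2]) simp
  show "a \<otimes>\<^bsub>presented_group S R\<^esub> b \<in> carrier (presented_group S R)"
    unfolding u(2) v(2) mult_word_elem[OF u(1) v(1)] carrier_presented_group using uv by (rule imageI)
  fix c assume "c \<in> carrier (presented_group S R)"
  then obtain w where w: "w \<in> words S" "c = word_elem S R w"
    unfolding carrier_presented_group by auto
  have vw: "v @ w \<in> words S" using v w by (rule_tac append_in_lists_conv[THEN iffD2]) simp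
  show "a \<otimes>\<^bsub>presented_group S R\<^esub> b \<otimes>\<^bsub>presented_group S R\<^esub> c =
      a \<otimes>\<^bsub>presented_group S R\<^esub> (b \<otimes>\<^bsub>presented_group S R\<^esub> c)"
    unfolding u(2) v(2) w(2)
    by (simp only: mult_word_elem[OF u(1) v(1)] mult_word_elem[OF uv w(1)]
        mult_word_elem[OF v(1) w(1)] mult_word_elem[OF u(1) vw] append_assoc)
qed

text \<open>The relations \<open>z\<^sup>\<phi> = z\<^sup>\<psi>\<close> for \<open>z \<in> Z\<close>, where \<open>z\<^sup>\<phi>\<close> and \<open>z\<^sup>\<psi>\<close>, which are elements of free
  groups and hence classes of words, are replaced by the words that represent them.\<close>

definition amalgam_rels ::
  "'c set \<Rightarrow> ('c \<Rightarrow> 'a word set) \<Rightarrow> ('c \<Rightarrow> 'a word set) \<Rightarrow> ('a word \<times> 'a word) set" where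
  "amalgam_rels Z \<phi> \<psi> = (\<Union>z\<in>Z. \<phi> z \<times> \<psi> z)"


section \<open>Conjugation, singular and regular elements\<close>

definition conj_elem :: "('g, 'm) monoid_scheme \<Rightarrow> 'g \<Rightarrow> 'g \<Rightarrow> 'g" where
  "conj_elem G h g = inv\<^bsub>G\<^esub> g \<otimes>\<^bsub>G\<^esub> h \<otimes>\<^bsub>G\<^esub> g"

definition conj_set :: "('g, 'm) monoid_scheme \<Rightarrow> 'g set \<Rightarrow> 'g \<Rightarrow> 'g set" where
  "conj_set G K g = (\<lambda>h. conj_elem G h g) ` K"

definition conjugate_in :: "('g, 'm) monoid_scheme \<Rightarrow> 'g \<Rightarrow> 'g \<Rightarrow> bool" where
  "conjugate_in G u v \<longleftrightarrow> (\<exists>g\<in>carrier G. conj_elem G u g = v)"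

definition N_star :: "('g, 'm) monoid_scheme \<Rightarrow> 'g set \<Rightarrow> 'g set" where
  "N_star G C = {g \<in> carrier G. C \<inter> conj_set G C g \<noteq> {\<one>\<^bsub>G\<^esub>}}"

definition Z_set :: "('g, 'm) monoid_scheme \<Rightarrow> 'g set \<Rightarrow> 'g set" where
  "Z_set G C = (\<Union>g \<in> N_star G C - C. conj_set G C (inv\<^bsub>G\<^esub> g) \<inter> C)"

definition singular :: "('g, 'm) monoid_scheme \<Rightarrow> 'g set \<Rightarrow> 'g \<Rightarrow> bool" where
  "singular G C g \<longleftrightarrow> g \<in> (N_star G C - C) \<union> Z_set G C"

definition regular :: "('g, 'm) monoid_scheme \<Rightarrow> 'g set \<Rightarrow> 'g \<Rightarrow> bool" where
  "regular G C g \<longleftrightarrow> g \<in> carrier G \<and> \<not> singular G C g"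


section \<open>Reduced forms and cyclically reduced elements\<close>

text \<open>Used for \<open>g, h \<in> (A \<union> B) - C\<close> with \<open>C = A \<inter> B\<close>, where each of \<open>g\<close>, \<open>h\<close> lies in exactly one
  factor.\<close>

definition different_factors :: "'g set \<Rightarrow> 'g set \<Rightarrow> 'g \<Rightarrow> 'g \<Rightarrow> bool" where
  "different_factors A B g h \<longleftrightarrow> g \<in> A \<and> h \<in> B \<or> g \<in> B \<and> h \<in> A"

definition reduced_form ::
  "('g, 'm) monoid_scheme \<Rightarrow> 'g set \<Rightarrow> 'g set \<Rightarrow> 'g set \<Rightarrow> 'g \<Rightarrow> 'g \<Rightarrow> 'g list \<Rightarrow> bool" where
  "reduced_form G A B C g c gs \<longleftrightarrow>
     c \<in> C \<and> set gs \<subseteq> (A \<union> B) - C \<and> successively (different_factors A B) gs \<and>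
     g = c \<otimes>\<^bsub>G\<^esub> foldr (\<otimes>\<^bsub>G\<^esub>) gs \<one>\<^bsub>G\<^esub>"

definition cyclically_reduced ::
  "('g, 'm) monoid_scheme \<Rightarrow> 'g set \<Rightarrow> 'g set \<Rightarrow> 'g set \<Rightarrow> 'g \<Rightarrow> bool" where
  "cyclically_reduced G A B C g \<longleftrightarrow>
     (\<exists>c gs. reduced_form G A B C g c gs \<and>
        (length gs = 0 \<or>
         length gs = 1 \<and> \<not> (\<exists>h\<in>C. conjugate_in G g h) \<or>
         length gs \<ge> 2 \<and> different_factors A B (hd gs) (last gs)))"

definition CR ::
  "('g, 'm) monoid_scheme \<Rightarrow> 'g set \<Rightarrow> 'g set \<Rightarrow> 'g set \<Rightarrow> 'g set" where
  "CR G A B C = {u \<in> carrier G.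
     \<exists>g. cyclically_reduced G A B C g \<and> regular G C g \<and> conjugate_in G u g}"


section \<open>Partial recursive functions\<close>

text \<open>Kleene's partial recursive functions in unary form: arguments are grouped by the Cantor
  pairing function instead of being arranged in tuples.  \<open>None\<close> means that the computation does
  not halt.\<close>

inductive partial_recursive :: "(nat \<rightharpoonup> nat) \<Rightarrow> bool" where
  zero: "partial_recursive (\<lambda>n. Some 0)"
| succ: "partial_recursive (\<lambda>n. Some (Suc n))"
| left: "partial_recursive (\<lambda>n. Some (fst (prod_decode n)))"
| right: "partial_recursive (\<lambda>n. Some (snd (prod_decode n)))"
| pair: "partial_recursive f \<Longrightarrow> partial_recursive g \<Longrightarrow>
    partial_recursive
      (\<lambda>n. Option.bind (f n) (\<lambda>a. Option.bind (g n) (\<lambda>b. Some (prod_encode (a, b)))))"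
| comp: "partial_recursive f \<Longrightarrow> partial_recursive g \<Longrightarrow> partial_recursive (f \<circ>\<^sub>m g)"
| prim_rec: "partial_recursive f \<Longrightarrow> partial_recursive g \<Longrightarrow>
    partial_recursive (\<lambda>n. case prod_decode n of (a, k) \<Rightarrow>
      rec_nat (f a) (\<lambda>i r. Option.bind r (\<lambda>y. g (prod_encode (a, prod_encode (i, y))))) k)"
| minimise: "partial_recursive f \<Longrightarrow>
    partial_recursive (\<lambda>a.
      if \<exists>k. f (prod_encode (a, k)) = Some 0 \<and> (\<forall>j<k. f (prod_encode (a, j)) \<noteq> None)
      then Some (LEAST k. f (prod_encode (a, k)) = Some 0) else None)"


section \<open>The conjugacy search problem\<close>

text \<open>Words are input to and output by algorithms through numberings \<open>idx\<close> of the generators.\<close>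

definition word_code :: "('a \<Rightarrow> nat) \<Rightarrow> 'a word \<Rightarrow> nat" where
  "word_code idx w = list_encode (map (\<lambda>(x, b). prod_encode (idx x, of_bool b)) w)"

text \<open>The output \<open>0\<close> means ``not conjugate''; the output \<open>Suc m\<close> means ``conjugate'', where \<open>m\<close> is
  the code of a word that represents a conjugator.\<close>

definition CSP_answer ::
  "('a \<Rightarrow> nat) \<Rightarrow> 'a set \<Rightarrow> ('a word \<times> 'a word) set \<Rightarrow> 'a word \<Rightarrow> 'a word \<Rightarrow> nat \<Rightarrow> bool" where
  "CSP_answer idx S R u v r \<longleftrightarrow>
     (case r of
        0 \<Rightarrow> \<not> conjugate_in (presented_group S R) (word_elem S R u) (word_elem S R v)
      | Suc m \<Rightarrow> \<exists>w\<in>words S. m = word_code idx w \<and>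
          conj_elem (presented_group S R) (word_elem S R u) (word_elem S R w) = word_elem S R v)"

definition CSP_decidable_on ::
  "('a \<Rightarrow> nat) \<Rightarrow> 'a set \<Rightarrow> ('a word \<times> 'a word) set \<Rightarrow> ('a word set \<times> 'a word set) set \<Rightarrow> bool" where
  "CSP_decidable_on idx S R \<Phi> \<longleftrightarrow>
     (\<exists>f. partial_recursive f \<and>
        (\<forall>u\<in>words S. \<forall>v\<in>words S.
           let res = f (prod_encode (word_code idx u, word_code idx v)) in
             ((word_elem S R u, word_elem S R v) \<in> \<Phi> \<longrightarrow> res \<noteq> None) \<and>
             (\<forall>r. res = Some r \<longrightarrow> CSP_answer idx S R u v r)))"

end

theory Submission
  imports Defs "HOL-Library.Sublist"
begin

text \<open>
  The algorithm enumerates certificates, so it suffices that conjugacy of \<open>u\<close> and \<open>v\<close> and, for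
  \<open>u\<close> in \<open>CR\<close>, also non-conjugacy have certificates whose correctness is recursively enumerable.
  After conjugation, \<open>u\<close> is cyclically reduced and regular.

  If \<open>u\<close> has length one, or lies in \<open>C\<close> without being conjugate into \<open>C\<close> by an element outside \<open>C\<close>,
  then a conjugate of \<open>u\<close> in a factor is already conjugate to \<open>u\<close> in that factor, and in a free
  group the conjugators that matter can be taken short: the conjugates of \<open>u\<close> by the prefixes of a
  long conjugator either repeat or reach a region in which nothing cancels.

  If \<open>u = u\<^sub>1 \<dots> u\<^sub>n\<close> with \<open>n \<ge> 2\<close>, then \<open>v = v\<^sub>1 \<dots> v\<^sub>n\<close> is, up to a cyclic permutation, conjugate to
  \<open>u\<close> by an element \<open>c\<close> of \<open>C\<close>, and \<open>c = u\<^sup>-\<^sup>1 c v\<close> lies in the coset obtained from \<open>C\<close> by repeating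
  \<open>Q \<mapsto> C \<inter> u\<^sub>i\<^sup>-\<^sup>1 Q v\<^sub>i\<close>. Howson's argument bounds the generators of each of these cosets. Regularity
  means that \<open>C \<inter> C\<^sup>u\<close> is trivial, so the last coset has at most one element, whose length is
  therefore bounded by a computable function of \<open>u\<close> and \<open>v\<close>; the triviality of \<open>C \<inter> C\<^sup>u\<close> can be
  checked in the same way.
\<close>

section \<open>Bijections and words\<close>

text \<open>No reduction procedure is verified, and membership in \<open>CR\<close> is never tested.
  The search runs over all conjugates of \<open>u\<close> and \<open>v\<close> at once, so
  termination only needs some conjugates with a certificate to exist, and these come from minimal
  length arguments. In exchange, a certificate contains statements about all words in a finite
  range. Hence each range must be bounded by a computable function, and inequality in
  \<open>G\<close> and non-membership in \<open>C\<close> must be enumerable just like equality;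
  they are witnessed by alternating products and reduced words.

  All geometry takes place in the Cayley tree of a free group: a path passes through every vertex of
  the geodesic between its ends, so subgroups spelled by words of length at most \<open>k\<close>
  are quasiconvex. Generators of intersections are bounded, but never computed. The constant
  comparing lengths in the two factors is chosen non-effectively; this is harmless, since it depends
  on the presentation only.

  The identity needs a case of its own: it is regular if \<open>N_star\<close> minus
  \<open>C\<close> is empty, yet every conjugator keeps it in \<open>C\<close>.\<close>

typedef 'o bijection = "{f :: 'o \<Rightarrow> 'o. bij f}"
  morphisms app Bijection
  by (rule exI[of _ id]) simp

setup_lifting type_definition_bijection

instantiation bijection :: (type) group_add
begin
lift_definition zero_bijection :: "'a bijection" is id by simp
lift_definition plus_bijection :: "'a bijection \<Rightarrow> 'a bijection \<Rightarrow> 'a bijection" is "(\<circ>)"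
  by (rule bij_comp)
lift_definition uminus_bijection :: "'a bijection \<Rightarrow> 'a bijection" is "inv_into UNIV"
  by (rule bij_imp_bij_inv)
definition minus_bijection :: "'a bijection \<Rightarrow> 'a bijection \<Rightarrow> 'a bijection" where
  "minus_bijection a b = a + - b"
instance
  by standard (transfer; simp add: bij_is_inj comp_assoc minus_bijection_def)+
end

lemma app_zero [simp]: "app 0 x = x" by transfer simp
lemma app_plus [simp]: "app (f + g) x = app f (app g x)" by transfer simp

text \<open>The left regular representation moves a group into a type of class \<open>group_add\<close>, so that
  calculations need no carriers; there is no such class for groups written multiplicatively.\<close>

definition cay :: "('g, 'm) monoid_scheme \<Rightarrow> 'g \<Rightarrow> 'g bijection" where
  "cay G g = Bijection (\<lambda>x. if x \<in> carrier G then g \<otimes>\<^bsub>G\<^esub> x else x)"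

context group begin

lemma app_cay:
  assumes "g \<in> carrier G"
  shows "app (cay G g) x = (if x \<in> carrier G then g \<otimes> x else x)"
proof -
  have "bij (\<lambda>x. if x \<in> carrier G then g \<otimes> x else x)"
    by (rule o_bij[of "\<lambda>x. if x \<in> carrier G then inv g \<otimes> x else x"])
       (use assms in \<open>auto simp: fun_eq_iff m_assoc[symmetric]\<close>)
  then show ?thesis by (simp add: cay_def Bijection_inverse)
qed

lemma cay_mult: "g \<in> carrier G \<Longrightarrow> h \<in> carrier G \<Longrightarrow> cay G (g \<otimes> h) = cay G g + cay G h"
  by (rule app_inject[THEN iffD1]) (auto simp: app_cay m_assoc fun_eq_iff)

lemma cay_one: "cay G \<one> = 0"
  using cay_mult[of \<one> \<one>] add_left_imp_eq[of "cay G \<one>" "cay G \<one>" 0] by simp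

lemma cay_inv: "g \<in> carrier G \<Longrightarrow> cay G (inv g) = - cay G g"
  using cay_mult[of g "inv g"] by (simp add: cay_one minus_unique)

lemma cay_eq_iff:
  assumes "g \<in> carrier G" "h \<in> carrier G" shows "cay G g = cay G h \<longleftrightarrow> g = h"
proof
  assume "cay G g = cay G h"
  then have "app (cay G g) \<one> = app (cay G h) \<one>" by simp
  then show "g = h" using assms by (simp add: app_cay)
qed simp

end

section \<open>Free reduction of words\<close>

definition inv_letter :: "'a \<times> bool \<Rightarrow> 'a \<times> bool" where
  "inv_letter p = (fst p, \<not> snd p)"

definition inv_word :: "'a word \<Rightarrow> 'a word" where
  "inv_word w = rev (map inv_letter w)"

lemma inv_letter_inv_letter [simp]: "inv_letter (inv_letter p) = p"
  by (simp add: inv_letter_def)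

lemma inv_letter_in_iff [simp]: "inv_letter p \<in> X \<times> UNIV \<longleftrightarrow> p \<in> X \<times> UNIV"
  by (cases p) (simp add: inv_letter_def)

lemma inv_word_Nil [simp]: "inv_word [] = []"
  by (simp add: inv_word_def)

lemma inv_word_append [simp]: "inv_word (u @ v) = inv_word v @ inv_word u"
  by (simp add: inv_word_def)

lemma inv_word_inv_word [simp]: "inv_word (inv_word u) = u"
  by (simp add: inv_word_def rev_map o_def)

lemma length_inv_word [simp]: "length (inv_word u) = length u"
  by (simp add: inv_word_def)

lemma inv_word_in_words [simp]: "inv_word u \<in> words X \<longleftrightarrow> u \<in> words X"
proof -
  have "inv_word u \<in> words X" if "u \<in> words X" for u
    using that by (fastforce simp: inv_word_def inv_letter_def)
  from this[of u] this[of "inv_word u"] show ?thesis by auto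
qed

fun push :: "'a \<times> bool \<Rightarrow> 'a word \<Rightarrow> 'a word" where
  "push p [] = [p]"
| "push p (q # w) = (if q = inv_letter p then w else p # q # w)"

definition nf :: "'a word \<Rightarrow> 'a word" where
  "nf w = foldr push w []"

definition reduced :: "'a word \<Rightarrow> bool" where
  "reduced w \<longleftrightarrow> successively (\<lambda>p q. q \<noteq> inv_letter p) w"

lemma reduced_Nil [simp]: "reduced []"
  by (simp add: reduced_def)

lemma reduced_push: "reduced w \<Longrightarrow> reduced (push p w)"
  by (cases w) (auto simp: reduced_def successively_Cons)

lemma push_push_inv: "reduced w \<Longrightarrow> push p (push (inv_letter p) w) = w"
  by (cases w rule: remdups_adj.cases) (auto simp: reduced_def)

lemma reduced_foldr_push: "reduced w \<Longrightarrow> reduced (foldr push u w)"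
  by (induction u) (auto intro: reduced_push)

lemma reduced_nf [simp]: "reduced (nf w)"
  by (simp add: nf_def reduced_foldr_push)

lemma nf_Cons: "nf (p # w) = push p (nf w)"
  by (simp add: nf_def)

lemma nf_Nil [simp]: "nf [] = []"
  by (simp add: nf_def)

lemma nf_reduced: "reduced w \<Longrightarrow> nf w = w"
proof (induction w)
  case (Cons p w)
  then have "nf w = w" by (auto simp: reduced_def successively_Cons)
  then show ?case using Cons.prems by (cases w) (auto simp: nf_Cons reduced_def)
qed simp

lemma reduced_appendD2: "reduced (u @ v) \<Longrightarrow> reduced v"
  by (auto simp: reduced_def successively_append_iff)

lemma length_push: "length (push p w) \<le> Suc (length w)"
  by (cases w) auto

lemma length_nf: "length (nf w) \<le> length w"
  by (induction w) (auto simp: nf_Cons intro: order_trans[OF length_push])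

lemma push_in_words: "w \<in> words X \<Longrightarrow> p \<in> X \<times> UNIV \<Longrightarrow> push p w \<in> words X"
  by (cases w) auto

lemma nf_in_words: "w \<in> words X \<Longrightarrow> nf w \<in> words X"
proof (induction w)
  case (Cons p w)
  then show ?case using push_in_words[of "nf w" X p] by (simp add: nf_Cons)
qed simp

text \<open>Van der Waerden's argument for free groups: words act on reduced words by pushing
  letters, and pushing a letter after its inverse is the identity there. Equivalent words therefore
  act alike; applied to \<open>[]\<close>, this shows that they have the same normal form.\<close>

lemma foldr_push_pres_rel:
  "(u, v) \<in> pres_rel S {} \<Longrightarrow> reduced w \<Longrightarrow> foldr push u w = foldr push v w"
proof (induction arbitrary: w rule: pres_rel.induct)
  case (cancel x b)
  then show ?case using push_push_inv[of w "(x, b)"] by (simp add: inv_letter_def)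
qed (auto simp: reduced_foldr_push)

lemma pres_rel_nf: "w \<in> words S \<Longrightarrow> (w, nf w) \<in> pres_rel S R"
proof (induction w)
  case Nil
  show ?case by (auto intro: pres_rel.refl)
next
  case (Cons p w)
  then have p: "p \<in> S \<times> UNIV" and w: "w \<in> words S" and IH: "(w, nf w) \<in> pres_rel S R" by auto
  have 1: "(p # w, p # nf w) \<in> pres_rel S R"
    using pres_rel.cong[OF pres_rel.refl[of "[p]"] IH] p by simp
  have "(p # nf w, push p (nf w)) \<in> pres_rel S R"
  proof (cases "\<exists>w'. nf w = inv_letter p # w'")
    case True
    then obtain w' where w': "nf w = inv_letter p # w'" by blast
    then have "w' \<in> words S" using nf_in_words[OF w] by simp
    then show ?thesis
      using pres_rel.cong[OF pres_rel.cancel[of "fst p" S "snd p" R] pres_rel.refl[of w']] p w'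
      by (auto simp: inv_letter_def)
  next
    case False
    then have "push p (nf w) = p # nf w" by (cases "nf w") auto
    then show ?thesis using p nf_in_words[OF w] by (auto intro!: pres_rel.refl)
  qed
  then show ?case using 1 by (auto simp: nf_Cons intro: pres_rel.trans)
qed

lemma pres_rel_free_iff:
  assumes "u \<in> words S" "v \<in> words S"
  shows "(u, v) \<in> pres_rel S {} \<longleftrightarrow> nf u = nf v"
proof
  assume "(u, v) \<in> pres_rel S {}"
  from foldr_push_pres_rel[OF this, of "[]"] show "nf u = nf v" by (simp add: nf_def)
next
  assume "nf u = nf v"
  then show "(u, v) \<in> pres_rel S {}"
    using pres_rel_nf[of _ S "{}"] assms by (metis pres_rel.trans pres_rel.sym)
qed

lemma word_elem_eq_iff:
  assumes "u \<in> words S" "v \<in> words S"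
  shows "word_elem S R u = word_elem S R v \<longleftrightarrow> (u, v) \<in> pres_rel S R"
  unfolding word_elem_def using equiv_class_eq_iff[OF equiv_pres_rel, of u v S R] assms by auto

section \<open>Evaluation of words in a group\<close>

definition ev :: "('a \<Rightarrow> 'g::group_add) \<Rightarrow> 'a word \<Rightarrow> 'g" where
  "ev \<gamma> w = sum_list (map (\<lambda>p. if snd p then - \<gamma> (fst p) else \<gamma> (fst p)) w)"

lemma ev_Nil [simp]: "ev \<gamma> [] = 0"
  by (simp add: ev_def)

lemma ev_append [simp]: "ev \<gamma> (u @ v) = ev \<gamma> u + ev \<gamma> v"
  by (simp add: ev_def)

lemma ev_Cons: "ev \<gamma> (p # v) = ev \<gamma> [p] + ev \<gamma> v"
  by (simp add: ev_def)

lemma ev_inv_letter: "ev \<gamma> [inv_letter p] = - ev \<gamma> [p]"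
  by (simp add: ev_def inv_letter_def)

lemma ev_inv_word [simp]: "ev \<gamma> (inv_word w) = - ev \<gamma> w"
proof (induction w)
  case (Cons p w)
  have "inv_word (p # w) = inv_word w @ [inv_letter p]" by (simp add: inv_word_def)
  then have "ev \<gamma> (inv_word (p # w)) = - ev \<gamma> w + - ev \<gamma> [p]" by (simp add: Cons.IH ev_inv_letter)
  also have "\<dots> = - ev \<gamma> (p # w)" by (subst (2) ev_Cons) (simp only: minus_add)
  finally show ?case .
qed simp

lemma ev_concat: "ev \<gamma> (concat ws) = sum_list (map (ev \<gamma>) ws)"
  by (induction ws) auto

lemma ev_push: "ev \<gamma> (push p w) = ev \<gamma> [p] + ev \<gamma> w"
proof (cases w)
  case (Cons q w')
  have "ev \<gamma> [p] + ev \<gamma> (inv_letter p # w') = ev \<gamma> w'"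
    by (subst ev_Cons) (simp add: ev_inv_letter add.assoc[symmetric])
  then show ?thesis using Cons ev_Cons[of \<gamma> p w] by auto
qed simp

lemma ev_nf [simp]: "ev \<gamma> (nf w) = ev \<gamma> w"
proof (induction w)
  case (Cons p w)
  then show ?case using ev_Cons[of \<gamma> p w] by (simp add: nf_Cons ev_push)
qed simp

text \<open>The suffixes of \<open>W\<close> are the vertices of a path in the Cayley tree of the
  free group, those of \<open>nf W\<close> the vertices of the geodesic with the same ends. In a
  tree the path meets all of them; \<open>\<gamma>\<close> then maps the vertices elsewhere. Pushing
  a letter creates at most one new suffix, the whole word.\<close>

lemma suffix_nfE:
  assumes "suffix s (nf W)"
  obtains s' where "suffix s' W" "ev \<gamma> s' = ev \<gamma> s"
  using assms
proof (induction W arbitrary: thesis s)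
  case (Cons p W)
  have "suffix s (nf W) \<or> s = push p (nf W)"
    using Cons.prems(2) by (cases "nf W") (auto simp: nf_Cons suffix_Cons split: if_splits)
  then show ?case
  proof
    assume "suffix s (nf W)"
    from Cons.IH[OF _ this] show ?thesis by (metis Cons.prems(1) suffix_ConsI)
  next
    assume "s = push p (nf W)"
    then show ?thesis using Cons.prems(1)[of "p # W"] by (simp add: ev_push ev_Cons[of \<gamma> p W])
  qed
qed auto

lemma ev_pres_rel:
  assumes "(u, v) \<in> pres_rel S R"
    and "\<And>r s. (r, s) \<in> R \<Longrightarrow> r \<in> words S \<Longrightarrow> s \<in> words S \<Longrightarrow> ev \<gamma> r = ev \<gamma> s"
  shows "ev \<gamma> u = ev \<gamma> v"
  using assms(1)
  by induction (auto simp: assms(2), auto simp: ev_def)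

lemma ev_cay:
  assumes "w \<in> words S"
  shows "ev (\<lambda>x. cay (presented_group S R) (word_elem S R [(x, False)])) w
       = cay (presented_group S R) (word_elem S R w)"
    (is "ev ?\<gamma> w = cay ?G _")
proof -
  interpret group ?G by (rule group_presented_group)
  have carr: "word_elem S R u \<in> carrier ?G" if "u \<in> words S" for u
    using that by (auto simp: carrier_presented_group)
  have one: "word_elem S R [] = \<one>\<^bsub>?G\<^esub>" by (simp add: presented_group_def)
  have letter: "ev ?\<gamma> [p] = cay ?G (word_elem S R [p])" if "p \<in> S \<times> UNIV" for p
  proof (cases "snd p")
    case True
    have w: "[(fst p, False)] \<in> words S" "[p] \<in> words S" using that by auto
    have "word_elem S R [(fst p, False)] \<otimes>\<^bsub>?G\<^esub> word_elem S R [p] = word_elem S R []"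
      unfolding mult_word_elem[OF w]
      using that True pres_rel.cancel[of "fst p" S False R] w
      by (subst word_elem_eq_iff) (auto simp: prod_eq_iff[of p])
    then have "cay ?G (word_elem S R [(fst p, False)]) + cay ?G (word_elem S R [p]) = 0"
      using cay_mult[OF carr[OF w(1)] carr[OF w(2)]] by (simp add: one cay_one)
    then show ?thesis using True by (simp add: ev_def minus_unique)
  next
    case False
    then have "p = (fst p, False)" by (cases p) simp
    then show ?thesis by (simp add: ev_def) (metis fst_conv snd_conv)
  qed
  show ?thesis using assms
  proof (induction w)
    case Nil
    show ?case by (simp add: one cay_one)
  next
    case (Cons p w)
    then have p: "[p] \<in> words S" and w: "w \<in> words S" by auto
    have "ev ?\<gamma> (p # w) = ev ?\<gamma> [p] + ev ?\<gamma> w" by (rule ev_Cons)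
    also have "\<dots> = cay ?G (word_elem S R [p] \<otimes>\<^bsub>?G\<^esub> word_elem S R w)"
      using letter[of p] p w Cons.IH by (simp add: cay_mult carr)
    also have "\<dots> = cay ?G (word_elem S R (p # w))" using mult_word_elem[OF p w] by simp
    finally show ?case .
  qed
qed

section \<open>Normal forms in amalgamated products\<close>

definition subgrp :: "'g::group_add set \<Rightarrow> bool" where
  "subgrp H \<longleftrightarrow> 0 \<in> H \<and> (\<forall>a\<in>H. \<forall>b\<in>H. a + b \<in> H) \<and> (\<forall>a\<in>H. - a \<in> H)"

lemma subgrpD:
  assumes "subgrp H"
  shows subgrp_zero: "0 \<in> H"
    and subgrp_add: "a \<in> H \<Longrightarrow> b \<in> H \<Longrightarrow> a + b \<in> H"
    and subgrp_minus: "a \<in> H \<Longrightarrow> - a \<in> H"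
    and subgrp_diff: "a \<in> H \<Longrightarrow> b \<in> H \<Longrightarrow> a - b \<in> H"
  using assms unfolding subgrp_def by (auto simp only: diff_conv_add_uminus)

lemma subgrp_minus_iff: "subgrp H \<Longrightarrow> - a \<in> H \<longleftrightarrow> a \<in> H"
  using subgrp_minus[of H a] subgrp_minus[of H "- a"] by auto

lemma subgrp_add_left_iff: "subgrp H \<Longrightarrow> a \<in> H \<Longrightarrow> a + b \<in> H \<longleftrightarrow> b \<in> H"
  by (metis add_minus_cancel minus_add_cancel subgrp_add subgrp_minus)

lemma subgrp_add_right_iff: "subgrp H \<Longrightarrow> b \<in> H \<Longrightarrow> a + b \<in> H \<longleftrightarrow> a \<in> H"
  by (metis add_diff_cancel subgrp_add subgrp_diff)

text \<open>The factors and the amalgamated group are kept apart here: that they embed into the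
  presented group is only a consequence of the action constructed below.\<close>

locale amalgam_data =
  fixes F :: "bool \<Rightarrow> 'f::group_add set" and K :: "'k::group_add set" and \<iota> :: "bool \<Rightarrow> 'k \<Rightarrow> 'f"
  assumes F: "subgrp (F i)" and K: "subgrp K"
    and \<iota>_in: "k \<in> K \<Longrightarrow> \<iota> i k \<in> F i"
    and \<iota>_add: "k \<in> K \<Longrightarrow> l \<in> K \<Longrightarrow> \<iota> i (k + l) = \<iota> i k + \<iota> i l"
    and \<iota>_inj: "inj_on (\<iota> i) K"
begin

lemmas F_simps = subgrpD[OF F] and K_simps = subgrpD[OF K]

lemma \<iota>_zero [simp]: "\<iota> i 0 = 0"
  using \<iota>_add[of 0 0 i] K_simps(1) add_left_imp_eq[of "\<iota> i 0" "\<iota> i 0" 0] by simp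

lemma \<iota>_minus: "k \<in> K \<Longrightarrow> \<iota> i (- k) = - \<iota> i k"
  using \<iota>_add[of k "- k" i] K_simps(3)[of k] by (simp add: minus_unique)

lemma \<iota>_image: "subgrp (\<iota> i ` K)"
  unfolding subgrp_def using K_simps
  by (auto simp flip: \<iota>_add \<iota>_minus intro!: image_eqI[of 0 "\<iota> i" 0])

text \<open>\<open>SOME\<close> is applied to the whole coset of \<open>y\<close>, so the
  representative depends on the coset only. The trivial coset gets 0, which lets
  \<open>join_hd\<close> recognise and drop trivial syllables.\<close>

definition rep :: "bool \<Rightarrow> 'f \<Rightarrow> 'f" where
  "rep i y = (if y \<in> \<iota> i ` K then 0 else (SOME t. t \<in> (\<lambda>k. \<iota> i k + y) ` K))"

definition coef :: "bool \<Rightarrow> 'f \<Rightarrow> 'k" where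
  "coef i y = inv_into K (\<iota> i) (y - rep i y)"

lemma rep_in: "\<exists>k\<in>K. rep i y = \<iota> i k + y"
proof (cases "y \<in> \<iota> i ` K")
  case True
  then obtain k where "k \<in> K" "y = \<iota> i k" by auto
  then show ?thesis using True
    by (intro bexI[of _ "- k"]) (auto simp: rep_def \<iota>_minus K_simps)
next
  case False
  have "rep i y \<in> (\<lambda>k. \<iota> i k + y) ` K"
    using False someI_ex[of "\<lambda>t. t \<in> (\<lambda>k. \<iota> i k + y) ` K"] K_simps(1) unfolding rep_def by auto
  then show ?thesis by auto
qed

lemma rep_add:
  assumes "k \<in> K" shows "rep i (\<iota> i k + y) = rep i y"
proof -
  have "\<iota> i k + y \<in> \<iota> i ` K \<longleftrightarrow> y \<in> \<iota> i ` K"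
    using subgrp_add_left_iff[OF \<iota>_image] assms by auto
  moreover have "(\<lambda>l. \<iota> i l + (\<iota> i k + y)) ` K = (\<lambda>l. \<iota> i l + y) ` K"
  proof -
    have "(\<lambda>l. \<iota> i l + (\<iota> i k + y)) ` K = (\<lambda>l. \<iota> i l + y) ` (\<lambda>l. l + k) ` K"
      using assms by (auto simp: \<iota>_add add.assoc image_iff)
    also have "(\<lambda>l. l + k) ` K = K"
      using assms K_simps by (auto simp: image_iff intro!: bexI[of _ "_ - k"])
    finally show ?thesis .
  qed
  ultimately show ?thesis unfolding rep_def by simp
qed

lemma rep_zero_iff: "rep i y = 0 \<longleftrightarrow> y \<in> \<iota> i ` K"
proof
  assume "rep i y = 0"
  then obtain k where "k \<in> K" "\<iota> i k + y = 0" using rep_in[of i y] by auto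
  then have "y = \<iota> i (- k)" by (simp add: \<iota>_minus minus_unique)
  then show "y \<in> \<iota> i ` K" using \<open>k \<in> K\<close> K_simps by auto
qed (simp add: rep_def)

lemma rep_rep [simp]: "rep i (rep i y) = rep i y"
  using rep_in[of i y] rep_add by metis

lemma rep_zero [simp]: "rep i 0 = 0"
  using K_simps(1) by (auto simp: rep_zero_iff image_iff intro!: bexI[of _ 0])

lemma coef_in: "coef i y \<in> K"
  and coef_rep: "\<iota> i (coef i y) + rep i y = y"
proof -
  obtain k where k: "k \<in> K" "rep i y = \<iota> i k + y" using rep_in by blast
  have "y - rep i y = \<iota> i (- k)" using k
    by (simp add: \<iota>_minus diff_conv_add_uminus minus_add add.assoc[symmetric] del:
    add_uminus_conv_diff)
  then have *: "y - rep i y \<in> \<iota> i ` K" using k K_simps by auto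
  show "coef i y \<in> K" unfolding coef_def by (rule inv_into_into[OF *])
  show "\<iota> i (coef i y) + rep i y = y" unfolding coef_def f_inv_into_f[OF *] by simp
qed

lemma coef_eqI: "k \<in> K \<Longrightarrow> \<iota> i k + rep i y = y \<Longrightarrow> coef i y = k"
  using coef_rep[of i y] coef_in[of i y] \<iota>_inj[of i] by (metis add_right_imp_eq inj_onD)

lemma coef_add: "k \<in> K \<Longrightarrow> coef i (\<iota> i k + y) = k + coef i y"
  by (rule coef_eqI) (simp_all add: K_simps coef_in rep_add \<iota>_add add.assoc coef_rep)

lemma rep_in_F: "y \<in> F i \<Longrightarrow> rep i y \<in> F i"
  using rep_in[of i y] by (auto simp: F_simps \<iota>_in)

text \<open>An absent syllable is read as 0. Lists that begin in factor \<open>i\<close> and lists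
  that do not can then be multiplied by an element of factor \<open>i\<close> in the same
  way.\<close>

fun split_hd :: "bool \<Rightarrow> (bool \<times> 'f) list \<Rightarrow> 'f \<times> (bool \<times> 'f) list" where
  "split_hd i [] = (0, [])"
| "split_hd i ((j, t) # l) = (if i = j then (t, l) else (0, (j, t) # l))"

definition join_hd :: "bool \<Rightarrow> 'f \<Rightarrow> (bool \<times> 'f) list \<Rightarrow> (bool \<times> 'f) list" where
  "join_hd i t l = (if t = 0 then l else (i, t) # l)"

text \<open>The pair \<open>(c, [(i\<^sub>1, t\<^sub>1), \<dots>, (i\<^sub>n, t\<^sub>n)])\<close> encodes the normal form \<open>c t\<^sub>1 \<dots> t\<^sub>n\<close>, and
  \<open>act i a\<close> is left multiplication by \<open>a\<close>.\<close>

definition normal_forms :: "('k \<times> (bool \<times> 'f) list) set" where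
  "normal_forms = {(c, l). c \<in> K \<and> successively (\<lambda>p q. fst p \<noteq> fst q) l \<and>
     (\<forall>(i, t)\<in>set l. t \<in> F i \<and> t \<noteq> 0 \<and> rep i t = t)}"

definition act :: "bool \<Rightarrow> 'f \<Rightarrow> 'k \<times> (bool \<times> 'f) list \<Rightarrow> 'k \<times> (bool \<times> 'f) list" where
  "act i a \<omega> = (case split_hd i (snd \<omega>) of (t, l) \<Rightarrow>
     (let y = a + \<iota> i (fst \<omega>) + t in (coef i y, join_hd i (rep i y) l)))"

definition starts :: "bool \<Rightarrow> (bool \<times> 'f) list \<Rightarrow> bool" where
  "starts i l \<longleftrightarrow> l \<noteq> [] \<and> fst (hd l) = i"

text \<open>With a possibly trivial leading syllable \<open>t\<close> from factor \<open>i\<close>,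
  all forms have one shape relative to \<open>i\<close>; the proofs about \<open>act\<close> need no
  case distinction after that.\<close>

lemma normal_formsE:
  assumes "\<omega> \<in> normal_forms"
  obtains c t l where "\<omega> = (c, join_hd i t l)" "c \<in> K" "t \<in> F i" "rep i t = t"
    "(c, l) \<in> normal_forms" "\<not> starts i l"
proof (cases "starts i (snd \<omega>)")
  case True
  then obtain c t l where \<omega>: "\<omega> = (c, (i, t) # l)"
    by (cases \<omega>; cases "snd \<omega>") (auto simp: starts_def)
  with assms show thesis
    by (intro that[of c t l])
      (auto simp: normal_forms_def join_hd_def starts_def successively_Cons)
next
  case False
  then show thesis using assms
    by (intro that[of "fst \<omega>" 0 "snd \<omega>"]) (auto simp: normal_forms_def join_hd_def F_simps)
qed

lemma join_hd_normal:
  assumes "(c, l) \<in> normal_forms" "\<not> starts i l" "d \<in> K" "t \<in> F i" "rep i t = t"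
  shows "(d, join_hd i t l) \<in> normal_forms"
  using assms by (auto simp: normal_forms_def join_hd_def starts_def successively_Cons)

lemma split_join_hd: "\<not> starts i l \<Longrightarrow> split_hd i (join_hd i t l) = (t, l)"
  by (cases l rule: split_hd.cases[of "(i, l)"
    for l, simplified]) (auto simp: join_hd_def starts_def)

lemma act_join_hd:
  "\<not> starts i l \<Longrightarrow> act i a (c, join_hd i t l) =
     (coef i (a + \<iota> i c + t), join_hd i (rep i (a + \<iota> i c + t)) l)"
  by (simp add: act_def split_join_hd Let_def)

lemma act_normal:
  assumes "\<omega> \<in> normal_forms" "a \<in> F i" shows "act i a \<omega> \<in> normal_forms"
  by (rule normal_formsE[OF assms(1), of i])
    (use assms(2) in \<open>auto simp: act_join_hd \<iota>_in coef_in F_simps intro!: join_hd_normal rep_in_F\<close>)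

lemma act_add:
  assumes "\<omega> \<in> normal_forms" "a \<in> F i" "b \<in> F i"
  shows "act i (a + b) \<omega> = act i a (act i b \<omega>)"
proof -
  obtain c t l where \<omega>: "\<omega> = (c, join_hd i t l)" "\<not> starts i l"
    using normal_formsE[OF assms(1), of i] by metis
  show ?thesis unfolding \<omega> using coef_rep[of i "b + \<iota> i c + t"]
    by (simp add: act_join_hd \<omega> add.assoc)
qed

text \<open>The result does not depend on \<open>i\<close>: this makes the two factor actions agree
  on the amalgamated subgroup, so that together they respect the relations of the amalgam. The
  leading syllable is its own representative, so all of \<open>k\<close> goes into the
  coefficient.\<close>

lemma act_\<iota>:
  assumes "(c, l) \<in> normal_forms" "k \<in> K"
  shows "act i (\<iota> i k) (c, l) = (k + c, l)"
proof -
  obtain t l' where l: "l = join_hd i t l'" "\<not> starts i l'" "c \<in> K" "rep i t = t"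
    using normal_formsE[OF assms(1), of i] by (metis prod.inject)
  have *: "\<iota> i k + \<iota> i c + t = \<iota> i (k + c) + t" using assms l by (simp add: \<iota>_add)
  have "coef i t = 0" using l by (intro coef_eqI) (auto simp: K_simps)
  moreover have "k + c \<in> K" using assms l by (simp add: K_simps)
  ultimately show ?thesis unfolding l(1) using l
    by (simp add: act_join_hd * rep_add coef_add)
qed

lemma act_zero: "\<omega> \<in> normal_forms \<Longrightarrow> act i 0 \<omega> = \<omega>"
  using act_\<iota>[of "fst \<omega>" "snd \<omega>" 0 i] K_simps(1) by simp

definition act_bij :: "bool \<Rightarrow> 'f \<Rightarrow> ('k \<times> (bool \<times> 'f) list) bijection" where
  "act_bij i a = Bijection (\<lambda>\<omega>. if \<omega> \<in> normal_forms then act i a \<omega> else \<omega>)"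

lemma app_act_bij:
  assumes "a \<in> F i"
  shows "app (act_bij i a) \<omega> = (if \<omega> \<in> normal_forms then act i a \<omega> else \<omega>)"
proof -
  have *: "act i a (act i (- a) \<omega>) = \<omega>" "act i (- a) (act i a \<omega>) = \<omega>" if "\<omega> \<in> normal_forms" for \<omega>
    using that assms by (simp_all add: act_add[symmetric] F_simps act_zero)
  have "bij (\<lambda>\<omega>. if \<omega> \<in> normal_forms then act i a \<omega> else \<omega>)"
    by (rule o_bij[of "\<lambda>\<omega>. if \<omega> \<in> normal_forms then act i (- a) \<omega> else \<omega>"])
      (use assms * in \<open>auto simp: fun_eq_iff act_normal F_simps\<close>)
  then show ?thesis by (simp add: act_bij_def Bijection_inverse)
qed

lemma act_bij_add: "a \<in> F i \<Longrightarrow> b \<in> F i \<Longrightarrow> act_bij i (a + b) = act_bij i a + act_bij i b"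
  by (rule app_inject[THEN iffD1])
    (auto simp: fun_eq_iff app_act_bij F_simps act_add act_normal)

lemma act_bij_\<iota>: "k \<in> K \<Longrightarrow> act_bij i (\<iota> i k) = act_bij j (\<iota> j k)"
  by (rule app_inject[THEN iffD1]) (auto simp: fun_eq_iff app_act_bij \<iota>_in act_\<iota>)

lemma base_normal: "(0, []) \<in> normal_forms"
  by (simp add: normal_forms_def K_simps)

lemma act_bij_inj:
  assumes "a \<in> F i" "b \<in> F i" "act_bij i a = act_bij i b" shows "a = b"
proof -
  have "act i a (0, []) = act i b (0, [])"
    using arg_cong[OF assms(3), of "\<lambda>f. app f (0, [])"] base_normal
    by (simp only: app_act_bij[OF assms(1)] app_act_bij[OF assms(2)] if_True)
  then have "coef i a = coef i b" "rep i a = rep i b"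
    by (auto simp: act_def join_hd_def Let_def split: if_splits)
  then show ?thesis using coef_rep[of i a] coef_rep[of i b] by metis
qed

text \<open>The normal form theorem inside the action: each syllable outside the amalgamated
  subgroup adds exactly one entry, because the list built so far does not begin in its factor, and a
  coefficient cannot move the new syllable into the subgroup. A nonempty alternating product hence
  moves the base point \<open>(0, [])\<close> to a form with a nonempty list.\<close>

lemma app_sum_list:
  assumes "successively (\<lambda>p q. fst p \<noteq> fst q) ps"
    and "\<And>i a. (i, a) \<in> set ps \<Longrightarrow> a \<in> F i \<and> a \<notin> \<iota> i ` K"
  shows "\<exists>c l. app (sum_list (map (\<lambda>(i, a). act_bij i a) ps)) (0, []) = (c, l) \<and>
           (c, l) \<in> normal_forms \<and> map fst l = map fst ps"
  using assms
proof (induction ps)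
  case Nil
  then show ?case using base_normal by simp
next
  case (Cons p ps)
  obtain i a where p: "p = (i, a)" by force
  have a: "a \<in> F i" "a \<notin> \<iota> i ` K" using Cons.prems(2)[of i a] p by auto
  obtain c l where l: "app (sum_list (map (\<lambda>(i, a). act_bij i a) ps)) (0, []) = (c, l)"
      "(c, l) \<in> normal_forms" "map fst l = map fst ps"
    using Cons by (auto simp: successively_Cons)
  have ns: "\<not> starts i l"
  proof
    assume "starts i l"
    then have "ps \<noteq> []" "fst (hd ps) = i"
      using l(3) by (cases l; cases ps; auto simp: starts_def)+
    then show False using Cons.prems(1) p by (auto simp: successively_Cons)
  qed
  have c: "c \<in> K" using l(2) by (simp add: normal_forms_def)
  have "a + \<iota> i c \<notin> \<iota> i ` K"
    using a(2) c subgrp_add_right_iff[OF \<iota>_image, of "\<iota> i c" i a] by auto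
  then have "act i a (c, l) = (coef i (a + \<iota> i c), (i, rep i (a + \<iota> i c)) # l)"
    using act_join_hd[OF ns, of a c 0] rep_zero_iff[of i "a + \<iota> i c"] by (simp add: join_hd_def)
  moreover have "act i a (c, l) \<in> normal_forms" using act_normal l(2) a(1) .
  ultimately show ?case using l a(1) p by (simp add: app_act_bij)
qed

end

section \<open>Conjugacy in amalgamated products\<close>

text \<open>Once \<open>A\<close> and \<open>B\<close> meet in \<open>C\<close> only, a syllable
  outside \<open>C\<close> lies in exactly one factor, so membership in \<open>A\<close> alone tells
  the factors apart.\<close>

definition alternating :: "'g::group_add set \<Rightarrow> 'g set \<Rightarrow> 'g set \<Rightarrow> 'g list \<Rightarrow> bool" where
  "alternating A B C gs \<longleftrightarrow> set gs \<subseteq> (A \<union> B) - C \<and> successively (\<lambda>g h. g \<in> A \<longleftrightarrow> h \<notin> A) gs"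

lemma sum_list_rev_uminus: "sum_list (rev (map uminus gs)) = - sum_list (gs :: 'g::group_add list)"
  by (induction gs) (simp_all add: minus_add)

text \<open>Normalises group terms: differences become sums, inverses move inwards, and sums are
  associated to the right with cancellation. The simp rule \<open>add_uminus_conv_diff\<close> has
  to be deleted whenever these are used, since it would undo the first step.\<close>

lemmas group_simps = diff_conv_add_uminus minus_add minus_minus add.assoc
  minus_add_cancel add_minus_cancel left_minus right_minus add_0_left add_0_right minus_zero

lemma successively_adjacentI:
  assumes "\<And>us a b vs. xs = us @ a # b # vs \<Longrightarrow> P a b" shows "successively P xs"
  using assms
proof (induction xs rule: remdups_adj.induct)
  case (3 a b vs)
  from 3(3)[of "[]"] have "P a b" by simp
  moreover have "successively P (b # vs)"
  proof (cases "a = b")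
    case True
    then show ?thesis using 3(1) 3(3)[of "a # _"] by simp
  next
    case False
    then show ?thesis using 3(2) 3(3)[of "a # _"] by simp
  qed
  ultimately show ?case by simp
qed auto

text \<open>The normal form theorem, in the shape of \<open>alternating_sum\<close>, is all that the
  conjugacy arguments know about amalgamated products. For the presented group it is obtained from
  the action on normal forms.\<close>

locale amalgam =
  fixes A B C :: "'g::group_add set"
  assumes A: "subgrp A" and B: "subgrp B" and Int: "A \<inter> B = C"
    and alternating_sum: "alternating A B C gs \<Longrightarrow> gs \<noteq> [] \<Longrightarrow> sum_list gs \<notin> C"
begin

lemma C: "subgrp C"
  using A B Int unfolding subgrp_def by blast

lemmas ABC_simps = subgrpD[OF A] subgrpD[OF B] subgrpD[OF C]

abbreviation "alt \<equiv> alternating A B C"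

lemma C_sub: "c \<in> C \<Longrightarrow> c \<in> A" "c \<in> C \<Longrightarrow> c \<in> B"
  using Int by auto

lemma in_A_iff: "g \<in> (A \<union> B) - C \<Longrightarrow> g \<in> A \<longleftrightarrow> g \<notin> B"
  using Int by auto

lemma C_iffs:
  assumes "c \<in> C"
  shows "c + g \<in> A \<longleftrightarrow> g \<in> A" "c + g \<in> B \<longleftrightarrow> g \<in> B" "c + g \<in> C \<longleftrightarrow> g \<in> C"
    "g + c \<in> A \<longleftrightarrow> g \<in> A" "g + c \<in> B \<longleftrightarrow> g \<in> B" "g + c \<in> C \<longleftrightarrow> g \<in> C"
  using assms C_sub[OF assms]
  by (simp_all add: subgrp_add_left_iff[OF A] subgrp_add_left_iff[OF B] subgrp_add_left_iff[OF C]
      subgrp_add_right_iff[OF A] subgrp_add_right_iff[OF B] subgrp_add_right_iff[OF C])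

lemma minus_iffs: "- g \<in> A \<longleftrightarrow> g \<in> A" "- g \<in> B \<longleftrightarrow> g \<in> B" "- g \<in> C \<longleftrightarrow> g \<in> C"
  by (simp_all add: subgrp_minus_iff[OF A] subgrp_minus_iff[OF B] subgrp_minus_iff[OF C])

lemma alt_Nil [simp]: "alt []"
  by (simp add: alternating_def)

lemma alt_Cons: "alt (g # gs) \<longleftrightarrow> g \<in> (A \<union> B) - C \<and> alt gs \<and> (gs \<noteq> [] \<longrightarrow> (g \<in> A \<longleftrightarrow> hd gs \<notin> A))"
  by (auto simp: alternating_def successively_Cons)

lemma alt_append: "alt (xs @ ys) \<longleftrightarrow>
    alt xs \<and> alt ys \<and> (xs \<noteq> [] \<longrightarrow> ys \<noteq> [] \<longrightarrow> (last xs \<in> A \<longleftrightarrow> hd ys \<notin> A))"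
  by (auto simp: alternating_def successively_append_iff)

lemma alt_rev_uminus: "alt (rev (map uminus gs)) \<longleftrightarrow> alt gs"
proof -
  have "successively (\<lambda>g h. g \<in> A \<longleftrightarrow> h \<notin> A) (rev (map uminus gs)) \<longleftrightarrow>
      successively (\<lambda>g h. g \<in> A \<longleftrightarrow> h \<notin> A) gs"
    by (simp add: successively_map minus_iffs) (rule arg_cong[where f =
      "\<lambda>P. successively P gs"], auto simp: fun_eq_iff)
  then show ?thesis by (auto simp: alternating_def minus_iffs)
qed

lemma hd_rev_uminus: "gs \<noteq> [] \<Longrightarrow> hd (rev (map uminus gs)) = - last gs"
  and last_rev_uminus: "gs \<noteq> [] \<Longrightarrow> last (rev (map uminus gs)) = - hd gs"
  by (simp_all add: hd_rev last_rev last_map hd_map)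

fun chain :: "'g set \<Rightarrow> 'g list \<Rightarrow> 'g list \<Rightarrow> 'g set" where
  "chain Q (u # us) (v # vs) = chain (C \<inter> (\<lambda>q. - u + q + v) ` Q) us vs"
| "chain Q _ _ = Q"

text \<open>The sum \<open>- sum_list us + c + sum_list vs\<close> equals \<open>d\<close>, an
  element of \<open>C\<close>, so it cannot be a nonempty alternating product. Hence the middle
  piece \<open>- u + c + v\<close> formed from the two leading syllables lies in \<open>C\<close>;
  it takes over the role of \<open>c\<close> for the remaining syllables.\<close>

lemma alt_sum_eqD:
  assumes "alt us" "alt vs" "c \<in> C" "d \<in> C" "c \<in> Q" "c + sum_list vs = sum_list us + d"
  shows "list_all2 (\<lambda>u v. u \<in> A \<longleftrightarrow> v \<in> A) us vs \<and> d \<in> chain Q us vs"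
  using assms
proof (induction us arbitrary: vs c Q)
  case Nil
  have "sum_list vs = - c + (c + sum_list vs)" by simp
  then have "sum_list vs = - c + d" using Nil.prems(6) by simp
  then have "sum_list vs \<in> C" using Nil.prems by (simp add: ABC_simps)
  then have "vs = []" using alternating_sum[OF Nil.prems(2)] by blast
  then show ?case using Nil.prems by simp
next
  case (Cons u us)
  have u: "u \<in> (A \<union> B) - C" "alt us" "us \<noteq> [] \<Longrightarrow> u \<in> A \<longleftrightarrow> hd us \<notin> A"
    using Cons.prems(1) by (auto simp: alt_Cons)
  show ?case
  proof (cases vs)
    case Nil
    then have "sum_list (u # us) = c - d" using Cons.prems(6) by (simp add: eq_diff_eq)
    then have "sum_list (u # us) \<in> C" using Cons.prems by (simp add: ABC_simps)
    then show ?thesis using alternating_sum[OF Cons.prems(1)] by blast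
  next
    case (Cons v vs')
    have v: "v \<in> (A \<union> B) - C" "alt vs'" "vs' \<noteq> [] \<Longrightarrow> v \<in> A \<longleftrightarrow> hd vs' \<notin> A"
      using Cons.prems(2) Cons by (auto simp: alt_Cons)
    let ?r = "rev (map uminus us)"
    have r: "alt ?r" "?r \<noteq> [] \<longleftrightarrow> us \<noteq> []" "us \<noteq> [] \<Longrightarrow> last ?r = - hd us"
      using u(2) by (simp_all add: alt_rev_uminus last_rev_uminus)
    define e where "e = - u + c + v"
    have cv: "c + (v + sum_list vs') = u + (sum_list us + d)"
      using Cons.prems(6) Cons by (simp add: add.assoc)
    have sum: "- sum_list us + (e + sum_list vs') = d"
      by (simp add: e_def add.assoc cv)
    have same: "u \<in> A \<longleftrightarrow> v \<in> A"
    proof (rule ccontr)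
      assume diff: "\<not> (u \<in> A \<longleftrightarrow> v \<in> A)"
      \<comment> \<open>If \<open>u\<close> and \<open>v\<close> came from different factors,
        nothing would merge except \<open>c\<close> into \<open>v\<close>, and the whole list would
        be alternating.\<close>
      have "alt (?r @ [- u, c + v] @ vs')"
        using u v r diff Cons.prems(3)
        by (auto simp: alt_append alt_Cons C_iffs minus_iffs)
      moreover have "sum_list (?r @ [- u, c + v] @ vs') = d"
        using sum by (simp add: sum_list_rev_uminus e_def add.assoc)
      ultimately show False using alternating_sum Cons.prems(4) by fastforce
    qed
    have eAB: "e \<in> A \<union> B" "v \<in> A \<Longrightarrow> e \<in> A" "v \<notin> A \<Longrightarrow> e \<in> B"
      using same u v C_sub[OF Cons.prems(3)] unfolding e_def
      by (auto simp: ABC_simps)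
    have e: "e \<in> C"
    proof (rule ccontr)
      assume ne: "e \<notin> C"
      then have "e \<in> A \<longleftrightarrow> v \<in> A" using eAB Int by auto
      then have "alt (?r @ [e] @ vs')"
        using u v r same ne eAB by (auto simp: alt_append alt_Cons minus_iffs)
      moreover have "sum_list (?r @ [e] @ vs') = d"
        using sum by (simp add: sum_list_rev_uminus)
      ultimately show False using alternating_sum Cons.prems(4) by fastforce
    qed
    have "e + sum_list vs' = sum_list us + d"
      using sum by (metis add_minus_cancel)
    from Cons.IH[OF u(2) v(2) e Cons.prems(4) _ this, of "C \<inter> (\<lambda>q. - u + q + v) ` Q"]
    show ?thesis using e same Cons.prems(5) Cons by (auto simp: e_def)
  qed
qed

lemma alt_sum_in_factor:
  assumes "alt gs" "sum_list gs \<in> A \<union> B" shows "length gs \<le> 1"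
proof (rule ccontr)
  assume *: "\<not> length gs \<le> 1"
  then have "sum_list gs \<notin> C" using alternating_sum[OF assms(1)] by fastforce
  then have "alt [sum_list gs]" using assms(2) by (simp add: alt_Cons)
  then have "list_all2 (\<lambda>u v. u \<in> A \<longleftrightarrow> v \<in> A) gs [sum_list gs]"
    using alt_sum_eqD[OF assms(1), of _ 0 0 UNIV] subgrp_zero[OF C] by simp
  then show False using * by (auto dest: list_all2_lengthD)
qed

definition cyc :: "'g list \<Rightarrow> bool" where
  "cyc gs \<longleftrightarrow> alt gs \<and> gs \<noteq> [] \<and> (hd gs \<in> A \<longleftrightarrow> last gs \<notin> A)"

lemma cyc_rotate1:
  assumes "cyc gs" shows "cyc (rotate1 gs)"
proof -
  obtain a zs where gs: "gs = a # zs" using assms by (cases gs) (auto simp: cyc_def)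
  have zs: "zs \<noteq> []" using assms gs by (auto simp: cyc_def)
  then have "alt zs" "a \<in> (A \<union> B) - C" "a \<in> A \<longleftrightarrow> hd zs \<notin> A" "a \<in> A \<longleftrightarrow> last zs \<notin> A"
    using assms unfolding gs by (simp_all add: cyc_def alt_Cons) blast+
  then have "alt (zs @ [a])" using zs by (simp add: alt_append alt_Cons)
  moreover have "hd (zs @ [a]) \<in> A \<longleftrightarrow> last (zs @ [a]) \<notin> A"
    using zs \<open>a \<in> A \<longleftrightarrow> hd zs \<notin> A\<close> by simp
  ultimately show ?thesis by (simp add: cyc_def gs)
qed

lemma cyc_rotate: "cyc gs \<Longrightarrow> cyc (rotate n gs)"
  by (induction n) (auto simp: cyc_rotate1)

lemma cyc_length: "cyc gs \<Longrightarrow> 2 \<le> length gs"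
  by (cases gs rule: remdups_adj.cases) (auto simp: cyc_def)

lemma rotate_snoc: "rotate (length xs) (xs @ [x]) = x # xs"
  by (metis append_Cons append_Nil rotate_append)

text \<open>By \<open>alt_sum_eqD\<close> an element determines the number of its syllables and the
  factor of each. The lemma excludes the forms that arise when a conjugator fails to cancel: they
  begin and end in the same factor.\<close>

lemma not_both_ends:
  assumes "alt gs" "3 \<le> length gs" "hd gs \<in> A \<longleftrightarrow> last gs \<in> A"
    and "sum_list gs \<in> A \<union> B \<or> (\<exists>us. cyc us \<and> sum_list us = sum_list gs)"
  shows False
  using assms(4)
proof
  assume "sum_list gs \<in> A \<union> B"
  then show False using alt_sum_in_factor[OF assms(1)] assms(2) by simp
next
  assume "\<exists>us. cyc us \<and> sum_list us = sum_list gs"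
  then obtain us where us: "cyc us" "sum_list us = sum_list gs" by blast
  then have *: "list_all2 (\<lambda>u v. u \<in> A \<longleftrightarrow> v \<in> A) us gs"
    using alt_sum_eqD[of us gs 0 0 UNIV] assms(1) ABC_simps by (auto simp: cyc_def)
  have len: "length us = length gs" using * by (rule list_all2_lengthD)
  have ne: "us \<noteq> []" "gs \<noteq> []" using us assms(2) by (auto simp: cyc_def)
  have "hd us \<in> A \<longleftrightarrow> hd gs \<in> A" "last us \<in> A \<longleftrightarrow> last gs \<in> A"
    using list_all2_nthD[OF *, of 0] list_all2_nthD[OF *, of "length us - 1"] len ne
    by (auto simp: hd_conv_nth last_conv_nth)
  then show False using us(1) assms(3) by (auto simp: cyc_def)
qed

text \<open>Induction on the syllables of the conjugator. As \<open>vs\<close> has its ends in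
  different factors, the first syllable \<open>h\<close> meets one end of \<open>vs\<close> in its
  own factor. The two must combine to an element \<open>e\<close> of \<open>C\<close>, since
  otherwise \<open>u\<close> would have an alternating form with both ends in one factor. Absorbing
  \<open>h\<close> then amounts to moving that end of \<open>vs\<close> to the other side, and the
  conjugator gets shorter.\<close>

theorem cyc_conjugate:
  assumes "cyc vs" "alt hs" "c \<in> C"
    and "u = - (c + sum_list hs) + sum_list vs + (c + sum_list hs)"
    and "u \<in> A \<union> B \<or> (\<exists>us. cyc us \<and> sum_list us = u)"
  shows "\<exists>c\<in>C. \<exists>k. u = - c + sum_list (rotate k vs) + c"
  using assms
proof (induction hs arbitrary: vs c)
  case Nil
  then show ?case by (auto intro!: bexI[of _ c] exI[of _ 0])
next
  case (Cons h hs)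
  have h: "h \<in> (A \<union> B) - C" "alt hs" "hs \<noteq> [] \<Longrightarrow> h \<in> A \<longleftrightarrow> hd hs \<notin> A"
    using Cons.prems(2) by (auto simp: alt_Cons)
  let ?r = "rev (map uminus hs)"
  have r: "alt ?r" "?r \<noteq> [] \<longleftrightarrow> hs \<noteq> []" "hs \<noteq> [] \<Longrightarrow> last ?r = - hd hs" "hs \<noteq> [] \<Longrightarrow> hd ?r = - last hs"
    using h(2) by (simp_all add: alt_rev_uminus last_rev_uminus hd_rev_uminus)
  have ch: "c + h \<in> (A \<union> B) - C" "c + h \<in> A \<longleftrightarrow> h \<in> A" using h(1) Cons.prems(3) by (auto simp: C_iffs)
  have len: "2 \<le> length vs" using Cons.prems(1) by (rule cyc_length)
  show ?case
  proof (cases "h \<in> A \<longleftrightarrow> hd vs \<in> A")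
    case True
    obtain v vt where vs: "vs = v # vt" "vt \<noteq> []"
      using len by (cases vs rule: remdups_adj.cases) auto
    have v: "v \<in> (A \<union> B) - C" "alt vt" "v \<in> A \<longleftrightarrow> hd vt \<notin> A" "v \<in> A \<longleftrightarrow> last vt \<notin> A"
      using Cons.prems(1) vs by (auto simp: cyc_def alt_Cons)
    define e where "e = - (c + h) + v"
    have eAB: "e \<in> A \<union> B" "v \<in> A \<Longrightarrow> e \<in> A" "v \<notin> A \<Longrightarrow> e \<in> B"
      using True vs v ch unfolding e_def by (auto simp: ABC_simps simp del: minus_add)
    have e: "e \<in> C"
    proof (rule ccontr)
      assume ne: "e \<notin> C"
      then have eA: "e \<in> A \<longleftrightarrow> v \<in> A" using eAB Int by auto
      let ?L = "?r @ [e] @ vt @ [c + h] @ hs"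
      have alt: "alt ?L"
        using r v ch h ne eAB eA True vs by (auto simp: alt_append alt_Cons minus_iffs)
      have sum: "sum_list ?L = u"
        by (simp add: Cons.prems(4) sum_list_rev_uminus e_def vs group_simps del:
          add_uminus_conv_diff)
      \<comment> \<open>For nonempty \<open>hs\<close> the ends are \<open>- last hs\<close> and
        \<open>last hs\<close>; for empty \<open>hs\<close> they are \<open>e\<close> and
        \<open>c + h\<close>.\<close>
      have "hd ?L \<in> A \<longleftrightarrow> last ?L \<in> A"
        using r eA ch True vs by (cases "hs = []") (auto simp: minus_iffs)
      moreover have "3 \<le> length ?L" using vs by (cases vt) auto
      ultimately show False using not_both_ends[OF alt] Cons.prems(5) sum by auto
    qed
    have chv: "c + h = v - e" by (simp add: e_def algebra_simps)
    have "u = - (- e + sum_list hs) + sum_list (rotate1 vs) + (- e + sum_list hs)"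
      unfolding Cons.prems(4) vs
        by (simp add: add.assoc[symmetric] chv) (simp add: group_simps del: add_uminus_conv_diff)
    from Cons.IH[OF cyc_rotate1[OF Cons.prems(1)] h(2) _ this Cons.prems(5)] e
    obtain d k where "d \<in> C" "u = - d + sum_list (rotate k (rotate1 vs)) + d"
      by (auto simp: ABC_simps)
    then show ?thesis by (metis rotate1_rotate_swap rotate_Suc)
  next
    case False
    obtain w vi where "vs = vi @ [w]" using len by (cases vs rule: rev_cases) auto
    then have vs: "vs = vi @ [w]" "vi \<noteq> []" using len by auto
    have v: "w \<in> (A \<union> B) - C" "alt vi" "w \<in> A \<longleftrightarrow> last vi \<notin> A" "w \<in> A \<longleftrightarrow> hd vi \<notin> A"
      using Cons.prems(1) vs by (auto simp: cyc_def alt_Cons alt_append)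
    have hw: "h \<in> A \<longleftrightarrow> w \<in> A" using False v vs by auto
    define e where "e = w + (c + h)"
    have eAB: "e \<in> A \<union> B" "w \<in> A \<Longrightarrow> e \<in> A" "w \<notin> A \<Longrightarrow> e \<in> B"
      using hw v ch unfolding e_def by (auto simp: ABC_simps)
    have e: "e \<in> C"
    proof (rule ccontr)
      assume ne: "e \<notin> C"
      then have eA: "e \<in> A \<longleftrightarrow> w \<in> A" using eAB Int by auto
      let ?L = "?r @ [- (c + h)] @ vi @ [e] @ hs"
      have "- (c + h) \<in> (A \<union> B) - C" "- (c + h) \<in> A \<longleftrightarrow> h \<in> A"
        using ch by (auto simp: minus_iffs simp del: minus_add)
      then have alt: "alt ?L"
        using r v h ne eAB eA hw vs
          by (auto simp: alt_append alt_Cons minus_iffs simp del: minus_add)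
      have sum: "sum_list ?L = u"
        by (simp add: Cons.prems(4) sum_list_rev_uminus e_def vs group_simps del:
          add_uminus_conv_diff)
      have "hd ?L \<in> A \<longleftrightarrow> last ?L \<in> A"
        using r eA ch hw vs by (cases "hs = []") (auto simp: minus_iffs simp del: minus_add)
      moreover have "3 \<le> length ?L" using vs by (cases vi) auto
      ultimately show False using not_both_ends[OF alt] Cons.prems(5) sum by auto
    qed
    have chv: "c + h = - w + e" by (simp add: e_def add.assoc[symmetric])
    \<comment> \<open>Rotation by \<open>length vi\<close> moves the last syllable to the front and
      thus inverts \<open>rotate1\<close>.\<close>
    have rot: "rotate (length vi) vs = w # vi" using vs rotate_snoc by simp
    have "u = - (e + sum_list hs) + sum_list (rotate (length vi) vs) + (e + sum_list hs)"
      unfolding rot unfolding Cons.prems(4) vs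
      by (simp add: add.assoc[symmetric] chv) (simp add: group_simps del: add_uminus_conv_diff)
    from Cons.IH[OF cyc_rotate[OF Cons.prems(1)] h(2) e this Cons.prems(5)]
    obtain d k where "d \<in> C" "u = - d + sum_list (rotate k (rotate (length vi) vs)) + d"
      by auto
    then show ?thesis by (metis rotate_rotate)
  qed
qed

text \<open>Conjugation by the first syllable, if it lies in \<open>A\<close>, keeps
  \<open>u\<close> in \<open>A\<close> outside \<open>C\<close>. The remaining syllables and their
  inverses then surround a single syllable and form an alternating list of odd length, which has its
  sum in a factor only if nothing remains. If the first syllable lies in \<open>B\<close>, all
  syllables surround one from \<open>A\<close> in this way, which is impossible.\<close>

lemma factor_conjugate:
  assumes "u \<in> A" and "\<And>a. a \<in> A \<Longrightarrow> - a + u + a \<notin> C"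
    and "alt hs" "c \<in> C" "h = c + sum_list hs" "- h + u + h \<in> A \<union> B"
  shows "h \<in> A"
proof (cases hs)
  case Nil
  then show ?thesis using assms C_sub by simp
next
  case (Cons h1 hs')
  have h1: "h1 \<in> (A \<union> B) - C" "alt hs'" "hs' \<noteq> [] \<Longrightarrow> h1 \<in> A \<longleftrightarrow> hd hs' \<notin> A"
    using assms(3) Cons by (auto simp: alt_Cons)
  show ?thesis
  proof (cases "h1 \<in> A")
    case True
    let ?a = "c + h1" and ?r = "rev (map uminus hs')"
    have a: "?a \<in> A" using True assms(4) by (simp add: C_iffs)
    let ?L = "?r @ [- ?a + u + ?a] @ hs'"
    have "- ?a + u + ?a \<in> A - C" using assms(2)[OF a] subgrpD[OF A] a assms(1)
      by (simp del: minus_add)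
    then have alt: "alt ?L"
      using h1 True
        by (auto simp: alt_append alt_Cons alt_rev_uminus last_rev_uminus minus_iffs simp del:
        minus_add)
    have "sum_list ?L = - h + u + h" using assms(5) Cons
      by (simp add: sum_list_rev_uminus group_simps del: add_uminus_conv_diff)
    then have "length ?L \<le> 1" using alt_sum_in_factor[OF alt] assms(6) by simp
    then have "hs' = []" by (cases hs') auto
    then show ?thesis using assms(5) Cons a by simp
  next
    case False
    let ?r = "rev (map uminus hs)"
    let ?L = "?r @ [- c + u + c] @ hs"
    have "- c + u + c \<in> A - C"
      using assms(2)[OF C_sub(1)[OF assms(4)]] subgrpD[OF A] assms(1) C_sub(1)[OF assms(4)] by simp
    then have alt: "alt ?L"
      using assms(3) Cons False
        by (auto simp: alt_append alt_Cons alt_rev_uminus last_rev_uminus minus_iffs)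
    have "sum_list ?L = - h + u + h" using assms(5)
      by (simp add: sum_list_rev_uminus group_simps del: add_uminus_conv_diff)
    then have "length ?L \<le> 1" using alt_sum_in_factor[OF alt] assms(6) by simp
    then show ?thesis using Cons by simp
  qed
qed

text \<open>The first syllable moves \<open>u\<close> out of \<open>C\<close>, but not out of the
  factor of that syllable. The remaining syllables then surround a proper syllable as in
  \<open>factor_conjugate\<close>, so the conjugator has at most one syllable.\<close>

lemma amalgamated_conjugate:
  assumes "u \<in> C" and "\<And>a. a \<in> (A \<union> B) - C \<Longrightarrow> - a + u + a \<notin> C"
    and "alt hs" "c \<in> C" "h = c + sum_list hs" "- h + u + h \<in> A \<union> B"
  shows "h \<in> A \<union> B"
proof (cases hs)
  case Nil
  then show ?thesis using assms C_sub by simp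
next
  case (Cons h1 hs')
  have h1: "h1 \<in> (A \<union> B) - C" "alt hs'" "hs' \<noteq> [] \<Longrightarrow> h1 \<in> A \<longleftrightarrow> hd hs' \<notin> A"
    using assms(3) Cons by (auto simp: alt_Cons)
  let ?a = "c + h1" and ?r = "rev (map uminus hs')"
  have a: "?a \<in> (A \<union> B) - C" "?a \<in> A \<longleftrightarrow> h1 \<in> A" using h1 assms(4) by (auto simp: C_iffs)
  let ?e = "- ?a + u + ?a"
  let ?L = "?r @ [?e] @ hs'"
  have e: "?e \<in> (A \<union> B) - C" "?a \<in> A \<Longrightarrow> ?e \<in> A" "?a \<in> B \<Longrightarrow> ?e \<in> B"
    using assms(2)[OF a(1)] subgrpD[OF A] subgrpD[OF B] C_sub[OF assms(1)] a(1)
      by (auto simp del: minus_add)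
  then have "?e \<in> A \<longleftrightarrow> h1 \<in> A" using a Int by auto
  then have alt: "alt ?L"
    using h1 e
      by (auto simp: alt_append alt_Cons alt_rev_uminus last_rev_uminus minus_iffs simp del:
      minus_add)
  have "sum_list ?L = - h + u + h" using assms(5) Cons
    by (simp add: sum_list_rev_uminus group_simps del: add_uminus_conv_diff)
  then have "length ?L \<le> 1" using alt_sum_in_factor[OF alt] assms(6) by simp
  then have "hs' = []" by (cases hs') auto
  then show ?thesis using assms(5) Cons a by simp
qed

section \<open>Existence of alternating and cyclically alternating forms\<close>

definition U :: "'g set" where
  "U = sum_list ` lists (A \<union> B)"

lemma U: "subgrp U"
  unfolding subgrp_def
proof (intro conjI ballI)
  show "0 \<in> U" unfolding U_def by (rule image_eqI[of _ _ "[]"]) auto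
next
  fix a b assume "a \<in> U" "b \<in> U"
  then obtain xs ys where "a = sum_list xs" "b = sum_list ys" "xs \<in> lists (A \<union> B)"
    "ys \<in> lists (A \<union> B)"
    by (auto simp: U_def)
  then show "a + b \<in> U" unfolding U_def by (intro image_eqI[of _ _ "xs @ ys"]) auto
next
  fix a assume "a \<in> U"
  then obtain xs where "a = sum_list xs" "xs \<in> lists (A \<union> B)" by (auto simp: U_def)
  then show "- a \<in> U" unfolding U_def
    by (intro image_eqI[of _ _ "rev (map uminus xs)"])
      (auto simp: sum_list_rev_uminus minus_iffs in_lists_conv_set)
qed

lemma AB_sub_U: "A \<union> B \<subseteq> U"
proof
  fix x assume "x \<in> A \<union> B" then show "x \<in> U" unfolding U_def by (intro image_eqI[of _ _ "[x]"]) auto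
qed

lemma sum_list_in_U: "gs \<in> lists (A \<union> B) \<Longrightarrow> sum_list gs \<in> U"
  by (simp add: U_def)

text \<open>A syllable in \<open>C\<close> could be merged with any neighbour, and so could two
  neighbours from one factor. The last assumption deals with a single syllable, which has no
  neighbour.\<close>

lemma alt_unmergeable:
  assumes "gs \<in> lists (A \<union> B)" "\<And>us a b vs. gs = us @ a # b # vs \<Longrightarrow> a + b \<notin> A \<union> B"
    and "length gs \<noteq> 1 \<or> sum_list gs \<notin> C"
  shows "alt gs"
proof -
  have AB: "a \<in> A \<union> B" if "a \<in> set gs" for a using that assms(1) by (auto simp: in_lists_conv_set)
  have "a \<notin> C" if "a \<in> set gs" for a
  proof
    assume "a \<in> C"
    obtain us vs where gs: "gs = us @ a # vs" using split_list[OF \<open>a \<in> set gs\<close>] by blast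
    show False
    proof (cases vs)
      case (Cons b vs')
      then show False using assms(2)[of us a b vs'] gs \<open>a \<in> C\<close> AB[of b] by (auto simp: C_iffs)
    next
      case Nil
      show False
      proof (cases us rule: rev_cases)
        case Nil
        then show False using assms(3) gs \<open>vs = []\<close> \<open>a \<in> C\<close> by simp
      next
        case (snoc us' b)
        then show False using assms(2)[of us' b a vs] gs \<open>a \<in> C\<close> AB[of b] by (auto simp: C_iffs)
      qed
    qed
  qed
  moreover have "successively (\<lambda>g h. g \<in> A \<longleftrightarrow> h \<notin> A) gs"
  proof (rule successively_adjacentI)
    fix us a b vs assume gs: "gs = us @ a # b # vs"
    have "a \<in> A \<union> B" "b \<in> A \<union> B" using AB gs by auto
    then show "a \<in> A \<longleftrightarrow> b \<notin> A" using assms(2)[OF gs] by (auto simp: ABC_simps)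
  qed
  ultimately show ?thesis using AB by (auto simp: alternating_def)
qed

lemma alt_form:
  assumes "g \<in> U" "g \<notin> C" obtains gs where "alt gs" "gs \<noteq> []" "sum_list gs = g"
proof -
  let ?P = "\<lambda>gs. gs \<in> lists (A \<union> B) \<and> sum_list gs = g"
  obtain gs0 where "?P gs0" using assms(1) by (auto simp: U_def)
  from ex_has_least_nat[of ?P gs0 length, OF this]
  obtain gs where gs: "?P gs" "\<And>gs'. ?P gs' \<Longrightarrow> length gs \<le> length gs'" by blast
  have "alt gs"
  proof (rule alt_unmergeable)
    show "length gs \<noteq> 1 \<or> sum_list gs \<notin> C" using gs(1) assms(2) by simp
    fix us a b vs assume *: "gs = us @ a # b # vs"
    show "a + b \<notin> A \<union> B"
    proof
      assume "a + b \<in> A \<union> B"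
      then have "?P (us @ (a + b) # vs)" using gs(1) * by (auto simp: add.assoc)
      from gs(2)[OF this] show False using * by simp
    qed
  qed (use gs in simp)
  moreover have "gs \<noteq> []" using gs(1) assms(2) ABC_simps by auto
  ultimately show thesis using that gs by blast
qed

lemma alt_form':
  assumes "g \<in> U" obtains c gs where "c \<in> C" "alt gs" "g = c + sum_list gs"
proof (cases "g \<in> C")
  case True then show thesis using that[of g "[]"] by simp
next
  case False then show thesis using alt_form[OF assms False] that[of 0] ABC_simps by (metis add_0)
qed

text \<open>Among all lists whose sum is conjugate to \<open>g\<close> a shortest one is taken; if
  its ends lay in one factor, a conjugation would merge them. A rotation, if necessary, brings a
  syllable from \<open>A\<close> to the front, so that certificates have to provide for one pattern
  of factors only.\<close>

lemma cyc_form: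
  assumes "g \<in> U"
  obtains x h where "x \<in> U" "g = - x + h + x" "h \<in> A \<union> B \<or> (\<exists>gs. cyc gs \<and> hd gs \<in> A \<and>
    sum_list gs = h)"
proof -
  let ?P = "\<lambda>gs. gs \<in> lists (A \<union> B) \<and> (\<exists>x\<in>U. g = - x + sum_list gs + x)"
  obtain gs0 where "gs0 \<in> lists (A \<union> B)" "sum_list gs0 = g" using assms(1) by (auto simp: U_def)
  then have "?P gs0" using subgrp_zero[OF U] by (auto intro!: bexI[of _ 0])
  from ex_has_least_nat[of ?P gs0 length, OF this]
  obtain gs where gs: "?P gs" "\<And>gs'. ?P gs' \<Longrightarrow> length gs \<le> length gs'" by blast
  then obtain x where x: "x \<in> U" "g = - x + sum_list gs + x" by blast
  show thesis
  proof (cases "length gs \<le> 1")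
    case True
    then have "sum_list gs \<in> A \<union> B" using gs(1) ABC_simps by (cases gs) auto
    then show thesis using that x by blast
  next
    case False
    have alt: "alt gs"
    proof (rule alt_unmergeable)
      show "length gs \<noteq> 1 \<or> sum_list gs \<notin> C" using False by simp
      fix us a b vs assume *: "gs = us @ a # b # vs"
      show "a + b \<notin> A \<union> B"
      proof
        assume "a + b \<in> A \<union> B"
        then have "?P (us @ (a + b) # vs)" using gs(1) * by (auto simp: add.assoc)
        from gs(2)[OF this] show False using * by simp
      qed
    qed (use gs in simp)
    obtain a zs where "gs = a # zs" "zs \<noteq> []" using False by (cases gs) auto
    then obtain b ys where ab: "gs = a # ys @ [b]" by (metis append_butlast_last_id)
    have aU: "a \<in> U" "b \<in> U" "a \<in> A \<union> B" "b \<in> A \<union> B" using gs(1) ab AB_sub_U by auto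
    have "b + a \<notin> A \<union> B"
    proof
      assume "b + a \<in> A \<union> B"
      moreover have "g = - (- a + x) + sum_list (ys @ [b + a]) + (- a + x)"
        unfolding x(2) ab by (simp add: group_simps del: add_uminus_conv_diff)
      ultimately have "?P (ys @ [b + a])" using gs(1) ab aU x(1) subgrpD[OF U]
        by (auto intro!: bexI[of _ "- a + x"])
      from gs(2)[OF this] show False using ab by simp
    qed
    then have "a \<in> A \<longleftrightarrow> b \<notin> A" using aU by (auto simp: ABC_simps)
    then have c: "cyc gs" using alt ab by (auto simp: cyc_def)
    show thesis
    proof (cases "a \<in> A")
      case True
      then have "hd gs \<in> A" using ab by simp
      then show thesis using that[OF x] c by blast
    next
      case False
      have "g = - (- a + x) + sum_list (rotate1 gs) + (- a + x)"
        unfolding x(2) ab by (simp add: group_simps del: add_uminus_conv_diff)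
      moreover have "hd (rotate1 gs) \<in> A" using alt ab False by (cases ys) (auto simp: alt_Cons)
      ultimately show thesis
        using that[of "- a + x" "sum_list (rotate1 gs)"] cyc_rotate1[OF c] subgrpD[OF U] aU x(1)
          by blast
    qed
  qed
qed

end

section \<open>Howson-type bounds in free groups\<close>

definition ball :: "('a \<Rightarrow> 'g::group_add) \<Rightarrow> 'a set \<Rightarrow> nat \<Rightarrow> 'g set" where
  "ball \<gamma> X n = ev \<gamma> ` {w \<in> words X. length w \<le> n}"

lemma in_ballI: "w \<in> words X \<Longrightarrow> length w \<le> n \<Longrightarrow> ev \<gamma> w \<in> ball \<gamma> X n"
  by (auto simp: ball_def)

lemma ball_mono: "m \<le> n \<Longrightarrow> ball \<gamma> X m \<subseteq> ball \<gamma> X n"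
  by (auto simp: ball_def)

lemma ball_add: "a \<in> ball \<gamma> X m \<Longrightarrow> b \<in> ball \<gamma> X n \<Longrightarrow> a + b \<in> ball \<gamma> X (m + n)"
proof -
  assume "a \<in> ball \<gamma> X m" "b \<in> ball \<gamma> X n"
  then obtain u v where "u \<in> words X" "length u \<le> m" "a = ev \<gamma> u" "v \<in> words X" "length v \<le> n"
    "b = ev \<gamma> v"
    by (auto simp: ball_def)
  then show ?thesis using in_ballI[of "u @ v" X "m + n" \<gamma>] by simp
qed

lemma ball_minus: "a \<in> ball \<gamma> X m \<Longrightarrow> - a \<in> ball \<gamma> X m"
proof -
  assume "a \<in> ball \<gamma> X m"
  then obtain u where "u \<in> words X" "length u \<le> m" "a = ev \<gamma> u" by (auto simp: ball_def)
  then show ?thesis using in_ballI[of "inv_word u" X m \<gamma>] by simp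
qed

lemma zero_in_ball: "0 \<in> ball \<gamma> X n"
  using in_ballI[of "[]" X n \<gamma>] by simp

text \<open>A coset is described
  by generators as \<open>q\<^sub>1 - q\<^sub>2 + q\<^sub>3 - \<dots> + q\<^sub>n\<close>; in this form the empty coset
  and the choice of a base point need no separate treatment.\<close>

definition affine :: "'g::group_add set \<Rightarrow> bool" where
  "affine Q \<longleftrightarrow> (\<forall>a\<in>Q. \<forall>b\<in>Q. \<forall>c\<in>Q. a - b + c \<in> Q)"

inductive_set affine_span :: "'g::group_add set \<Rightarrow> 'g set" for P where
  base: "p \<in> P \<Longrightarrow> p \<in> affine_span P"
| step: "a \<in> P \<Longrightarrow> b \<in> P \<Longrightarrow> c \<in> affine_span P \<Longrightarrow> a - b + c \<in> affine_span P"

lemma affineD: "affine Q \<Longrightarrow> a \<in> Q \<Longrightarrow> b \<in> Q \<Longrightarrow> c \<in> Q \<Longrightarrow> a - b + c \<in> Q"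
  by (simp add: affine_def)

lemma affine_span_mono:
  assumes "P \<subseteq> P'" shows "affine_span P \<subseteq> affine_span P'"
proof
  fix x assume "x \<in> affine_span P"
  then show "x \<in> affine_span P'"
    by induction (use assms in \<open>auto intro: affine_span.intros\<close>)
qed

lemma affine_span_subset:
  assumes "affine Q" "P \<subseteq> Q" shows "affine_span P \<subseteq> Q"
proof
  fix x assume "x \<in> affine_span P"
  then show "x \<in> Q" by induction (use assms in \<open>auto intro: affineD\<close>)
qed

lemma affine_span_right:
  "a \<in> affine_span P \<Longrightarrow> b \<in> P \<Longrightarrow> c \<in> P \<Longrightarrow> a - b + c \<in> affine_span P"
proof (induction rule: affine_span.induct)
  case (base p)
  then show ?case by (auto intro: affine_span.intros)
next
  case (step a' b' c')
  then have "a' - b' + (c' - b + c) \<in> affine_span P" by (blast intro: affine_span.step)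
  then show ?case by (simp add: group_simps del: add_uminus_conv_diff)
qed

lemma affine_span_empty: "affine_span {} = {}"
proof -
  have "False" if "x \<in> affine_span {}" for x :: 'a using that by induction auto
  then show ?thesis by blast
qed

text \<open>Generation within a ball, without a base point. A nonempty \<open>Q\<close> of this kind
  has to meet the ball, because the span of the empty set is empty; this is how the length of a
  conjugator is finally bounded.\<close>

definition bounded :: "('a \<Rightarrow> 'g::group_add) \<Rightarrow> 'a set \<Rightarrow> nat \<Rightarrow> 'g set \<Rightarrow> bool" where
  "bounded \<gamma> X n Q \<longleftrightarrow> Q \<subseteq> affine_span (Q \<inter> ball \<gamma> X n)"

lemma bounded_mono:
  assumes "bounded \<gamma> X m Q" "Q \<inter> ball \<gamma> X m \<subseteq> ball \<gamma> Y n" shows "bounded \<gamma> Y n Q"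
  using assms affine_span_mono[of "Q \<inter> ball \<gamma> X m" "Q \<inter> ball \<gamma> Y n"] by (auto simp: bounded_def)

lemma suffix_concatE:
  assumes "suffix s (concat ts)"
  obtains "s = []" | t t' ts' where "t \<in> set ts" "suffix t' t" "set ts' \<subseteq> set ts"
    "s = t' @ concat ts'"
  using assms
proof (induction ts arbitrary: thesis)
  case (Cons t ts)
  from Cons.prems(3) consider "suffix s (concat ts)" | t' where "suffix t' t" "s = t' @ concat ts"
    by (auto simp: suffix_append)
  then show ?case
  proof cases
    case 1
    show ?thesis
    proof (rule Cons.IH[OF _ _ 1])
      fix u t' ts'
      assume "u \<in> set ts" "suffix t' u" "set ts' \<subseteq> set ts" "s = t' @ concat ts'"
      then show thesis by (intro Cons.prems(2)[of u t' ts']) auto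
    qed (rule Cons.prems(1))
  next
    case 2
    then show ?thesis using Cons.prems(2)[of t t' ts] by auto
  qed
qed auto

lemma concat_words: "set ws \<subseteq> words X \<Longrightarrow> concat ws \<in> words X"
  by (induction ws) simp_all

lemma subgrp_ev_words: "subgrp (ev \<gamma> ` words X)"
  unfolding subgrp_def
proof (intro conjI ballI)
  show "0 \<in> ev \<gamma> ` words X" by (rule image_eqI[of _ _ "[]"]) auto
next
  fix a b assume "a \<in> ev \<gamma> ` words X" "b \<in> ev \<gamma> ` words X"
  then obtain u v where "a = ev \<gamma> u" "b = ev \<gamma> v" "u \<in> words X" "v \<in> words X" by auto
  then show "a + b \<in> ev \<gamma> ` words X" by (intro image_eqI[of _ _ "u @ v"]) auto
next
  fix a assume "a \<in> ev \<gamma> ` words X"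
  then obtain u where "a = ev \<gamma> u" "u \<in> words X" by auto
  then show "- a \<in> ev \<gamma> ` words X" by (intro image_eqI[of _ _ "inv_word u"]) auto
qed

text \<open>As \<open>T\<close> is closed under inverses, plain concatenations of its words already
  represent a subgroup. The words over \<open>X\<close> fill one factor of the ambient group, and
  \<open>free\<close> says that this factor is free on \<open>X\<close>.\<close>

locale free_factor =
  fixes \<gamma> :: "'a \<Rightarrow> 'g::group_add" and X :: "'a set" and T :: "'a word set" and k :: nat
  assumes finite_X: "finite X"
    and T: "T \<subseteq> words X" "\<And>t. t \<in> T \<Longrightarrow> inv_word t \<in> T" "\<And>t. t \<in> T \<Longrightarrow> length t \<le> k"
    and free: "u \<in> words X \<Longrightarrow> v \<in> words X \<Longrightarrow> ev \<gamma> u = ev \<gamma> v \<Longrightarrow> nf u = nf v"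
begin

definition A :: "'g set" where "A = ev \<gamma> ` words X"
definition C :: "'g set" where "C = ev \<gamma> ` concat ` lists T"

definition W :: "nat \<Rightarrow> nat" where "W n = card {w \<in> words X. length w \<le> n}"

lemma finite_words_le: "finite {w \<in> words X. length w \<le> n}"
  using finite_lists_length_le[of "X \<times> (UNIV :: bool set)" n] finite_X
  by (simp add: lists_eq_set Collect_conj_eq)

lemma finite_ball: "finite (ball \<gamma> X n)"
  unfolding ball_def using finite_words_le by blast

lemma A: "subgrp A"
  unfolding A_def by (rule subgrp_ev_words)

lemma concat_in_words: "ts \<in> lists T \<Longrightarrow> concat ts \<in> words X"
  using T(1) by (intro concat_words) auto

lemma inv_word_concat: "inv_word (concat ts) = concat (rev (map inv_word ts))"
  by (induction ts) auto

lemma C_sub_A: "C \<subseteq> A"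
  unfolding C_def A_def using concat_in_words by blast

lemma C: "subgrp C"
  unfolding subgrp_def
proof (intro conjI ballI)
  show "0 \<in> C" unfolding C_def
    by (rule image_eqI[of _ _ "[]"]) (auto simp: image_iff intro: bexI[of _ "[]"])
next
  fix a b assume "a \<in> C" "b \<in> C"
  then obtain xs ys where "a = ev \<gamma> (concat xs)" "b = ev \<gamma> (concat ys)" "xs \<in> lists T"
    "ys \<in> lists T"
    by (auto simp: C_def)
  then have "a + b = ev \<gamma> (concat (xs @ ys))" "xs @ ys \<in> lists T" by auto
  then show "a + b \<in> C" unfolding C_def by blast
next
  fix a assume "a \<in> C"
  then obtain xs where "a = ev \<gamma> (concat xs)" "xs \<in> lists T" by (auto simp: C_def)
  then have "- a = ev \<gamma> (concat (rev (map inv_word xs)))" "rev (map inv_word xs) \<in> lists T"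
    using T(2) by (auto simp: in_lists_conv_set simp flip: ev_inv_word inv_word_concat)
  then show "- a \<in> C" unfolding C_def by blast
qed

lemmas AC_simps = subgrpD[OF A] subgrpD[OF C]

lemma words_suffix: "w \<in> words X \<Longrightarrow> suffix s w \<Longrightarrow> s \<in> words X"
  by (auto simp: suffix_def)

text \<open>Quasiconvexity: by \<open>suffix_nfE\<close> the suffix has the value of a suffix of a
  product of words from \<open>T\<close>. The latter is again such a product, preceded by a part of
  one more word, and this part has length at most \<open>k\<close>.\<close>

lemma suffix_near_C:
  assumes "w \<in> words X" "reduced w" "ev \<gamma> w \<in> C" "suffix s w"
  shows "\<exists>t\<in>ball \<gamma> X k. - t + ev \<gamma> s \<in> C"
proof -
  obtain ts where ts: "ts \<in> lists T" "ev \<gamma> w = ev \<gamma> (concat ts)" using assms(3)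
    by (auto simp: C_def)
  have "w = nf (concat ts)"
    using free[OF assms(1) concat_in_words[OF ts(1)] ts(2)] nf_reduced[OF assms(2)] by simp
  then obtain s' where s': "suffix s' (concat ts)" "ev \<gamma> s' = ev \<gamma> s"
    using suffix_nfE[of s "concat ts" \<gamma>] assms(4) by metis
  from s'(1) show ?thesis
  proof (cases rule: suffix_concatE)
    case 1
    then show ?thesis using s'(2) zero_in_ball AC_simps by (intro bexI[of _ 0]) auto
  next
    case (2 t t' ts')
    have "ts' \<in> lists T" using 2 ts(1) by auto
    then have "ev \<gamma> (concat ts') \<in> C" unfolding C_def by blast
    moreover have "t \<in> T" using 2(1) ts(1) by auto
    then have "ev \<gamma> t' \<in> ball \<gamma> X k"
      using T words_suffix[OF _ 2(2)] suffix_length_le[OF 2(2)]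
        by (intro in_ballI) (auto intro: order_trans)
    ultimately show ?thesis using 2(4) s'(2)[symmetric] by (intro bexI[of _ "ev \<gamma> t'"]) auto
  qed
qed

text \<open>Reading a reduced word for an element of \<open>C\<close> letter by letter and staying close to \<open>C\<close> splits
  the element into factors that lie in a fixed finite subset of \<open>C\<close>.\<close>

lemma undistorted:
  fixes D :: "nat \<Rightarrow> 'g set"
  assumes "C \<inter> ball \<gamma> X (2 * k + 1) \<subseteq> D L" "mono D"
    and add: "\<And>a b m n. a \<in> D m \<Longrightarrow> b \<in> D n \<Longrightarrow> a + b \<in> D (m + n)"
  shows "C \<inter> ball \<gamma> X n \<subseteq> D (L * (n + 1))"
proof -
  have *: "c \<in> D (L * (length w + 1))"
    if "w \<in> words X" "\<And>s. suffix s w \<Longrightarrow> \<exists>t\<in>ball \<gamma> X k. - t + ev \<gamma> s \<in> C"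
      "t \<in> ball \<gamma> X k" "c \<in> C" "ev \<gamma> w = t + c" for w t c
    using that
  proof (induction w arbitrary: t c rule: list.induct)
    case Nil
    have "c = - t" using Nil.prems by (simp add: minus_unique)
    then have "c \<in> ball \<gamma> X (2 * k + 1)"
      using ball_minus[OF Nil.prems(3)] ball_mono[of k "2 * k + 1" \<gamma> X] by auto
    then show ?case using assms(1) Nil.prems(4) by auto
  next
    case (Cons p w)
    obtain s where s: "s \<in> ball \<gamma> X k" "- s + ev \<gamma> w \<in> C"
      using Cons.prems(2)[of w] by (auto simp: suffix_Cons)
    define d where "d = - s + ev \<gamma> w"
    have d: "d \<in> D (L * (length w + 1))"
    proof (rule Cons.IH[OF _ _ s(1)])
      show "d \<in> C" using s(2) by (simp add: d_def)
      show "ev \<gamma> w = s + d" by (simp add: d_def)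
    qed (use Cons.prems in \<open>auto simp: suffix_Cons\<close>)
    have "c = - t + ev \<gamma> (p # w)" unfolding Cons.prems(5) by simp
    also have "\<dots> = - t + (ev \<gamma> [p] + ev \<gamma> w)" by (subst ev_Cons) simp
    finally have "c - d = - t + ev \<gamma> [p] + s"
      by (simp add: d_def group_simps del: add_uminus_conv_diff)
    moreover have "ev \<gamma> [p] \<in> ball \<gamma> X 1" using Cons.prems(1) by (intro in_ballI) auto
    \<comment> \<open>Passing from one vertex near \<open>C\<close> to the next costs
      \<open>k\<close> for each of the two detours and one letter; hence the radius
      \<open>2 * k + 1\<close>.\<close>
    ultimately have "c - d \<in> ball \<gamma> X (2 * k + 1)"
      using ball_add[OF ball_add[OF ball_minus[of t \<gamma> X k]] s(1), of "ev \<gamma> [p]" 1] Cons.prems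
        by (simp add: mult_2)
    then have "c - d \<in> D L" using assms(1) Cons.prems(4) s(2) AC_simps by (auto simp: d_def)
    from add[OF this d] show ?case by simp
  qed
  show ?thesis
  proof
    fix c assume c: "c \<in> C \<inter> ball \<gamma> X n"
    then obtain w where w: "w \<in> words X" "length w \<le> n" "c = ev \<gamma> w" by (auto simp: ball_def)
    have "c \<in> D (L * (length (nf w) + 1))"
      by (rule *[of _ 0])
        (use c w nf_in_words[OF w(1)] suffix_near_C[OF nf_in_words[OF w(1)]] zero_in_ball in auto)
    then show "c \<in> D (L * (n + 1))"
      using monoD[OF assms(2), of "L * (length (nf w) + 1)" "L * (n + 1)"] length_nf[of w] w(2)
        by auto
  qed
qed

text \<open>A ball is finite, so an increasing cover of \<open>C\<close> exhausts the part of
  \<open>C\<close> in it at some stage, which is not computed.\<close>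

lemma undistorted_constant:
  fixes D :: "nat \<Rightarrow> 'g set"
  assumes "C \<subseteq> (\<Union>n. D n)" "mono D"
  obtains L where "C \<inter> ball \<gamma> X n \<subseteq> D L"
proof -
  have "\<exists>L. F \<subseteq> D L" if "finite F" "F \<subseteq> C" for F
    using that
  proof (induction F)
    case (insert c F)
    then obtain L m where "F \<subseteq> D L" "c \<in> D m" using assms(1) by blast
    then have "insert c F \<subseteq> D (max L m)"
      using monoD[OF assms(2), of L "max L m"] monoD[OF assms(2), of m "max L m"] by auto
    then show ?case by blast
  qed auto
  from this[of "C \<inter> ball \<gamma> X n"] show thesis using that finite_ball by auto
qed

lemma affine_inter:
  assumes "affine Q" shows "affine (C \<inter> (\<lambda>q. g + q + h) ` Q)"
  unfolding affine_def
proof (intro ballI)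
  fix a b c assume abc: "a \<in> C \<inter> (\<lambda>q. g + q + h) ` Q" "b \<in> C \<inter> (\<lambda>q. g + q + h) ` Q"
    "c \<in> C \<inter> (\<lambda>q. g + q + h) ` Q"
  then obtain x y z where "a = g + x + h" "b = g + y + h" "c = g + z + h" and Q: "x \<in> Q" "y \<in> Q"
    "z \<in> Q" by auto
  then have "a - b + c = g + (x - y + z) + h" by (simp add: group_simps del: add_uminus_conv_diff)
  then show "a - b + c \<in> C \<inter> (\<lambda>q. g + q + h) ` Q"
    using affineD[OF assms Q] abc AC_simps by (metis IntD1 IntI image_eqI)
qed

text \<open>The counterpart of \<open>suffix_near_C\<close> for a coset. The generators spell a
  path, and a suffix that begins inside a generator differs from an element of \<open>Q\<close> by a
  part of this generator. The translation by \<open>hw\<close> is carried along because translates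
  of \<open>Q\<close> are going to be intersected with \<open>C\<close>.\<close>

lemma affine_span_word:
  assumes "affine Q" "hw \<in> words X" "a \<in> affine_span (Q \<inter> ball \<gamma> X n)"
  shows "\<exists>V\<in>words X. ev \<gamma> V = a \<and>
    (\<forall>s. suffix s (V @ hw) \<longrightarrow> (\<exists>t\<in>ball \<gamma> X (n + length hw). \<exists>q\<in>Q. ev \<gamma> s = t + q + ev \<gamma> hw))"
  using assms(3)
proof induction
  case (base p)
  then obtain V where V: "V \<in> words X" "length V \<le> n" "p = ev \<gamma> V" "p \<in> Q" by (auto simp: ball_def)
  have "\<exists>t\<in>ball \<gamma> X (n + length hw). \<exists>q\<in>Q. ev \<gamma> s = t + q + ev \<gamma> hw" if s: "suffix s (V @ hw)" for s
    using s unfolding suffix_append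
  proof
    assume "suffix s hw"
    then obtain h' where "hw = h' @ s" by (auto simp: suffix_def)
    then have "ev \<gamma> s = ev \<gamma> (inv_word h' @ inv_word V) + p + ev \<gamma> hw"
      "ev \<gamma> (inv_word h' @ inv_word V) \<in> ball \<gamma> X (n + length hw)"
      using V assms(2) by (simp add: group_simps del: add_uminus_conv_diff, intro in_ballI) auto
    then show ?thesis using V by blast
  next
    assume "\<exists>xs'. s = xs' @ hw \<and> suffix xs' V"
    then obtain p' p'' where "s = p' @ hw" "V = p'' @ p'" by (auto simp: suffix_def)
    then have "ev \<gamma> s = ev \<gamma> (inv_word p'') + p + ev \<gamma> hw"
      "ev \<gamma> (inv_word p'') \<in> ball \<gamma> X (n + length hw)"
      using V by (simp add: group_simps del: add_uminus_conv_diff, intro in_ballI) auto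
    then show ?thesis using V by blast
  qed
  then show ?case using V by blast
next
  case (step a b c)
  then obtain V where V: "V \<in> words X" "ev \<gamma> V = c"
    "\<And>s. suffix s (V @ hw) \<Longrightarrow> \<exists>t\<in>ball \<gamma> X (n + length hw). \<exists>q\<in>Q. ev \<gamma> s = t + q + ev \<gamma> hw" by auto
  obtain wa where a: "wa \<in> words X" "length wa \<le> n" "a = ev \<gamma> wa" "a \<in> Q" using step
    by (auto simp: ball_def)
  obtain wb where b: "wb \<in> words X" "length wb \<le> n" "b = ev \<gamma> wb" "b \<in> Q" using step
    by (auto simp: ball_def)
  have cQ: "c \<in> Q" using step(3) affine_span_subset[OF assms(1)] by auto
  have "\<exists>t\<in>ball \<gamma> X (n + length hw). \<exists>q\<in>Q. ev \<gamma> s = t + q + ev \<gamma> hw"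
    if s: "suffix s ((wa @ inv_word wb @ V) @ hw)" for s
  proof -
    from s consider "suffix s (V @ hw)" | s' s'' where "s = s' @ V @ hw" "inv_word wb = s'' @ s'"
      | s' s'' where "s = s' @ inv_word wb @ V @ hw" "wa = s'' @ s'"
      by (auto simp: suffix_append suffix_def append_eq_append_conv2)
    then show ?thesis
    proof cases
      case 1
      then show ?thesis by (rule V(3))
    next
      case 2
      have "length s' \<le> length (inv_word wb)" "s' \<in> words X"
        using 2(2) b(1) inv_word_in_words[of wb X]
          by (auto simp del: inv_word_in_words length_inv_word)
      then have "ev \<gamma> s' \<in> ball \<gamma> X (n + length hw)" using b(2) by (intro in_ballI) auto
      moreover have "ev \<gamma> s = ev \<gamma> s' + c + ev \<gamma> hw" using 2(1) V(2) by (simp add: add.assoc)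
      ultimately show ?thesis using cQ by blast
    next
      case 3
      \<comment> \<open>Inside the leading \<open>a\<close> the new element \<open>a - b + c\<close>
        serves as the reference point, whereas inside the inverse of \<open>b\<close> it is still
        \<open>c\<close>.\<close>
      have "a - b + c \<in> Q" using affineD[OF assms(1)] a b cQ by blast
      moreover have "ev \<gamma> (inv_word s'') \<in> ball \<gamma> X (n + length hw)"
        using 3(2) a by (intro in_ballI) auto
      moreover have "ev \<gamma> s = ev \<gamma> (inv_word s'') + (a - b + c) + ev \<gamma> hw"
        using 3 V(2) a b by (simp add: group_simps del: add_uminus_conv_diff)
      ultimately show ?thesis by blast
    qed
  qed
  moreover have "ev \<gamma> (wa @ inv_word wb @ V) = a - b + c" using a b V
    by (simp add: group_simps del: add_uminus_conv_diff)
  ultimately show ?case using a(1) b(1) V(1) by (intro bexI[of _ "wa @ inv_word wb @ V"]) auto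
qed

lemma pigeonhole_suffixes:
  assumes "finite R" "\<And>i. i \<le> card R \<Longrightarrow> \<exists>r\<in>R. P i r"
  obtains i j r where "i < j" "j \<le> card R" "r \<in> R" "P i r" "P j r"
proof -
  obtain f where f: "\<And>i. i \<le> card R \<Longrightarrow> f i \<in> R \<and> P i (f i)" using assms(2) by metis
  have "card (f ` {..card R}) \<le> card R" using f by (intro card_mono[OF assms(1)]) auto
  then have "\<not> inj_on f {..card R}" by (intro pigeonhole) auto
  then obtain i j where "i \<le> card R" "j \<le> card R" "i \<noteq> j" "f i = f j" by (auto simp: inj_on_def)
  then show thesis
    using that[of i j "f i"] that[of j i "f i"] f[of i] f[of j]
      by (cases i j rule: linorder_cases) auto
qed

text \<open>Howson's argument: two suffixes of a long reduced word that agree modulo both cosets can be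
  exchanged, which shortens the word.\<close>

lemma bounded_inter:
  assumes "affine Q" "bounded \<gamma> X n Q" "gw \<in> words X" "hw \<in> words X"
    and N: "N = 3 * (W k * W (n + length gw + length hw))"
  shows "bounded \<gamma> X N (C \<inter> (\<lambda>q. ev \<gamma> gw + q + ev \<gamma> hw) ` Q)"
proof -
  define Q' where "Q' = C \<inter> (\<lambda>q. ev \<gamma> gw + q + ev \<gamma> hw) ` Q"
  define M where "M = W k * W (n + length gw + length hw)"
  define R where "R = {w \<in> words X. length w \<le> k} \<times> {w \<in> words X. length w \<le> n + length gw + length
    hw}"
  have finR: "finite R" and cardR: "card R = M"
    unfolding R_def M_def W_def using finite_words_le by (auto simp: card_cartesian_product)
  have affQ': "affine Q'" unfolding Q'_def by (rule affine_inter[OF assms(1)])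
  have near: "\<exists>t\<in>ball \<gamma> X (n + length gw + length hw). \<exists>q\<in>Q. ev \<gamma> s = t + q + ev \<gamma> hw"
    if w: "w \<in> words X" "reduced w" "ev \<gamma> w \<in> Q'" and s: "suffix s w" for w s
  proof -
    obtain q where q: "q \<in> Q" "ev \<gamma> w = ev \<gamma> gw + q + ev \<gamma> hw" using w(3) by (auto simp: Q'_def)
    have "q \<in> affine_span (Q \<inter> ball \<gamma> X n)" using q(1) assms(2) by (auto simp: bounded_def)
    from affine_span_word[OF assms(1,4) this] obtain V where V: "V \<in> words X" "ev \<gamma> V = q"
      "\<And>s. suffix s (V @ hw) \<Longrightarrow> \<exists>t\<in>ball \<gamma> X (n + length hw). \<exists>q\<in>Q. ev \<gamma> s = t + q + ev \<gamma> hw" by auto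
    have "w = nf (gw @ V @ hw)"
      using free[of w "gw @ V @ hw"] w(1) V assms(3,4) q(2) nf_reduced[OF w(2)]
        by (simp add: add.assoc)
    then obtain s' where s': "suffix s' (gw @ V @ hw)" "ev \<gamma> s' = ev \<gamma> s"
      using suffix_nfE[of s "gw @ V @ hw" \<gamma>] s by metis
    from s'(1) consider "suffix s' (V @ hw)" | g' where "s' = g' @ V @ hw" "suffix g' gw"
      by (auto simp: suffix_append)
    then show ?thesis
    proof cases
      case 1
      from V(3)[OF this] obtain t q where "t \<in> ball \<gamma> X (n + length hw)" "q \<in> Q"
        "ev \<gamma> s' = t + q + ev \<gamma> hw" by blast
      then show ?thesis using s'(2) ball_mono[of "n + length hw" "n + length gw + length hw" \<gamma> X]
        by auto
    next
      case 2
      then have "ev \<gamma> g' \<in> ball \<gamma> X (n + length gw + length hw)"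
        using words_suffix[OF assms(3)] suffix_length_le[of g' gw] by (intro in_ballI) auto
      moreover have "ev \<gamma> s = ev \<gamma> g' + q + ev \<gamma> hw"
        using 2(1) V(2) s'(2) by (simp add: add.assoc)
      ultimately show ?thesis using q(1) by blast
    qed
  qed
  \<comment> \<open>Two suffixes \<open>a\<close> and \<open>b\<close> of length at most
    \<open>M\<close> share an offset \<open>t1\<close> from \<open>C\<close> and an offset
    \<open>t2\<close> from the translate of \<open>Q\<close>. Replacing \<open>b\<close> by
    \<open>a\<close> removes the right factor \<open>d = - ev \<gamma> a + ev \<gamma> b\<close>. It
    lies in \<open>C\<close> and is, up to conjugation by \<open>ev \<gamma> hw\<close>, a
    difference of elements of \<open>Q\<close>; so translation by \<open>d\<close> maps
    \<open>Q'\<close> into itself.\<close>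
  have cut: "\<exists>v d. v \<in> words X \<and> d \<in> ball \<gamma> X (2 * M) \<and> length v < length w \<and> ev \<gamma> v \<in> Q' \<and>
      ev \<gamma> w = ev \<gamma> v + d \<and> (\<forall>p\<in>Q'. p + d \<in> Q')"
    if w: "w \<in> words X" "reduced w" "ev \<gamma> w \<in> Q'" and len: "M < length w" for w
  proof -
    let ?s = "\<lambda>i. drop (length w - i) w"
    let ?P = "\<lambda>i (t1, t2). - ev \<gamma> t1 + ev \<gamma> (?s i) \<in> C \<and> (\<exists>q\<in>Q. ev \<gamma> (?s i) = ev \<gamma> t2 + q + ev \<gamma>
      hw)"
    have near_both: "\<exists>r\<in>R. ?P i r" for i
    proof -
      have suf: "suffix (?s i) w" by (rule suffix_drop)
      have "ev \<gamma> w \<in> C" using w(3) by (simp add: Q'_def)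
      from suffix_near_C[OF w(1,2) this suf] obtain t1
        where t1: "t1 \<in> words X" "length t1 \<le> k" "- ev \<gamma> t1 + ev \<gamma> (?s i) \<in> C"
        by (auto simp: ball_def)
      from near[OF w suf] obtain t2 q
        where "t2 \<in> words X" "length t2 \<le> n + length gw + length hw" "q \<in> Q"
          "ev \<gamma> (?s i) = ev \<gamma> t2 + q + ev \<gamma> hw"
        by (auto simp: ball_def)
      with t1 show ?thesis unfolding R_def by (intro bexI[of _ "(t1, t2)"]) blast+
    qed
    obtain i j r where ij': "i < j" "j \<le> M" "r \<in> R" "?P i r" "?P j r"
      unfolding cardR[symmetric] by (rule pigeonhole_suffixes[of R ?P, OF finR near_both])
    obtain t1 t2 where "r = (t1, t2)" by force
    with ij' have ij: "i < j" "j \<le> M" "(t1, t2) \<in> R" "?P i (t1, t2)" "?P j (t1, t2)" by blast+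
    define a where "a = ?s i"
    define b where "b = ?s j"
    define v where "v = take (length w - j) w @ a"
    have wb: "w = take (length w - j) w @ b" by (simp add: b_def)
    have in_w: "a \<in> words X" "b \<in> words X" "take (length w - j) w \<in> words X"
      using w(1) by (auto simp: a_def b_def dest: in_set_dropD in_set_takeD)
    have len_ab: "length a = i" "length b = j" using ij len by (auto simp: a_def b_def)
    define d where "d = - ev \<gamma> a + ev \<gamma> b"
    have d: "d \<in> ball \<gamma> X (2 * M)"
      using in_ballI[of "inv_word a @ b" X "2 * M" \<gamma>] in_w len_ab ij by (simp add: d_def)
    have lenv: "length v < length w" using ij len len_ab by (simp add: v_def)
    have evw: "ev \<gamma> w = ev \<gamma> v + d"
      by (subst wb) (simp add: v_def d_def group_simps del: add_uminus_conv_diff)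
    obtain q1 q2 where q: "q1 \<in> Q" "q2 \<in> Q" "ev \<gamma> a = ev \<gamma> t2 + q1 + ev \<gamma> hw"
      "ev \<gamma> b = ev \<gamma> t2 + q2 + ev \<gamma> hw"
      using ij(4,5) by (auto simp: a_def b_def)
    have dC: "d \<in> C"
    proof -
      have "- (- ev \<gamma> t1 + ev \<gamma> a) + (- ev \<gamma> t1 + ev \<gamma> b) \<in> C"
        using ij(4,5) AC_simps unfolding a_def b_def by (auto simp del: minus_add)
      then show ?thesis by (simp add: d_def group_simps del: add_uminus_conv_diff)
    qed
    have dq: "d = - ev \<gamma> hw - q1 + q2 + ev \<gamma> hw"
      unfolding d_def q by (simp add: group_simps del: add_uminus_conv_diff)
    have shift: "p + d \<in> Q'" "p - d \<in> Q'" if p: "p \<in> Q'" for p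
    proof -
      obtain q where qq: "q \<in> Q" "p = ev \<gamma> gw + q + ev \<gamma> hw" "p \<in> C" using p by (auto simp: Q'_def)
      have "p + d = ev \<gamma> gw + (q - q1 + q2) + ev \<gamma> hw" "p - d = ev \<gamma> gw + (q - q2 + q1) + ev \<gamma> hw"
        unfolding dq qq by (simp_all add: group_simps del: add_uminus_conv_diff)
      moreover have "p + d \<in> C" "p - d \<in> C"
        using AC_simps(6)[OF qq(3) dC] AC_simps(8)[OF qq(3) dC] .
      moreover have "q - q1 + q2 \<in> Q" "q - q2 + q1 \<in> Q"
        using affineD[OF assms(1)] q(1,2) qq(1) by blast+
      ultimately show "p + d \<in> Q'" "p - d \<in> Q'" unfolding Q'_def by blast+
    qed
    have "ev \<gamma> v = ev \<gamma> w - d" using evw by (simp add: eq_diff_eq)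
    then have "ev \<gamma> v \<in> Q'" using shift(2)[OF w(3)] by simp
    then show ?thesis using d lenv evw shift(1) in_w
      by (intro exI[of _ v] exI[of _ d]) (auto simp: v_def)
  qed
  have short: "\<exists>p\<in>Q'. p \<in> ball \<gamma> X M" if "w \<in> words X" "ev \<gamma> w \<in> Q'" for w
    using that
  proof (induction "length w" arbitrary: w rule: less_induct)
    case less
    have nw: "nf w \<in> words X" "ev \<gamma> (nf w) \<in> Q'" using less.prems nf_in_words by auto
    show ?case
    proof (cases "length (nf w) \<le> M")
      case True
      then show ?thesis using nw in_ballI[OF nw(1) True, of \<gamma>] by auto
    next
      case False
      then obtain v where "v \<in> words X" "length v < length (nf w)" "ev \<gamma> v \<in> Q'"
        using cut[OF nw(1) reduced_nf nw(2)] by auto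
      then show ?thesis using less.hyps[of v] length_nf[of w] by auto
    qed
  qed
  have "ev \<gamma> w \<in> affine_span (Q' \<inter> ball \<gamma> X N)" if "w \<in> words X" "ev \<gamma> w \<in> Q'" for w
    using that
  proof (induction "length w" arbitrary: w rule: less_induct)
    case less
    have nw: "nf w \<in> words X" "ev \<gamma> (nf w) \<in> Q'" using less.prems nf_in_words by auto
    \<comment> \<open>A base point \<open>p\<close> of length at most \<open>M\<close> and its
      translate \<open>p + d\<close>, with \<open>d\<close> of length at most \<open>2 * M\<close>,
      are the generators needed to recover the word from the shorter \<open>v\<close>, as
      \<open>ev \<gamma> v - p + (p + d)\<close>. This explains the factor 3.\<close>
    have N3: "N = M + 2 * M" by (simp add: N M_def)
    show ?case
    proof (cases "length (nf w) \<le> M")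
      case True
      then show ?thesis using nw in_ballI[OF nw(1), of N \<gamma>] N3 by (auto intro: affine_span.base)
    next
      case False
      then obtain v d where v: "v \<in> words X" "length v < length (nf w)" "ev \<gamma> v \<in> Q'"
        "d \<in> ball \<gamma> X (2 * M)" "ev \<gamma> (nf w) = ev \<gamma> v + d" "\<forall>p\<in>Q'. p + d \<in> Q'"
        using cut[OF nw(1) reduced_nf nw(2)] by auto
      obtain p where p: "p \<in> Q'" "p \<in> ball \<gamma> X M" using short[OF nw] by blast
      have "p + d \<in> Q' \<inter> ball \<gamma> X N" using v p ball_add[OF p(2) v(4)] N3 by auto
      moreover have "p \<in> Q' \<inter> ball \<gamma> X N" using p ball_mono[of M N \<gamma> X] N3 by auto
      moreover have "ev \<gamma> v \<in> affine_span (Q' \<inter> ball \<gamma> X N)" using less.hyps[of v] v length_nf[of w]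
        by auto
      ultimately have "ev \<gamma> v - p + (p + d) \<in> affine_span (Q' \<inter> ball \<gamma> X N)"
        by (rule_tac affine_span_right)
      then show ?thesis using v(5) by (simp add: group_simps del: add_uminus_conv_diff)
    qed
  qed
  moreover have "Q' \<subseteq> A" using C_sub_A by (auto simp: Q'_def)
  ultimately show ?thesis unfolding bounded_def Q'_def[symmetric] by (auto simp: A_def)
qed

text \<open>As long as the conjugates of \<open>u\<close> by the prefixes of \<open>g\<close> are not longer than \<open>u\<close>, two of them
  agree sooner or later; once they get longer, nothing cancels any more.\<close>

lemma conjugator_cut:
  assumes "gw \<in> words X" "reduced gw" "u \<in> words X" "m + W (length u) < length gw"
  obtains (suffix) p r where "gw = p @ r" "m < length r" "suffix r (nf (inv_word gw @ u @ gw))"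
  | (cut) p b s where "gw = p @ b @ s" "b \<noteq> []" "length (p @ b) \<le> W (length u)"
      "- ev \<gamma> p + ev \<gamma> u + ev \<gamma> p = - ev \<gamma> (p @ b) + ev \<gamma> u + ev \<gamma> (p @ b)"
proof -
  define U where "U i = nf (inv_word (take i gw) @ u @ take i gw)" for i
  have take: "take i gw \<in> words X" for i using assms(1) by (auto dest: in_set_takeD)
  have U: "U i \<in> words X" "reduced (U i)"
    "ev \<gamma> (U i) = - ev \<gamma> (take i gw) + ev \<gamma> u + ev \<gamma> (take i gw)" for i
    using take[of i] assms(3) nf_in_words[of "inv_word (take i gw) @ u @ take i gw" X]
    unfolding U_def by (simp_all add: add.assoc)
  show thesis
  proof (cases "\<exists>i\<le>W (length u). length u < length (U i)")
    case True
    \<comment> \<open>The first prefix whose conjugate is longer than \<open>u\<close>; the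
      conjugate by the prefix before it is still at most as long as \<open>u\<close>.\<close>
    define i where "i = (LEAST i. i \<le> W (length u) \<and> length u < length (U i))"
    have i: "i \<le> W (length u)" "length u < length (U i)"
      using LeastI_ex[of "\<lambda>i. i \<le> W (length u) \<and> length u < length (U i)"] True unfolding i_def
        by auto
    have "i \<noteq> 0" using i(2) length_nf[of u] by (auto simp: U_def intro: Nat.gr0I)
    then obtain j where j: "i = Suc j" by (cases i) auto
    have Uj: "length (U j) \<le> length u"
      using not_less_Least[of j "\<lambda>i. i \<le> W (length u) \<and> length u < length (U i)"] i(1) j
        unfolding i_def by auto
    have jl: "j < length gw" using i j assms(4) by simp
    define y where "y = gw ! j"
    define r' where "r' = drop (Suc j) gw"
    have gw: "gw = take j gw @ y # r'" "take i gw = take j gw @ [y]"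
      using jl by (simp_all add: y_def r'_def id_take_nth_drop j take_Suc_conv_app_nth)
    have yX: "y \<in> X \<times> UNIV" using assms(1) jl by (auto simp: y_def in_lists_conv_set)
    define V where "V = U j"
    have Ui: "U i = nf (inv_letter y # V @ [y])"
    proof -
      have "ev \<gamma> (U i) = ev \<gamma> (inv_letter y # V @ [y])"
        unfolding U(3) V_def gw(2) using ev_Cons[of \<gamma> "inv_letter y" "U j @ [y]"]
        by (simp add: U(3) ev_inv_letter group_simps del: add_uminus_conv_diff)
      moreover have "inv_letter y # V @ [y] \<in> words X"
        using U(1)[of j] yX inv_letter_in_iff[of y X] by (simp add: V_def del: inv_letter_in_iff)
      ultimately have "nf (U i) = nf (inv_letter y # V @ [y])" using free U(1)[of i] by blast
      then show ?thesis using nf_reduced[OF U(2)[of i]] by simp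
    qed
    have V: "reduced V" "V \<noteq> []" using U(2)[of j] i(2) Ui
      by (auto simp: V_def nf_Cons)
    \<comment> \<open>If \<open>V\<close> began with \<open>y\<close> or ended with its inverse,
      conjugation by \<open>y\<close> would not lengthen it. Hence nothing cancels in
      \<open>inv_word r @ V @ r\<close>: both junctions are reduced, and so is \<open>r\<close> as a
      part of \<open>gw\<close>.\<close>
    have hdV: "hd V \<noteq> y"
    proof
      assume "hd V = y"
      then obtain V' where V': "V = y # V'" using V(2) by (cases V) auto
      have "ev \<gamma> (U i) = ev \<gamma> (V' @ [y])"
        unfolding Ui V'
          by (simp add: ev_Cons[of \<gamma> _ "_ # _"] ev_Cons[of \<gamma> _ "V' @ [y]"] ev_inv_letter)
      moreover have "V' @ [y] \<in> words X" using U(1)[of j] V' yX by (simp add: V_def[symmetric])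
      ultimately have "U i = nf (V' @ [y])"
        using free[of "U i" "V' @ [y]"] U(1)[of i] nf_reduced[OF U(2)[of i]] by simp
      then show False using length_nf[of "V' @ [y]"] i(2) Uj V' by (simp add: V_def[symmetric])
    qed
    have lastV: "last V \<noteq> inv_letter y"
    proof
      assume "last V = inv_letter y"
      then obtain V' where V': "V = V' @ [inv_letter y]" using V(2)
        by (metis append_butlast_last_id)
      have "ev \<gamma> (U i) = ev \<gamma> (inv_letter y # V')"
        unfolding Ui V' ev_nf
          by (simp add: ev_Cons[of \<gamma> _ "_ @ _"] ev_Cons[of \<gamma> _ "V'"] ev_Cons[of \<gamma> _
          "[_]"] ev_inv_letter add.assoc)
      moreover have "inv_letter y # V' \<in> words X" using U(1)[of j] V' yX
        by (simp add: V_def[symmetric])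
      ultimately have "U i = nf (inv_letter y # V')"
        using free[of "U i" "inv_letter y # V'"] U(1)[of i] nf_reduced[OF U(2)[of i]] by simp
      then show False using length_nf[of "inv_letter y # V'"] i(2) Uj V'
        by (simp add: V_def[symmetric])
    qed
    define r where "r = y # r'"
    have r: "gw = take j gw @ r" "reduced r" using gw(1) assms(2) reduced_appendD2[of "take j gw" r]
      by (simp_all add: r_def)
    have red_inv: "reduced (inv_word r)"
    proof -
      have "successively (\<lambda>p q. inv_letter p \<noteq> q) r"
        using r(2) unfolding reduced_def by (rule successively_mono) auto
      then show ?thesis unfolding reduced_def inv_word_def successively_rev successively_map
        by (rule successively_mono) auto
    qed
    have "reduced (inv_word r @ V @ r)"
    proof -
      have "y \<noteq> inv_letter (last V)" using lastV by (metis inv_letter_inv_letter)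
      then have "reduced (V @ r)" using V(1) r(2)
        by (simp add: reduced_def successively_append_iff r_def)
      moreover have "last (inv_word r) = inv_letter y" by (simp add: inv_word_def r_def)
      ultimately show ?thesis using red_inv hdV V(2)
        by (simp add: reduced_def successively_append_iff)
    qed
    moreover have "nf (inv_word gw @ u @ gw) = nf (inv_word r @ V @ r)"
    proof (rule free)
      show "inv_word gw @ u @ gw \<in> words X" using assms(1,3) by simp
      have "r \<in> words X" using assms(1) r(1) by (metis append_in_lists_conv)
      then show "inv_word r @ V @ r \<in> words X" using U(1)[of j] by (simp add: V_def)
      have "ev \<gamma> gw = ev \<gamma> (take j gw) + ev \<gamma> r" by (subst r(1)) simp
      then show "ev \<gamma> (inv_word gw @ u @ gw) = ev \<gamma> (inv_word r @ V @ r)"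
        by (simp add: V_def U(3) group_simps del: add_uminus_conv_diff)
    qed
    ultimately have "nf (inv_word gw @ u @ gw) = (inv_word r @ V) @ r" by (simp add: nf_reduced)
    then have "suffix r (nf (inv_word gw @ u @ gw))" by (metis suffix_def)
    moreover have "m < length r" using i(1) j assms(4) jl by (simp add: r_def r'_def)
    ultimately show thesis using suffix[OF r(1)] by blast
  next
    case False
    let ?R = "{w \<in> words X. length w \<le> length u}"
    \<comment> \<open>All conjugates by prefixes of length at most \<open>W (length u)\<close> are
      now words no longer than \<open>u\<close>, and there is one more prefix than there are such
      words.\<close>
    have ex: "\<exists>r\<in>?R. U i = r" if "i \<le> card ?R" for i
      using False that U(1)[of i] by (simp add: W_def not_less)
    obtain i j r where "i < j" "j \<le> card ?R" "U i = r" "U j = r"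
      by (rule pigeonhole_suffixes[of ?R "\<lambda>i r. U i = r", OF finite_words_le ex])
    then have ij: "i < j" "j \<le> W (length u)" "U i = U j" by (simp_all add: W_def)
    have tj: "take j gw = take i gw @ drop i (take j gw)"
      using ij(1) by (metis append_take_drop_id less_imp_le min.absorb1 take_take)
    show thesis
    proof (rule cut[of "take i gw" "drop i (take j gw)" "drop j gw"])
      show "gw = take i gw @ drop i (take j gw) @ drop j gw"
        using tj by (metis append.assoc append_take_drop_id)
      show "drop i (take j gw) \<noteq> []" using ij assms(4) by simp
      show "length (take i gw @ drop i (take j gw)) \<le> W (length u)"
        using ij by (simp add: tj[symmetric])
      show "- ev \<gamma> (take i gw) + ev \<gamma> u + ev \<gamma> (take i gw) =
          - ev \<gamma> (take i gw @ drop i (take j gw)) + ev \<gamma> u + ev \<gamma> (take i gw @ drop i (take j gw))"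
        unfolding tj[symmetric] using U(3)[of i] U(3)[of j] ij(3) by simp
    qed
  qed
qed

lemma shortest_word:
  assumes "g \<in> A" "P g"
  obtains w where "w \<in> words X" "reduced w" "P (ev \<gamma> w)"
    "\<And>v. v \<in> words X \<Longrightarrow> P (ev \<gamma> v) \<Longrightarrow> length w \<le> length v"
proof -
  obtain w0 where "w0 \<in> words X \<and> P (ev \<gamma> w0)" using assms by (auto simp: A_def)
  from ex_has_least_nat[of "\<lambda>w. w \<in> words X \<and> P (ev \<gamma> w)" w0 length, OF this]
  obtain w where w: "w \<in> words X" "P (ev \<gamma> w)"
    "\<And>v. v \<in> words X \<Longrightarrow> P (ev \<gamma> v) \<Longrightarrow> length w \<le> length v" by blast
  show thesis
    using that[of "nf w"] w nf_in_words[OF w(1)] order_trans[OF length_nf w(3)] by simp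
qed

text \<open>\<open>D = {}\<close> concerns arbitrary conjugators, \<open>D = C\<close> those outside
  \<open>C\<close>. Let \<open>w\<close> be a shortest one. If its long tail is a suffix of a
  reduced word for an element of \<open>C\<close>, the tail is within \<open>k\<close> of
  \<open>C\<close>, and multiplying \<open>w\<close> on the right by an element of \<open>C\<close>
  shortens it. If a piece \<open>b\<close> can be cut out, the shorter conjugator must lie in
  \<open>D = C\<close> by minimality. Then \<open>u\<close> lies in \<open>C\<close>, and the
  element \<open>p @ b @ inv_word p\<close> commutes with \<open>u\<close> and is itself a
  conjugator outside \<open>C\<close>; its length explains the term
  \<open>2 * W (length u)\<close>.\<close>

lemma short_conjugator_into_C:
  assumes "u \<in> words X" "g \<in> A" "g \<notin> D" "- g + ev \<gamma> u + g \<in> C" "D = {} \<or> D = C"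
  shows "\<exists>h\<in>ball \<gamma> X (k + 2 * W (length u)). h \<notin> D \<and> - h + ev \<gamma> u + h \<in> C"
proof -
  let ?P = "\<lambda>g. g \<notin> D \<and> - g + ev \<gamma> u + g \<in> C"
  obtain w where w: "w \<in> words X" "reduced w" "?P (ev \<gamma> w)"
    "\<And>v. v \<in> words X \<Longrightarrow> ?P (ev \<gamma> v) \<Longrightarrow> length w \<le> length v"
    using shortest_word[of g ?P] assms(2-4) by blast
  show ?thesis
  proof (cases "k + W (length u) < length w")
    case False
    then show ?thesis using w in_ballI[OF w(1), of "k + 2 * W (length u)" \<gamma>] by auto
  next
    case True
    from w(1,2) assms(1) True show ?thesis
    proof (cases rule: conjugator_cut)
      case (suffix p r)
      have rX: "r \<in> words X" "p \<in> words X" using suffix w(1) by auto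
      have "ev \<gamma> (nf (inv_word w @ u @ w)) \<in> C" using w(3) by (simp add: add.assoc)
      from suffix_near_C[OF nf_in_words reduced_nf this suffix(3)] w(1) assms(1)
      obtain t where t: "t \<in> words X" "length t \<le> k" "- ev \<gamma> t + ev \<gamma> r \<in> C"
        by (auto simp: ball_def)
      define c where "c = - ev \<gamma> t + ev \<gamma> r"
      have pt: "ev \<gamma> (p @ t) = ev \<gamma> w - c" using suffix(1)
        by (simp add: c_def group_simps del: add_uminus_conv_diff)
      have "ev \<gamma> w - c \<notin> D"
      proof
        assume *: "ev \<gamma> w - c \<in> D"
        then have "D = C" using assms(5) by auto
        then have "ev \<gamma> w - c + c \<in> C" using * t(3) AC_simps unfolding c_def by blast
        then show False using w(3) \<open>D = C\<close> by simp
      qed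
      moreover have "- (ev \<gamma> w - c) + ev \<gamma> u + (ev \<gamma> w - c) = c + (- ev \<gamma> w + ev \<gamma> u + ev \<gamma> w) - c"
        by (simp add: group_simps del: add_uminus_conv_diff)
      then have "- (ev \<gamma> w - c) + ev \<gamma> u + (ev \<gamma> w - c) \<in> C"
        using w(3) t(3) AC_simps unfolding c_def by metis
      ultimately have "length w \<le> length (p @ t)" using w(4)[of "p @ t"] rX t pt
        by (simp del: ev_append minus_diff_eq)
      then show ?thesis using suffix(1,2) t(2) by simp
    next
      case (cut p b s)
      have X: "p \<in> words X" "b \<in> words X" "s \<in> words X" using cut w(1) by auto
      have "- ev \<gamma> (p @ s) + ev \<gamma> u + ev \<gamma> (p @ s) = - ev \<gamma> s + (- ev \<gamma> p + ev \<gamma> u + ev \<gamma> p) + ev \<gamma>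
        s"
        by (simp add: group_simps del: add_uminus_conv_diff)
      also have "\<dots> = - ev \<gamma> w + ev \<gamma> u + ev \<gamma> w"
        unfolding cut(4) using cut(1) by (simp add: group_simps del: add_uminus_conv_diff)
      finally have conj: "- ev \<gamma> (p @ s) + ev \<gamma> u + ev \<gamma> (p @ s) \<in> C" using w(3) by simp
      have "length (p @ s) < length w" using cut(1,2) by simp
      then have psD: "ev \<gamma> (p @ s) \<in> D" using w(4)[of "p @ s"] X conj
        by (meson append_in_lists_conv leD)
      then have D: "D = C" using assms(5) by auto
      define h where "h = ev \<gamma> (p @ b @ inv_word p)"
      have hw: "h = ev \<gamma> w - ev \<gamma> (p @ s)" using cut(1)
        by (simp add: h_def group_simps del: add_uminus_conv_diff)
      have "h \<notin> C"
      proof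
        assume "h \<in> C"
        then have "h + ev \<gamma> (p @ s) \<in> C" using psD D AC_simps by blast
        then show False using w(3) D hw by simp
      qed
      have "- h + ev \<gamma> u + h = ev \<gamma> p + (- ev \<gamma> (p @ b) + ev \<gamma> u + ev \<gamma> (p @ b)) - ev \<gamma> p"
        by (simp add: h_def group_simps del: add_uminus_conv_diff)
      also have "\<dots> = ev \<gamma> u" unfolding cut(4)[symmetric]
        by (simp add: group_simps del: add_uminus_conv_diff)
      finally have hu: "- h + ev \<gamma> u + h = ev \<gamma> u" .
      have "ev \<gamma> u = ev \<gamma> (p @ s) + (- ev \<gamma> (p @ s) + ev \<gamma> u + ev \<gamma> (p @ s)) - ev \<gamma> (p @ s)"
        by (simp add: group_simps del: add_uminus_conv_diff)
      then have "ev \<gamma> u \<in> C" using psD conj D AC_simps by metis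
      moreover have "h \<in> ball \<gamma> X (k + 2 * W (length u))"
        unfolding h_def using cut(3) X by (intro in_ballI) auto
      ultimately show ?thesis using \<open>h \<notin> C\<close> D hu by (intro bexI[of _ h]) auto
    qed
  qed
qed

text \<open>A long tail of a shortest conjugator would be a suffix of the normal form of
  \<open>v\<close>, hence no longer than \<open>v\<close>; a repetition among the conjugates by
  prefixes could be cut out.\<close>

lemma short_conjugator:
  assumes "u \<in> words X" "v \<in> words X" "g \<in> A" "- g + ev \<gamma> u + g = ev \<gamma> v"
  shows "\<exists>h\<in>ball \<gamma> X (length v + W (length u)). - h + ev \<gamma> u + h = ev \<gamma> v"
proof -
  let ?P = "\<lambda>g. - g + ev \<gamma> u + g = ev \<gamma> v"
  obtain w where w: "w \<in> words X" "reduced w" "?P (ev \<gamma> w)"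
    "\<And>v. v \<in> words X \<Longrightarrow> ?P (ev \<gamma> v) \<Longrightarrow> length w \<le> length v"
    using shortest_word[of g ?P] assms(3,4) by blast
  show ?thesis
  proof (cases "length v + W (length u) < length w")
    case False
    then show ?thesis using w in_ballI[OF w(1), of "length v + W (length u)" \<gamma>] by auto
  next
    case True
    from w(1,2) assms(1) True show ?thesis
    proof (cases rule: conjugator_cut)
      case (suffix p r)
      have "nf (inv_word w @ u @ w) = nf v"
        using w(1,3) assms by (intro free) (auto simp: add.assoc)
      then have "length r \<le> length v" using suffix_length_le[OF suffix(3)] length_nf[of v] by simp
      then show ?thesis using suffix(2) by simp
    next
      case (cut p b s)
      have X: "p \<in> words X" "b \<in> words X" "s \<in> words X" using cut w(1) by auto
      have "- ev \<gamma> (p @ s) + ev \<gamma> u + ev \<gamma> (p @ s) = - ev \<gamma> s + (- ev \<gamma> p + ev \<gamma> u + ev \<gamma> p) + ev \<gamma>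
        s"
        by (simp add: group_simps del: add_uminus_conv_diff)
      also have "\<dots> = - ev \<gamma> w + ev \<gamma> u + ev \<gamma> w"
        unfolding cut(4) using cut(1) by (simp add: group_simps del: add_uminus_conv_diff)
      finally have "?P (ev \<gamma> (p @ s))" using w(3) by simp
      then have "length w \<le> length (p @ s)" using w(4)[of "p @ s"] X by (meson append_in_lists_conv)
      then show ?thesis using cut(1,2) by simp
    qed
  qed
qed

end

section \<open>Recursive functions and recursively enumerable predicates\<close>

definition p1 :: "nat \<Rightarrow> nat" where "p1 n = fst (prod_decode n)"
definition p2 :: "nat \<Rightarrow> nat" where "p2 n = snd (prod_decode n)"
abbreviation pair :: "nat \<Rightarrow> nat \<Rightarrow> nat" where "pair a b \<equiv> prod_encode (a, b)"

lemma p1_pr [simp]: "p1 (pair a b) = a" and p2_pr [simp]: "p2 (pair a b) = b"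
  by (simp_all add: p1_def p2_def)

lemma pr_p1_p2 [simp]: "pair (p1 n) (p2 n) = n"
  by (simp add: p1_def p2_def)

definition computable :: "(nat \<Rightarrow> nat) \<Rightarrow> bool" where
  "computable f \<longleftrightarrow> partial_recursive (\<lambda>n. Some (f n))"

named_theorems computable_intros

lemma computable_comp: "computable f \<Longrightarrow> computable g \<Longrightarrow> computable (\<lambda>n. f (g n))"
  using partial_recursive.comp[of "\<lambda>n. Some (f n)" "\<lambda>n. Some (g n)"]
  by (simp add: computable_def map_comp_def)

lemma computable_pr [computable_intros]: "computable f \<Longrightarrow> computable g \<Longrightarrow>
  computable (\<lambda>n. pair (f n) (g n))"
  using partial_recursive.pair[of "\<lambda>n. Some (f n)" "\<lambda>n. Some (g n)"] by (simp add: computable_def)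

lemma computable_p1 [computable_intros]: "computable f \<Longrightarrow> computable (\<lambda>n. p1 (f n))"
  using computable_comp[of p1 f] partial_recursive.left by (simp add: computable_def p1_def)

lemma computable_p2 [computable_intros]: "computable f \<Longrightarrow> computable (\<lambda>n. p2 (f n))"
  using computable_comp[of p2 f] partial_recursive.right by (simp add: computable_def p2_def)

lemma computable_id [computable_intros]: "computable (\<lambda>n. n)"
proof -
  have "computable p1" "computable p2"
    using partial_recursive.left partial_recursive.right
      by (simp_all add: computable_def p1_def p2_def)
  from computable_pr[OF this] show ?thesis by simp
qed

lemma computable_Suc [computable_intros]: "computable f \<Longrightarrow> computable (\<lambda>n. Suc (f n))"
  using computable_comp[of Suc f] partial_recursive.succ by (simp add: computable_def)

lemma computable_const [computable_intros]: "computable (\<lambda>n. c)"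
proof (induction c)
  case 0
  show ?case using partial_recursive.zero by (simp add: computable_def)
qed (rule computable_Suc)

text \<open>Arguments are packed into nested pairs: \<open>p1 m\<close> is the parameter,
  \<open>p1 (p2 m)\<close> the counter and \<open>p2 (p2 m)\<close> the previous value. The rules
  for folds use the same packing, with the list entry in place of the counter.\<close>

lemma computable_rec_nat [computable_intros]:
  assumes "computable a" "computable k" "computable (\<lambda>m. g (p1 m) (p1 (p2 m)) (p2 (p2 m)))"
  shows "computable (\<lambda>n. rec_nat (a n) (g n) (k n))"
proof -
  define g' where "g' = (\<lambda>m. g (p1 m) (p1 (p2 m)) (p2 (p2 m)))"
  have "rec_nat (Some (a b)) (\<lambda>i r. Option.bind r (\<lambda>y. Some (g' (pair b (pair i y))))) n
      = Some (rec_nat (a b) (g b) n)" for b n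
    by (induction n) (simp_all add: g'_def)
  then have "(\<lambda>n. case prod_decode n of (b, k) \<Rightarrow>
      rec_nat (Some (a b)) (\<lambda>i r. Option.bind r (\<lambda>y. Some (g' (pair b (pair i y))))) k)
      = (\<lambda>n. Some (rec_nat (a (p1 n)) (g (p1 n)) (p2 n)))"
    by (auto simp: fun_eq_iff p1_def p2_def split: prod.split)
  then have "computable (\<lambda>n. rec_nat (a (p1 n)) (g (p1 n)) (p2 n))"
    using partial_recursive.prim_rec[of "\<lambda>n. Some (a n)" "\<lambda>n. Some (g' n)"] assms
    by (simp add: computable_def g'_def[symmetric])
  from computable_comp[OF this computable_pr[OF computable_id assms(2)]] show ?thesis by simp
qed

lemma computable_plus [computable_intros]:
  assumes "computable f" "computable g" shows "computable (\<lambda>n. f n + g n)"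
proof -
  have "rec_nat a (\<lambda>_ y. Suc y) b = a + b" for a b by (induction b) auto
  moreover have "computable (\<lambda>n. rec_nat (f n) (\<lambda>_ y. Suc y) (g n))"
    by (intro computable_intros assms)
  ultimately show ?thesis by simp
qed

lemma computable_times [computable_intros]:
  assumes "computable f" "computable g" shows "computable (\<lambda>n. f n * g n)"
proof -
  have "rec_nat 0 (\<lambda>_ y. y + a) b = a * b" for a b :: nat by (induction b) auto
  moreover have "computable (\<lambda>n. rec_nat 0 (\<lambda>_ y. y + f n) (g n))"
    by (intro computable_intros computable_comp[OF assms(1)] assms)
  ultimately show ?thesis by simp
qed

lemma computable_minus [computable_intros]:
  assumes "computable f" "computable g" shows "computable (\<lambda>n. f n - g n)"
proof -
  have pred: "rec_nat 0 (\<lambda>i _. i) b = b - 1" for b by (cases b) auto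
  have "rec_nat a (\<lambda>_ y. rec_nat 0 (\<lambda>i _. i) y) b = a - b" for a b
    by (induction b) (auto simp: pred)
  moreover have "computable (\<lambda>n. rec_nat (f n) (\<lambda>_ y. rec_nat 0 (\<lambda>i _. i) y) (g n))"
    by (intro computable_intros assms)
  ultimately show ?thesis by simp
qed

section \<open>Decidable predicates\<close>

definition decidable :: "(nat \<Rightarrow> bool) \<Rightarrow> bool" where
  "decidable P \<longleftrightarrow> computable (\<lambda>n. of_bool (P n))"

lemma decidable_comp: "decidable P \<Longrightarrow> computable f \<Longrightarrow> decidable (\<lambda>n. P (f n))"
  unfolding decidable_def by (rule computable_comp)

lemma computable_If [computable_intros]:
  assumes "decidable P" "computable f" "computable g"
    shows "computable (\<lambda>n. if P n then f n else g n)"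
proof -
  have "computable (\<lambda>n. rec_nat (g n) (\<lambda>_ _. f n) (of_bool (P n)))"
    using assms(1)
      by (intro computable_intros computable_comp[OF assms(2)] assms(3)) (simp_all add:
      decidable_def)
  also have "(\<lambda>n. rec_nat (g n) (\<lambda>_ _. f n) (of_bool (P n))) = (\<lambda>n. if P n then f n else g n)"
    by auto
  finally show ?thesis .
qed

lemma decidable_const [computable_intros]: "decidable (\<lambda>n. b)"
  unfolding decidable_def by (rule computable_const)

lemma decidable_zero [computable_intros]: "computable f \<Longrightarrow> decidable (\<lambda>n. f n = 0)"
proof -
  assume "computable f"
  then have "computable (\<lambda>n. 1 - f n)" by (intro computable_intros)
  also have "(\<lambda>n. 1 - f n) = (\<lambda>n. of_bool (f n = 0))" by auto
  finally show ?thesis by (simp add: decidable_def)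
qed

lemma decidable_not [computable_intros]: "decidable P \<Longrightarrow> decidable (\<lambda>n. \<not> P n)"
  using decidable_zero[of "\<lambda>n. of_bool (P n)"] by (simp add: decidable_def)

lemma decidable_conj [computable_intros]: "decidable P \<Longrightarrow> decidable Q \<Longrightarrow> decidable (\<lambda>n. P n \<and> Q n)"
  using computable_times[of "\<lambda>n. of_bool (P n)" "\<lambda>n. of_bool (Q n)"]
    by (simp add: decidable_def of_bool_conj)

lemma decidable_disj [computable_intros]: "decidable P \<Longrightarrow> decidable Q \<Longrightarrow> decidable (\<lambda>n. P n \<or> Q n)"
  using decidable_not[OF decidable_conj[OF decidable_not[of P] decidable_not[of Q]]] by simp

lemma decidable_imp [computable_intros]: "decidable P \<Longrightarrow> decidable Q \<Longrightarrow> decidable (\<lambda>n. P n \<longrightarrow> Q n)"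
  unfolding imp_conv_disj by (intro decidable_disj decidable_not)

lemma decidable_eq [computable_intros]:
  assumes "computable f" "computable g" shows "decidable (\<lambda>n. f n = g n)"
proof -
  have "decidable (\<lambda>n. (f n - g n) + (g n - f n) = 0)" using assms by (intro computable_intros)
  also have "(\<lambda>n. (f n - g n) + (g n - f n) = 0) = (\<lambda>n. f n = g n)" by auto
  finally show ?thesis .
qed

lemma decidable_ball [computable_intros]:
  assumes "computable b" "decidable (\<lambda>m. P (p1 m) (p2 m))" shows "decidable (\<lambda>n. \<forall>k<b n. P n k)"
proof -
  have *: "rec_nat 1 (\<lambda>i y. y * of_bool (P n i)) k = (of_bool (\<forall>i<k. P n i) :: nat)" for n k
    by (induction k) (auto simp: less_Suc_eq)
  have "computable (\<lambda>m. of_bool (P (p1 m) (p2 m)))" using assms(2) by (simp add: decidable_def)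
  from computable_comp[OF this, of "\<lambda>m. pair (p1 m) (p1 (p2 m))"]
  have "computable (\<lambda>m. of_bool (P (p1 m) (p1 (p2 m))))" by (simp add: computable_intros)
  then have "computable (\<lambda>n. rec_nat 1 (\<lambda>i y. y * of_bool (P n i)) (b n))"
    by (intro computable_intros assms(1))
  then show ?thesis unfolding * decidable_def .
qed

lemma decidable_finite [computable_intros]:
  assumes "computable f" "finite S" shows "decidable (\<lambda>n. f n \<in> S)"
  using assms(2)
proof induction
  case (insert x S)
  then have "decidable (\<lambda>n. f n = x \<or> f n \<in> S)" by (intro computable_intros assms(1))
  then show ?case by simp
qed (simp add: decidable_const)

section \<open>Computable functions on lists\<close>

definition computable_list :: "(nat \<Rightarrow> nat list) \<Rightarrow> bool" where
  "computable_list F \<longleftrightarrow> computable (\<lambda>n. list_encode (F n))"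

lemma computable_list_comp: "computable_list F \<Longrightarrow> computable f \<Longrightarrow> computable_list (\<lambda>n. F (f n))"
  unfolding computable_list_def by (rule computable_comp)

lemma computable_list_const [computable_intros]: "computable_list (\<lambda>n. l)"
  unfolding computable_list_def by (rule computable_const)

lemma computable_list_Cons [computable_intros]: "computable f \<Longrightarrow> computable_list F \<Longrightarrow>
  computable_list (\<lambda>n. f n # F n)"
  unfolding computable_list_def by (auto intro!: computable_intros)

lemma computable_list_list_decode [computable_intros]:
  "computable f \<Longrightarrow> computable_list (\<lambda>n. list_decode (f n))"
  by (simp add: computable_list_def)

lemma computable_list_encode [computable_intros]: "computable_list F \<Longrightarrow>
  computable (\<lambda>n. list_encode (F n))"
  by (simp add: computable_list_def)

lemma decidable_list_eq [computable_intros]: "computable_list F \<Longrightarrow> computable_list G \<Longrightarrow>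
  decidable (\<lambda>n. F n = G n)"
  using decidable_eq[of "\<lambda>n. list_encode (F n)" "\<lambda>n. list_encode (G n)"]
  by (simp add: computable_list_def list_encode_eq)

lemma computable_list_If [computable_intros]:
  "decidable P \<Longrightarrow> computable_list F \<Longrightarrow> computable_list G \<Longrightarrow> computable_list (\<lambda>n. if P n then F n else G
    n)"
  unfolding computable_list_def by (simp add: if_distrib computable_If)

definition hd0 :: "nat list \<Rightarrow> nat" where
  "hd0 l = (case l of [] \<Rightarrow> 0 | x # _ \<Rightarrow> x)"

lemma prod_decode_0: "prod_decode 0 = (0, 0)"
  using prod_encode_inverse[of "(0, 0)"] by (simp add: prod_encode_def)

lemma computable_hd0 [computable_intros]:
  assumes "computable_list F" shows "computable (\<lambda>n. hd0 (F n))"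
proof -
  have "p1 (list_encode l - 1) = hd0 l" for l
    by (cases l) (auto simp: hd0_def p1_def prod_decode_0)
  moreover have "computable (\<lambda>n. p1 (list_encode (F n) - 1))" using assms
    by (intro computable_intros)
  ultimately show ?thesis by simp
qed

lemma computable_list_tl [computable_intros]:
  assumes "computable_list F" shows "computable_list (\<lambda>n. tl (F n))"
proof -
  have "p2 (list_encode l - 1) = list_encode (tl l)" for l
    by (cases l) (auto simp: p2_def prod_decode_0)
  moreover have "computable (\<lambda>n. p2 (list_encode (F n) - 1))" using assms
    by (intro computable_intros)
  ultimately show ?thesis by (simp add: computable_list_def)
qed

lemma length_le_list_encode: "length l \<le> list_encode l"
proof (induction l)
  case (Cons x l)
  then show ?case using le_prod_encode_2[of "list_encode l" x] by simp
qed simp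

text \<open>The state is a pair of the accumulator and the code of the remaining list. The step is
  iterated as often as the code of the list says, which is at least its length; on an empty list it
  does nothing.\<close>

lemma computable_fold [computable_intros]:
  assumes "computable_list L" "computable a" "computable (\<lambda>m. g (p1 m) (p1 (p2 m)) (p2 (p2 m)))"
  shows "computable (\<lambda>n. fold (g n) (L n) (a n))"
proof -
  define stp where "stp n s = (if list_decode (p2 s) = [] then s
    else pair (g n (hd0 (list_decode (p2 s))) (p1 s)) (list_encode (tl (list_decode (p2
      s)))))" for n s
  have "(stp n ^^ j) (pair b (list_encode l)) = pair (fold (g n) l b) 0" if "length l \<le> j"
    for n l b j
    using that
  proof (induction l arbitrary: b j)
    case Nil
    have "stp n (pair b 0) = pair b 0" by (simp add: stp_def)
    then show ?case by (induction j) auto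
  next
    case (Cons x l)
    then obtain j' where j: "j = Suc j'" "length l \<le> j'" by (cases j) auto
    have "stp n (pair b (list_encode (x # l))) = pair (g n x b) (list_encode l)"
      using list_encode_inverse[of "x # l"] by (simp add: stp_def hd0_def)
    then show ?case using Cons.IH[OF j(2)]
      by (simp add: j(1) funpow_Suc_right del: funpow.simps(2) list_encode.simps)
  qed
  moreover have "rec_nat s (\<lambda>_. f) j = (f ^^ j) s" for s j and f :: "nat \<Rightarrow> nat"
    by (induction j) auto
  ultimately have *: "p1 (rec_nat (pair (a n) (list_encode (L n))) (\<lambda>_. stp n) (list_encode (L n)))
    = fold (g n) (L n) (a n)" for n
    using length_le_list_encode by simp
  have "computable (\<lambda>m. g (p1 m) (hd0 (list_decode (p2 (p2 (p2 m))))) (p1 (p2 (p2 m))))"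
    using computable_comp[OF assms(3), of
      "\<lambda>m. pair (p1 m) (pair (hd0 (list_decode (p2 (p2 (p2 m))))) (p1 (p2 (p2 m))))"]
    by (simp add: computable_intros)
  then have "computable (\<lambda>m. stp (p1 m) (p2 (p2 m)))"
    unfolding stp_def by (intro computable_intros)
  then have "computable (\<lambda>n. p1 (rec_nat (pair (a n) (list_encode (L n))) (\<lambda>_. stp n) (list_encode
    (L n))))"
    by (intro computable_intros assms)
  then show ?thesis by (simp add: *)
qed

lemma computable_list_fold [computable_intros]:
  assumes "computable_list L" "computable_list A"
    "computable_list (\<lambda>m. g (p1 m) (p1 (p2 m)) (list_decode (p2 (p2 m))))"
  shows "computable_list (\<lambda>n. fold (g n) (L n) (A n))"
proof -
  have "fold (\<lambda>x acc. list_encode (g n x (list_decode acc))) l (list_encode a) = list_encode (fold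
    (g n) l a)" for n l a
    by (induction l arbitrary: a) auto
  moreover have "computable (\<lambda>n. fold (\<lambda>x acc. list_encode (g n x (list_decode acc))) (L n)
    (list_encode (A n)))"
    using assms by (intro computable_intros)
  ultimately show ?thesis by (simp add: computable_list_def)
qed

lemma computable_list_rec_nat [computable_intros]:
  assumes "computable_list A" "computable k"
    "computable_list (\<lambda>m. g (p1 m) (p1 (p2 m)) (list_decode (p2 (p2 m))))"
  shows "computable_list (\<lambda>n. rec_nat (A n) (g n) (k n))"
proof -
  have "rec_nat (list_encode a) (\<lambda>i acc. list_encode (g n i (list_decode acc))) j = list_encode
    (rec_nat a (g n) j)" for n a j
    by (induction j) auto
  moreover have "computable (\<lambda>n. rec_nat (list_encode (A n)) (\<lambda>i acc. list_encode (g n i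
    (list_decode acc))) (k n))"
    using assms by (intro computable_intros)
  ultimately show ?thesis by (simp add: computable_list_def)
qed

lemma computable_list_rev [computable_intros]:
  assumes "computable_list F" shows "computable_list (\<lambda>n. rev (F n))"
proof -
  have "computable_list (\<lambda>n. fold (\<lambda>x l. x # l) (F n) [])" by (intro computable_intros assms)
  then show ?thesis by (simp add: rev_conv_fold)
qed

lemma computable_list_foldr [computable_intros]:
  assumes "computable_list L" "computable_list A"
    "computable_list (\<lambda>m. g (p1 m) (p1 (p2 m)) (list_decode (p2 (p2 m))))"
  shows "computable_list (\<lambda>n. foldr (g n) (L n) (A n))"
proof -
  have "computable_list (\<lambda>n. fold (g n) (rev (L n)) (A n))" by (intro computable_intros assms)
  then show ?thesis by (simp add: foldr_conv_fold)
qed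

lemma computable_list_append [computable_intros]:
  assumes "computable_list F" "computable_list G" shows "computable_list (\<lambda>n. F n @ G n)"
proof -
  have "foldr (\<lambda>x l. x # l) xs ys = xs @ ys" for xs ys :: "nat list" by (induction xs) auto
  moreover have "computable_list (\<lambda>n. foldr (\<lambda>x l. x # l) (F n) (G n))"
    by (intro computable_intros assms)
  ultimately show ?thesis by simp
qed

lemma computable_list_map [computable_intros]:
  assumes "computable_list F" "computable (\<lambda>m. h (p1 m) (p2 m))"
    shows "computable_list (\<lambda>n. map (h n) (F n))"
proof -
  have "foldr (\<lambda>x l. h n x # l) xs [] = map (h n) xs" for n xs by (induction xs) auto
  moreover have "computable (\<lambda>m. h (p1 m) (p1 (p2 m)))"
    using computable_comp[OF assms(2), of "\<lambda>m. pair (p1 m) (p1 (p2 m))"]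
      by (simp add: computable_intros)
  then have "computable_list (\<lambda>n. foldr (\<lambda>x l. h n x # l) (F n) [])"
    by (intro computable_intros assms(1))
  ultimately show ?thesis by simp
qed

lemma computable_list_filter [computable_intros]:
  assumes "computable_list F" "decidable (\<lambda>m. P (p1 m) (p2 m))"
    shows "computable_list (\<lambda>n. filter (P n) (F n))"
proof -
  have "foldr (\<lambda>x l. if P n x then x # l else l) xs [] = filter (P n) xs" for n xs
    by (induction xs) auto
  moreover have "decidable (\<lambda>m. P (p1 m) (p1 (p2 m)))"
    using decidable_comp[OF assms(2), of "\<lambda>m. pair (p1 m) (p1 (p2 m))"]
      by (simp add: computable_intros)
  then have "computable_list (\<lambda>n. foldr (\<lambda>x l. if P n x then x # l else l) (F n) [])"
    by (intro computable_intros assms(1))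
  ultimately show ?thesis by simp
qed

lemma computable_list_concat_map [computable_intros]:
  assumes "computable_list F" "computable_list (\<lambda>m. h (p1 m) (p2 m))"
    shows "computable_list (\<lambda>n. concat (map (h n) (F n)))"
proof -
  have "foldr (\<lambda>x l. h n x @ l) xs [] = concat (map (h n) xs)" for n xs by (induction xs) auto
  moreover have "computable_list (\<lambda>m. h (p1 m) (p1 (p2 m)))"
    using computable_list_comp[OF assms(2), of "\<lambda>m. pair (p1 m) (p1 (p2 m))"]
      by (simp add: computable_intros)
  then have "computable_list (\<lambda>n. foldr (\<lambda>x l. h n x @ l) (F n) [])"
    by (intro computable_intros assms(1))
  ultimately show ?thesis by simp
qed

lemma computable_length [computable_intros]:
  assumes "computable_list F" shows "computable (\<lambda>n. length (F n))"
proof -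
  have "fold (\<lambda>x. Suc) l a = length l + a" for l :: "nat list" and a
    by (induction l arbitrary: a) auto
  moreover have "computable (\<lambda>n. fold (\<lambda>x. Suc) (F n) 0)" by (intro computable_intros assms)
  ultimately show ?thesis by simp
qed

definition nth0 :: "nat list \<Rightarrow> nat \<Rightarrow> nat" where
  "nth0 l i = (if i < length l then l ! i else 0)"

lemma computable_nth0 [computable_intros]:
  assumes "computable_list F" "computable f" shows "computable (\<lambda>n. nth0 (F n) (f n))"
proof -
  have "rec_nat l (\<lambda>_. tl) i = drop i l" for l :: "nat list" and i
    by (induction i) (simp_all add: drop_Suc tl_drop)
  moreover have "hd0 (drop i l) = nth0 l i" for i l
    by (cases "drop i l") (auto simp: hd0_def nth0_def nth_via_drop dest: drop_eq_Nil[THEN iffD2])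
  moreover have "computable (\<lambda>n. hd0 (rec_nat (F n) (\<lambda>_. tl) (f n)))"
    by (intro computable_intros assms)
  ultimately show ?thesis by simp
qed

section \<open>Enumerable predicates\<close>

definition enumerable :: "(nat \<Rightarrow> bool) \<Rightarrow> bool" where
  "enumerable P \<longleftrightarrow> (\<exists>Q. decidable Q \<and> (\<forall>n. P n \<longleftrightarrow> (\<exists>k. Q (pair n k))))"

named_theorems enumerable_intros

lemma reE:
  assumes "enumerable P" obtains Q where "decidable Q" "\<And>n. P n \<longleftrightarrow> (\<exists>k. Q (pair n k))"
  using assms unfolding enumerable_def by blast

lemma enumerable_dec: "decidable P \<Longrightarrow> enumerable P"
  unfolding enumerable_def
    by (rule exI[of _ "\<lambda>m. P (p1 m)"]) (simp add: decidable_comp computable_intros)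

lemma enumerable_ex [enumerable_intros]:
  assumes "enumerable (\<lambda>m. P (p1 m) (p2 m))" shows "enumerable (\<lambda>n. \<exists>k. P n k)"
proof -
  obtain Q where Q: "decidable Q" "\<And>m. P (p1 m) (p2 m) \<longleftrightarrow> (\<exists>k. Q (pair m k))"
    by (rule reE[OF assms]) (rule that)
  have Q': "P n k \<longleftrightarrow> (\<exists>w. Q (pair (pair n k) w))" for n k using Q(2)[of "pair n k"] by simp
  have "(\<exists>k. P n k) \<longleftrightarrow> (\<exists>j. Q (pair (pair n (p1 j)) (p2 j)))" for n
    unfolding Q' by (metis p1_pr p2_pr)
  moreover have "decidable (\<lambda>m. Q (pair (pair (p1 m) (p1 (p2 m))) (p2 (p2 m))))"
    by (intro decidable_comp[OF Q(1)] computable_intros)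
  ultimately show ?thesis unfolding enumerable_def
    by (intro exI[of _ "\<lambda>m. Q (pair (pair (p1 m) (p1 (p2 m))) (p2 (p2 m)))"]) simp
qed

lemma enumerable_conj [enumerable_intros]:
  assumes "enumerable P" "enumerable P'" shows "enumerable (\<lambda>n. P n \<and> P' n)"
proof -
  obtain Q Q' where Q: "decidable Q" "\<And>m. P m \<longleftrightarrow> (\<exists>k. Q (pair m k))"
    and Q': "decidable Q'" "\<And>m. P' m \<longleftrightarrow> (\<exists>k. Q' (pair m k))" using reE[OF assms(1)] reE[OF assms(2)]
      by metis
  have "P n \<and> P' n \<longleftrightarrow> (\<exists>j. Q (pair n (p1 j)) \<and> Q' (pair n (p2 j)))" for n
    unfolding Q(2) Q'(2) by (metis p1_pr p2_pr)
  moreover have "decidable (\<lambda>m. Q (pair (p1 m) (p1 (p2 m))) \<and> Q' (pair (p1 m) (p2 (p2 m))))"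
    by (intro decidable_conj decidable_comp[OF Q(1)] decidable_comp[OF Q'(1)] computable_intros)
  ultimately show ?thesis unfolding enumerable_def
    by (intro exI[of _ "\<lambda>m. Q (pair (p1 m) (p1 (p2 m))) \<and> Q' (pair (p1 m) (p2 (p2 m)))"]) simp
qed

lemma enumerable_disj [enumerable_intros]:
  assumes "enumerable P" "enumerable P'" shows "enumerable (\<lambda>n. P n \<or> P' n)"
proof -
  obtain Q Q' where Q: "decidable Q" "\<And>m. P m \<longleftrightarrow> (\<exists>k. Q (pair m k))"
    and Q': "decidable Q'" "\<And>m. P' m \<longleftrightarrow> (\<exists>k. Q' (pair m k))" using reE[OF assms(1)] reE[OF assms(2)]
      by metis
  have "decidable (\<lambda>m. Q m \<or> Q' m)" using Q(1) Q'(1) by (rule decidable_disj)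
  then show ?thesis unfolding enumerable_def Q(2) Q'(2) by (intro exI[of _ "\<lambda>m. Q m \<or> Q' m"]) auto
qed

text \<open>Finitely many witnesses fit into one list, so bounded universal quantifiers preserve
  enumerability. This allows certificates to contain exhaustive checks over a bounded range.\<close>

lemma enumerable_ball [enumerable_intros]:
  assumes "computable b" "enumerable (\<lambda>m. P (p1 m) (p2 m))" shows "enumerable (\<lambda>n. \<forall>k<b n. P n k)"
proof -
  obtain Q where Q: "decidable Q" "\<And>m. P (p1 m) (p2 m) \<longleftrightarrow> (\<exists>k. Q (pair m k))"
    by (rule reE[OF assms(2)]) (rule that)
  have Q': "P n k \<longleftrightarrow> (\<exists>w. Q (pair (pair n k) w))" for n k using Q(2)[of "pair n k"] by simp
  have "(\<forall>k<b n. P n k) \<longleftrightarrow> (\<exists>l. \<forall>k<b n. Q (pair (pair n k) (nth0 (list_decode l) k)))" (is "?L \<longleftrightarrow> ?R")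
    for n
  proof
    assume ?L
    then have "\<forall>k<b n. \<exists>w. Q (pair (pair n k) w)" using Q' by auto
    then obtain w where w: "\<forall>k<b n. Q (pair (pair n k) (w k))" by metis
    then show ?R by (intro exI[of _ "list_encode (map w [0..<b n])"]) (simp add: nth0_def)
  next
    assume ?R
    then show ?L using Q' by auto
  qed
  moreover have "decidable (\<lambda>m. \<forall>k<b (p1 m). Q (pair (pair (p1 m) k) (nth0 (list_decode (p2 m))
    k)))"
    by (intro computable_intros computable_comp[OF assms(1)] decidable_comp[OF Q(1)])
  ultimately show ?thesis unfolding enumerable_def
    by (intro exI[of _ "\<lambda>m. \<forall>k<b (p1 m). Q (pair (pair (p1 m) k) (nth0 (list_decode (p2 m)) k))"])
      simp
qed

text \<open>The function searches for the least pair of an answer and a witness for it and returns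
  the answer. Each single test is total, so the search halts as soon as any answer exists.\<close>

lemma enumerable_selection:
  assumes "enumerable (\<lambda>m. P (p1 m) (p2 m))"
  obtains f where "partial_recursive f" "\<And>n r. f n = Some r \<Longrightarrow> P n r" "\<And>n r. P n r \<Longrightarrow> f n \<noteq> None"
proof -
  obtain Q where Q: "decidable Q" "\<And>m. P (p1 m) (p2 m) \<longleftrightarrow> (\<exists>k. Q (pair m k))"
    by (rule reE[OF assms]) (rule that)
  define R where "R n j \<longleftrightarrow> Q (pair (pair n (p1 j)) (p2 j))" for n j
  define h where "h m = (1 - of_bool (R (p1 m) (p2 m)) :: nat)" for m
  have h: "h (pair n j) = 0 \<longleftrightarrow> R n j" for n j by (simp add: h_def)
  have "decidable (\<lambda>m. R (p1 m) (p2 m))" unfolding R_def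
    by (intro decidable_comp[OF Q(1)] computable_intros)
  then have "computable h" unfolding h_def decidable_def by (intro computable_intros)
  let ?mu = "\<lambda>n. if \<exists>j. R n j then Some (LEAST j. R n j) else None"
  have mu: "partial_recursive ?mu"
    using partial_recursive.minimise[of "\<lambda>m. Some (h m)"] \<open>computable h\<close>
      by (simp add: computable_def h cong: if_cong)
  have "partial_recursive ((\<lambda>n. Some (p1 n)) \<circ>\<^sub>m ?mu)"
    using computable_p1[OF computable_id]
      by (intro partial_recursive.comp mu) (simp add: computable_def)
  then show thesis
  proof (rule that)
    fix n r
    {
      assume "((\<lambda>n. Some (p1 n)) \<circ>\<^sub>m ?mu) n = Some r"
      then have "\<exists>j. R n j" and r: "r = p1 (LEAST j. R n j)"
        by (auto simp: map_comp_def split: if_splits)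
      then have "R n (LEAST j. R n j)" by (metis LeastI)
      then show "P n r" using Q(2)[of "pair n r"] by (auto simp: R_def r)
    }
    assume "P n r"
    then obtain k where "Q (pair (pair n r) k)" using Q(2)[of "pair n r"] by auto
    then have "R n (pair r k)" by (simp add: R_def)
    then show "((\<lambda>n. Some (p1 n)) \<circ>\<^sub>m ?mu) n \<noteq> None" by (auto simp: map_comp_def)
  qed
qed

section \<open>Coding of words\<close>

lemma words_mono: "w \<in> words Z \<Longrightarrow> Z \<subseteq> Z' \<Longrightarrow> w \<in> words Z'"
  by (auto simp: in_lists_conv_set)

locale coding =
  fixes idx :: "'a \<Rightarrow> nat" and S :: "'a set"
  assumes inj_idx: "inj_on idx S" and finite_S: "finite S"
begin

definition letter_code :: "'a \<times> bool \<Rightarrow> nat"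
  where "letter_code p = pair (idx (fst p)) (of_bool (snd p))"
definition codes :: "'a word \<Rightarrow> nat list" where "codes w = map letter_code w"
definition letter_of :: "nat \<Rightarrow> 'a \<times> bool" where "letter_of = inv_into (S \<times> UNIV) letter_code"

lemma word_code_eq: "word_code idx w = list_encode (codes w)"
  unfolding word_code_def codes_def letter_code_def by (simp add: case_prod_beta')

lemma letter_code_inj: "inj_on letter_code (S \<times> UNIV)"
  using inj_idx by (auto simp: inj_on_def letter_code_def)

lemma letter_code_eq_iff: "p \<in> S \<times> UNIV \<Longrightarrow> q \<in> S \<times> UNIV \<Longrightarrow> letter_code p = letter_code q \<longleftrightarrow> p = q"
  using letter_code_inj by (auto simp: inj_on_def)

lemma codes_inj: "u \<in> words S \<Longrightarrow> v \<in> words S \<Longrightarrow> codes u = codes v \<longleftrightarrow> u = v"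
  unfolding codes_def using inj_on_map_eq_map[of letter_code u v] letter_code_inj
  by (meson Un_least in_lists_conv_set inj_on_subset subsetI)

lemma unlc_lc: "p \<in> S \<times> UNIV \<Longrightarrow> letter_of (letter_code p) = p"
  unfolding letter_of_def by (rule inv_into_f_f[OF letter_code_inj])

lemma codes_simps [simp]: "codes [] = []" "codes (p # w) = letter_code p # codes w"
  "codes (u @ v) = codes u @ codes v"
  "length (codes w) = length w" "codes w = [] \<longleftrightarrow> w = []"
  by (simp_all add: codes_def)

text \<open>Entries that are not codes of letters over \<open>Z\<close> are ignored, so every number
  denotes a word, and quantifiers over words become quantifiers over numbers.\<close>

definition word_of :: "'a set \<Rightarrow> nat \<Rightarrow> 'a word" where
  "word_of Z k = map letter_of (filter (\<lambda>m. m \<in> letter_code ` (Z \<times> UNIV)) (list_decode k))"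

lemma word_of_in_words: "Z \<subseteq> S \<Longrightarrow> word_of Z k \<in> words Z"
proof -
  assume Z: "Z \<subseteq> S"
  have "letter_of (letter_code p) \<in> Z \<times> UNIV" if "p \<in> Z \<times> UNIV" for p
    using unlc_lc[of p] that Z by (metis SigmaE SigmaI subsetD)
  then have "y \<in> Z \<times> UNIV" if "y \<in> set (word_of Z k)" for y using that unfolding word_of_def
    by force
  then show ?thesis by blast
qed

lemma word_of_wc: "w \<in> words Z \<Longrightarrow> Z \<subseteq> S \<Longrightarrow> word_of Z (list_encode (codes w)) = w"
proof -
  assume w: "w \<in> words Z" "Z \<subseteq> S"
  have "filter (\<lambda>m. m \<in> letter_code ` (Z \<times> UNIV)) (codes w) = codes w"
    using w(1) by (auto simp: codes_def filter_id_conv in_lists_conv_set)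
  moreover have "map letter_of (codes w) = w"
    using w unfolding codes_def map_map by (intro map_idI) (auto simp: in_lists_conv_set unlc_lc)
  ultimately show ?thesis by (simp add: word_of_def)
qed

definition computable_word :: "'a set \<Rightarrow> (nat \<Rightarrow> 'a word) \<Rightarrow> bool" where
  "computable_word Z F \<longleftrightarrow> computable_list (\<lambda>n. codes (F n)) \<and> (\<forall>n. F n \<in> words Z)"

named_theorems computable_word_intros

lemma computable_word_in: "computable_word Z F \<Longrightarrow> F n \<in> words Z"
  and computable_word_rcl: "computable_word Z F \<Longrightarrow> computable_list (\<lambda>n. codes (F n))"
  by (simp_all add: computable_word_def)

lemma computable_word_mono: "computable_word Z F \<Longrightarrow> Z \<subseteq> Z' \<Longrightarrow> computable_word Z' F"
  unfolding computable_word_def using words_mono by blast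

lemma computable_word_comp: "computable_word Z F \<Longrightarrow> computable f \<Longrightarrow> computable_word Z (\<lambda>n. F (f n))"
  unfolding computable_word_def using computable_list_comp[of "\<lambda>n. codes (F n)" f] by simp

lemma computable_word_const: "w \<in> words Z \<Longrightarrow> computable_word Z (\<lambda>n. w)"
  by (simp add: computable_word_def computable_list_const)

lemma computable_word_append [computable_word_intros]: "computable_word Z F \<Longrightarrow> computable_word Z G \<Longrightarrow>
  computable_word Z (\<lambda>n. F n @ G n)"
  by (simp add: computable_word_def computable_list_append)

lemma computable_word_If [computable_word_intros]: "decidable P \<Longrightarrow> computable_word Z F \<Longrightarrow>
  computable_word Z G \<Longrightarrow> computable_word Z (\<lambda>n. if P n then F n else G n)"
  unfolding computable_word_def by (auto simp: if_distrib[of codes] intro: computable_list_If)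

lemma computable_word_inv_word [computable_word_intros]:
  assumes "computable_word Z F" shows "computable_word Z (\<lambda>n. inv_word (F n))"
proof -
  have "letter_code (inv_letter p) = pair (p1 (letter_code p)) (1 - p2 (letter_code p))" for p
    by (simp add: letter_code_def inv_letter_def)
  then have "codes (inv_word w) = rev (map (\<lambda>m. pair (p1 m) (1 - p2 m)) (codes w))" for w
    by (simp add: inv_word_def codes_def rev_map)
  moreover have "computable_list (\<lambda>n. rev (map (\<lambda>m. pair (p1 m) (1 - p2 m)) (codes (F n))))"
    using assms by (intro computable_intros) (simp add: computable_word_def)
  ultimately show ?thesis using assms by (simp add: computable_word_def)
qed

lemma computable_word_word_of [computable_word_intros]:
  assumes "computable f" "Z \<subseteq> S" shows "computable_word Z (\<lambda>n. word_of Z (f n))"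
proof -
  have "letter_code (letter_of m) = m" if "m \<in> letter_code ` (Z \<times> UNIV)" for m
    using that assms(2) unlc_lc by auto
  then have "codes (word_of Z k) = filter (\<lambda>m. m \<in> letter_code ` (Z \<times> UNIV)) (list_decode k)" for k
    unfolding codes_def word_of_def map_map by (intro map_idI) auto
  moreover have "finite (letter_code ` (Z \<times> UNIV))" using finite_subset[OF assms(2) finite_S]
    by simp
  then have "computable_list (\<lambda>n. filter (\<lambda>m. m \<in> letter_code ` (Z \<times> UNIV)) (list_decode (f n)))"
    using assms(1) by (intro computable_intros)
  ultimately show ?thesis using word_of_in_words[OF assms(2)] by (simp add: computable_word_def)
qed

lemma computable_word_nf [computable_word_intros]:
  assumes "computable_word Z F" "Z \<subseteq> S" shows "computable_word Z (\<lambda>n. nf (F n))"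
proof -
  define push' :: "nat \<Rightarrow> nat list \<Rightarrow> nat list" where
    "push' m l = (if l \<noteq> [] \<and> hd0 l = pair (p1 m) (1 - p2 m) then tl l else m # l)" for m l
  have push: "codes (push p w) = push' (letter_code p) (codes w)" if "p \<in> S \<times> UNIV" "w \<in> words S"
    for p w
  proof -
    have inv: "letter_code (inv_letter p) = pair (p1 (letter_code p)) (1 - p2 (letter_code p))"
      by (simp add: letter_code_def inv_letter_def)
    show ?thesis
    proof (cases w)
      case (Cons q w')
      then have "letter_code q = letter_code (inv_letter p) \<longleftrightarrow> q = inv_letter p"
        using that inv_letter_in_iff[of p S] by (intro letter_code_eq_iff) auto
      then show ?thesis using Cons by (simp add: push'_def hd0_def inv)
    qed (simp add: push'_def)
  qed
  have nf: "codes (nf w) = foldr push' (codes w) []" if "w \<in> words S" for w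
    using that
  proof (induction w rule: list.induct)
    case (Cons p w)
    then show ?case using push[of p "nf w"] nf_in_words[of w S] by (simp add: nf_Cons)
  qed simp
  have "computable_list (\<lambda>n. foldr push' (codes (F n)) [])"
    unfolding push'_def using computable_word_rcl[OF assms(1)] by (intro computable_intros)
  moreover have "F n \<in> words S" for n using computable_word_in[OF computable_word_mono[OF assms]] .
  moreover have "nf (F n) \<in> words Z" for n using nf_in_words[OF computable_word_in[OF assms(1)]] .
  ultimately show ?thesis using nf by (simp add: computable_word_def)
qed

lemma computable_word_rotate [computable_word_intros]:
  assumes "computable_word Z F" "computable f" shows "computable_word Z (\<lambda>n. rotate (f n) (F n))"
proof -
  have r1: "rotate1 l = (if l = [] then [] else tl l @ [hd0 l])" for l :: "nat list"
    by (cases l) (auto simp: hd0_def)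
  have "rec_nat l (\<lambda>_ l. rotate1 l) i = rotate i l" for l :: "nat list" and i
    by (induction i) auto
  moreover have "computable_list (\<lambda>n. rec_nat (codes (F n)) (\<lambda>_ l. rotate1 l) (f n))"
    unfolding r1 using assms by (intro computable_intros) (simp_all add: computable_word_def)
  moreover have "rotate i w \<in> words Z" if "w \<in> words Z" for i w
    using that by (simp add: in_lists_conv_set)
  ultimately show ?thesis using assms(1) by (simp add: computable_word_def codes_def rotate_map)
qed

lemma decidable_word_eq [computable_word_intros]:
  assumes "computable_word S F" "computable_word S G" shows "decidable (\<lambda>n. F n = G n)"
  using decidable_list_eq[OF computable_word_rcl[OF assms(1)] computable_word_rcl[OF assms(2)]]
  by (simp add: codes_inj[OF computable_word_in[OF assms(1)] computable_word_in[OF assms(2)]])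

lemma computable_word_table [computable_word_intros]:
  assumes "set ws \<subseteq> words Z" "computable f"
  shows "computable_word Z (\<lambda>n. if f n < length ws then ws ! f n else [])"
proof -
  have "codes (if i < length ws then ws ! i else []) = list_decode (nth0 (map (\<lambda>w. list_encode
    (codes w)) ws) i)" for i
    by (simp add: nth0_def)
  moreover have "computable_list (\<lambda>n. list_decode (nth0 (map (\<lambda>w. list_encode (codes w)) ws) (f
    n)))"
    using assms(2) by (intro computable_intros)
  moreover have "(if i < length ws then ws ! i else []) \<in> words Z" for i
    using subsetD[OF assms(1) nth_mem[of i ws]] by simp
  ultimately show ?thesis unfolding computable_word_def by simp
qed

lemma computable_word_concat_map [computable_word_intros]:
  assumes "computable_list L" "computable_word Z (\<lambda>m. h (p1 m) (p2 m))"
    shows "computable_word Z (\<lambda>n. concat (map (h n) (L n)))"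
proof -
  have "codes (concat (map f l)) = concat (map (\<lambda>x. codes (f x)) l)" for f :: "nat \<Rightarrow> 'a word" and l
    by (induction l) auto
  moreover have "computable_list (\<lambda>n. concat (map (\<lambda>x. codes (h n x)) (L n)))"
    using computable_word_rcl[OF assms(2)] by (intro computable_list_concat_map assms(1))
  moreover have "h n x \<in> words Z" for n x using computable_word_in[OF assms(2), of "pair n x"]
    by simp
  then have "concat (map (h n) l) \<in> words Z" for n l
    by (induction l) auto
  ultimately show ?thesis by (simp add: computable_word_def)
qed

definition letter_bound :: nat where "letter_bound = Max (insert 0 (letter_code ` (S \<times> UNIV)))"

lemma letter_code_le: "p \<in> S \<times> UNIV \<Longrightarrow> letter_code p \<le> letter_bound"
  unfolding letter_bound_def using finite_S by (intro Max_ge) auto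

end

text \<open>The recursion imitates the code of a list of \<open>n\<close> entries equal to
  \<open>b\<close>; the additional \<open>Suc\<close> makes the bound strict. As codes are
  injective, it bounds the number of short words as well as their codes.\<close>

definition code_bound :: "nat \<Rightarrow> nat \<Rightarrow> nat" where
  "code_bound b n = rec_nat 1 (\<lambda>_ y. Suc (Suc (pair b y))) n"

lemma triangle_mono: "m \<le> n \<Longrightarrow> triangle m \<le> triangle n"
  by (induction n) (auto simp: le_Suc_eq)

lemma pr_mono: "a \<le> a' \<Longrightarrow> b \<le> b' \<Longrightarrow> pair a b \<le> pair a' b'"
  unfolding prod_encode_def by (simp add: add_mono triangle_mono)

lemma code_bound_Suc: "code_bound b (Suc n) = Suc (Suc (pair b (code_bound b n)))"
  by (simp add: code_bound_def)

lemma code_bound_gt: "n < code_bound b n"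
proof (induction n)
  case (Suc n)
  then show ?case using le_prod_encode_2[of "code_bound b n" b] by (simp add: code_bound_Suc)
qed (simp add: code_bound_def)

lemma code_bound_mono: "m \<le> n \<Longrightarrow> code_bound b m \<le> code_bound b n"
proof (induction n)
  case (Suc n)
  have "code_bound b n \<le> code_bound b (Suc n)"
    using le_prod_encode_2[of "code_bound b n" b] by (simp add: code_bound_Suc)
  then show ?case using Suc by (auto simp: le_Suc_eq)
qed simp

lemma list_encode_less_code_bound:
  assumes "length l \<le> n" "\<And>x. x \<in> set l \<Longrightarrow> x \<le> b" shows "list_encode l < code_bound b n"
  using assms
proof (induction l arbitrary: n)
  case Nil
  then show ?case using code_bound_gt[of n b] by simp
next
  case (Cons x l)
  then obtain n' where n: "n = Suc n'" "length l \<le> n'" by (cases n) auto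
  have "list_encode l < code_bound b n'" using Cons n by auto
  then have "pair x (list_encode l) \<le> pair b (code_bound b n')" using Cons.prems(2)
    by (intro pr_mono) auto
  then show ?case by (simp add: n code_bound_Suc)
qed

lemma computable_code_bound [computable_intros]:
  "computable f \<Longrightarrow> computable (\<lambda>n. code_bound b (f n))"
  unfolding code_bound_def by (intro computable_intros)

context coding begin

lemma word_code_bound:
  assumes "w \<in> words Z" "Z \<subseteq> S" "length w \<le> n" "letter_bound \<le> b"
  shows "list_encode (codes w) < code_bound b n"
proof (rule list_encode_less_code_bound)
  fix x assume "x \<in> set (codes w)"
  then obtain p where "p \<in> set w" "x = letter_code p" by (auto simp: codes_def)
  then show "x \<le> b" using assms letter_code_le[of p] by (force simp: in_lists_conv_set)
qed (use assms in simp)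

lemma card_words_le_code_bound:
  assumes "Z \<subseteq> S" "letter_bound \<le> b"
  shows "card {w \<in> words Z. length w \<le> n} \<le> code_bound b n"
proof -
  have ZS: "w \<in> words S" if "w \<in> words Z" for w using that assms(1)
    by (auto simp: in_lists_conv_set)
  have "inj_on (\<lambda>w. list_encode (codes w)) {w \<in> words Z. length w \<le> n}"
    by (rule inj_onI) (simp add: list_encode_eq codes_inj[OF ZS ZS])
  moreover have "(\<lambda>w. list_encode (codes w)) ` {w \<in> words Z. length w \<le> n} \<subseteq> {..<code_bound b n}"
    using word_code_bound[OF _ assms(1) _ assms(2)] by auto
  ultimately have "card {w \<in> words Z. length w \<le> n} \<le> card {..<code_bound b n}"
    by (rule card_inj_on_le) simp
  then show ?thesis by simp
qed

lemma all_short_words: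
  assumes "\<forall>j<code_bound b n. P (word_of Z j)" "w \<in> words Z" "Z \<subseteq> S" "length w \<le> n"
    "letter_bound \<le> b"
  shows "P w"
  using assms(1) word_code_bound[OF assms(2-5)] word_of_wc[OF assms(2,3)] by metis

lemma length_le_word_code: "length w \<le> list_encode (codes w)"
  using length_le_list_encode[of "codes w"] by simp

section \<open>Equality in a finitely presented group is enumerable\<close>

definition moves :: "('a word \<times> 'a word) set \<Rightarrow> ('a word \<times> 'a word) set" where
  "moves R = R \<union> R\<inverse> \<union> (\<lambda>(x, b). ([(x, b), (x, \<not> b)], [])) ` (S \<times> UNIV)
     \<union> (\<lambda>(x, b). ([], [(x, b), (x, \<not> b)])) ` (S \<times> UNIV)"

definition move_rel :: "('a word \<times> 'a word) set \<Rightarrow> ('a word \<times> 'a word) set" where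
  "move_rel R = {(p @ a @ q, p @ b @ q) | p a b q. p \<in> words S \<and> q \<in> words S \<and> (a, b) \<in> moves R}"

lemma move_relI:
  "(a, b) \<in> moves R \<Longrightarrow> p \<in> words S \<Longrightarrow> q \<in> words S \<Longrightarrow> (p @ a @ q, p @ b @ q) \<in> move_rel R"
  unfolding move_rel_def by blast

lemma moves_sym: "(a, b) \<in> moves R \<Longrightarrow> (b, a) \<in> moves R"
  unfolding moves_def by auto

lemma pres_rel_subset_move_rel:
  assumes "(u, v) \<in> pres_rel S R" shows "(u, v) \<in> (move_rel R)\<^sup>*"
  using assms
proof induction
  case (sym u v)
  have "sym (move_rel R)" unfolding move_rel_def using moves_sym by (auto simp: sym_def) blast
  then show ?case using sym.IH sym_rtrancl[of "move_rel R"] by (auto simp: sym_def)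
next
  case (cong u u' v v')
  have u: "u' \<in> words S" "v \<in> words S" using cong.hyps equiv_pres_rel[of S R]
    by (auto simp: equiv_def refl_on_def)
  have "(p @ w @ q, p @ w' @ q) \<in> (move_rel R)\<^sup>*"
    if "(w, w') \<in> (move_rel R)\<^sup>*" "p \<in> words S" "q \<in> words S" for p q w w'
    using that(1)
  proof induction
    case (step y z)
    from step(2) obtain p' a b q' where "y = p' @ a @ q'" "z = p' @ b @ q'" "p' \<in> words S"
      "q' \<in> words S" "(a, b) \<in> moves R"
      by (auto simp: move_rel_def)
    then have "(p @ y @ q, p @ z @ q) \<in> move_rel R"
      using move_relI[of a b R "p @ p'" "q' @ q"] that(2,3) by simp
    then show ?case using step.IH by simp
  qed simp
  from this[OF cong.IH(1), of "[]" v] this[OF cong.IH(2), of u' "[]"] show ?case using u by simp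
next
  case (cancel x b)
  then have "([(x, b), (x, \<not> b)], []) \<in> moves R" unfolding moves_def by (auto simp: image_iff)
  from move_relI[OF this, of "[]" "[]"] show ?case by auto
next
  case (relation r s)
  then have "(r, s) \<in> moves R" unfolding moves_def by auto
  from move_relI[OF this, of "[]" "[]"] show ?case by auto
qed auto

lemma move_rel_subset_pres_rel:
  assumes "R \<subseteq> words S \<times> words S" "(u, v) \<in> move_rel R" shows "(u, v) \<in> pres_rel S R"
proof -
  obtain p a b q where uv: "u = p @ a @ q" "v = p @ b @ q" "p \<in> words S" "q \<in> words S"
    "(a, b) \<in> moves R"
    using assms(2) by (auto simp: move_rel_def)
  have "(a, b) \<in> pres_rel S R"
  proof -
    have R: "(r, s) \<in> pres_rel S R" if "(r, s) \<in> R" for r s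
      using that assms(1) by (intro pres_rel.relation) auto
    show ?thesis using uv(5) R pres_rel.cancel[of _ S _ R] unfolding moves_def
      by (auto intro: pres_rel.sym)
  qed
  then show ?thesis using uv by (auto intro: pres_rel.cong pres_rel.refl)
qed

text \<open>A derivation is a list of numbers, each encoding a left context, a right context and the
  index of a move. A step that does not apply leaves the word unchanged, so every list of numbers is
  a correct derivation and no side condition has to be checked.\<close>

lemma enumerable_pres_rel:
  assumes R: "finite R" "R \<subseteq> words S \<times> words S" and F: "computable_word S F"
    and G: "computable_word S G"
  shows "enumerable (\<lambda>n. (F n, G n) \<in> pres_rel S R)"
proof -
  have "finite (moves R)" unfolding moves_def using R(1) finite_S by auto
  then obtain ms where ms: "set ms = moves R" using finite_list by blast
  have msS: "moves R \<subseteq> words S \<times> words S" using R(2) by (auto simp: moves_def)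
  define mf where "mf i = (if i < length ms then map fst ms ! i else [])" for i
  define mt where "mt i = (if i < length ms then map snd ms ! i else [])" for i
  define mv where "mv c w = (if w = word_of S (p1 c) @ mf (p2 (p2 c)) @ word_of S (p1 (p2 c))
    then word_of S (p1 c) @ mt (p2 (p2 c)) @ word_of S (p1 (p2 c)) else w)" for c w
  have mfS: "mf i \<in> words S" "mt i \<in> words S" for i
  proof -
    have "ms ! i \<in> words S \<times> words S" if "i < length ms"
      using subsetD[OF msS] nth_mem[OF that] unfolding ms .
    then show "mf i \<in> words S" "mt i \<in> words S" by (auto simp: mf_def mt_def mem_Times_iff)
  qed
  have mvS: "mv c w \<in> words S" if "w \<in> words S" for c w
    using that mfS word_of_in_words[of S] by (auto simp: mv_def)
  have 1: "(u, fold mv l u) \<in> pres_rel S R" if "u \<in> words S" for u l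
    using that
  proof (induction l arbitrary: u)
    case Nil
    then show ?case by (auto intro: pres_rel.refl)
  next
    case (Cons c l)
    have "(u, mv c u) \<in> pres_rel S R"
    proof (cases "u = word_of S (p1 c) @ mf (p2 (p2 c)) @ word_of S (p1 (p2 c)) \<and>
      p2 (p2 c) < length ms")
      case True
      then have "(mf (p2 (p2 c)), mt (p2 (p2 c))) \<in> moves R"
        using ms nth_mem[of "p2 (p2 c)" ms] by (simp add: mf_def mt_def)
      then have "(u, mv c u) \<in> move_rel R"
        using True move_relI[of _ _ R "word_of S (p1 c)"
          "word_of S (p1 (p2 c))"] word_of_in_words[of S]
        by (simp add: mv_def)
      then show ?thesis by (rule move_rel_subset_pres_rel[OF R(2)])
    next
      case False
      then have "mv c u = u" by (auto simp: mv_def mf_def mt_def)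
      then show ?thesis using Cons.prems by (simp add: pres_rel.refl)
    qed
    then show ?case using Cons.IH[OF mvS[OF Cons.prems]] by (auto intro: pres_rel.trans)
  qed
  have 2: "\<exists>l. fold mv l u = v" if "(u, v) \<in> (move_rel R)\<^sup>*" for u v
    using that
  proof induction
    case base
    show ?case by (rule exI[of _ "[]"]) simp
  next
    case (step y z)
    then obtain l where l: "fold mv l u = y" by blast
    from step(2) obtain p a b q where pq: "y = p @ a @ q" "z = p @ b @ q" "p \<in> words S"
      "q \<in> words S" "(a, b) \<in> moves R"
      by (auto simp: move_rel_def)
    then obtain i where i: "i < length ms" "ms ! i = (a, b)" using ms by (metis in_set_conv_nth)
    define c where "c = pair (list_encode (codes p)) (pair (list_encode (codes q)) i)"
    have "mv c y = z" using pq i word_of_wc[of p S] word_of_wc[of q S]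
      by (simp add: mv_def mf_def mt_def c_def)
    then have "fold mv (l @ [c]) u = z" using l by simp
    then show ?case by blast
  qed
  have iff: "(F n, G n) \<in> pres_rel S R \<longleftrightarrow> (\<exists>k. fold mv (list_decode k) (F n) = G n)" for n
    using 1[OF computable_word_in[OF F]] 2[OF pres_rel_subset_move_rel]
      by (metis list_encode_inverse)
  define mv' where "mv' c l = (if l = codes (word_of S (p1 c)) @ codes (mf (p2 (p2 c))) @ codes
    (word_of S (p1 (p2 c)))
    then codes (word_of S (p1 c)) @ codes (mt (p2 (p2 c))) @ codes (word_of S (p1 (p2 c))) else
      l)" for c l
  have mv': "codes (mv c w) = mv' c (codes w)" if "w \<in> words S" for c w
  proof -
    have "word_of S (p1 c) @ mf (p2 (p2 c)) @ word_of S (p1 (p2 c)) \<in> words S"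
      using mfS word_of_in_words[of S] by auto
    from codes_inj[OF that this] show ?thesis by (simp add: mv_def mv'_def)
  qed
  have fold': "codes (fold mv l w) = fold mv' l (codes w) \<and> fold mv l w \<in> words S" if "w \<in> words S"
    for l w
    using that by (induction l arbitrary: w) (simp_all add: mv' mvS)
  have rmf: "computable_word S (\<lambda>n. mf (f n))" "computable_word S (\<lambda>n. mt (f n))" if "computable f"
    for f
  proof -
    have "set (map fst ms) \<subseteq> words S" "set (map snd ms) \<subseteq> words S"
      using msS unfolding set_map ms by force+
    from computable_word_table[OF this(1) that] computable_word_table[OF this(2) that]
    show "computable_word S (\<lambda>n. mf (f n))" "computable_word S (\<lambda>n. mt (f n))"
      by (simp_all add: mf_def mt_def)
  qed
  have "computable_list (\<lambda>m. fold mv' (list_decode (p2 m)) (codes (F (p1 m))))"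
    unfolding mv'_def
    by (intro computable_intros computable_list_comp[OF computable_word_rcl[OF F]]
      computable_word_rcl[OF computable_word_word_of] computable_word_rcl[OF rmf(1)]
      computable_word_rcl[OF rmf(2)] order_refl)
  moreover have "computable_list (\<lambda>m. codes (G (p1 m)))"
    by (intro computable_list_comp[OF computable_word_rcl[OF G]] computable_intros)
  ultimately have "decidable (\<lambda>m. fold mv' (list_decode (p2 m)) (codes (F (p1 m))) = codes (G (p1
    m)))"
    by (rule decidable_list_eq)
  moreover have "fold mv' (list_decode k) (codes (F n)) = codes (G n) \<longleftrightarrow>
    fold mv (list_decode k) (F n) = G n" for k n
    using fold'[OF computable_word_in[OF F], of
      "list_decode k"] codes_inj[OF _ computable_word_in[OF G]] by metis
  ultimately have "decidable (\<lambda>m. fold mv (list_decode (p2 m)) (F (p1 m)) = G (p1 m))" by simp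
  then have "enumerable (\<lambda>n. \<exists>k. fold mv (list_decode k) (F n) = G n)"
    by (intro enumerable_ex enumerable_dec)
  then show ?thesis by (simp add: iff)
qed

end

section \<open>Bounds for conjugators\<close>

lemma alternating_commute:
  assumes "A \<inter> B = C" shows "alternating B A C gs \<longleftrightarrow> alternating A B C gs"
proof -
  have "successively (\<lambda>g h. g \<in> B \<longleftrightarrow> h \<notin> B) gs \<longleftrightarrow> successively (\<lambda>g h. g \<in> A \<longleftrightarrow> h \<notin> A) gs"
    if "set gs \<subseteq> (A \<union> B) - C"
    using that assms by (induction gs rule: induct_list012) auto
  then show ?thesis unfolding alternating_def by (auto simp: Un_commute)
qed

lemma amalgam_commute: "amalgam A B C \<Longrightarrow> amalgam B A C"
  unfolding amalgam_def using alternating_commute[of A B C] by (auto simp: Int_commute)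

lemma pres_rel_mono:
  assumes "(u, v) \<in> pres_rel S R" "\<And>r s. (r, s) \<in> R \<Longrightarrow> r \<in> words S \<Longrightarrow> s \<in> words S \<Longrightarrow>
    (r, s) \<in> pres_rel S R'"
  shows "(u, v) \<in> pres_rel S R'"
  using assms(1)
proof induction
  case (trans u v w)
  show ?case using trans.IH by (rule pres_rel.trans)
qed (auto intro: pres_rel.refl pres_rel.sym pres_rel.cong pres_rel.cancel assms(2))

lemma pres_rel_converse: "pres_rel S (R\<inverse>) = pres_rel S R"
proof -
  have "(u, v) \<in> pres_rel S (R\<inverse>)" if "(u, v) \<in> pres_rel S R" for u v
    and R :: "('a word \<times> 'a word) set"
    by (rule pres_rel_mono[OF that]) (auto intro: pres_rel.sym pres_rel.relation)
  from this[of _ _ R] this[of _ _ "R\<inverse>"] show ?thesis by auto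
qed

lemma ev_concat_mono:
  assumes "\<And>s. s \<in> P \<Longrightarrow> \<exists>t\<in>Q. ev \<gamma> s = ev \<gamma> t"
  shows "ev \<gamma> ` concat ` lists P \<subseteq> ev \<gamma> ` concat ` lists Q"
proof -
  obtain f where f: "\<And>s. s \<in> P \<Longrightarrow> f s \<in> Q \<and> ev \<gamma> s = ev \<gamma> (f s)" using assms by metis
  have "map f ts \<in> lists Q \<and> ev \<gamma> (concat (map f ts)) = ev \<gamma> (concat ts)" if "ts \<in> lists P" for ts
    using that by (induction ts rule: list.induct) (use f in auto)
  then have "ev \<gamma> (concat ts) \<in> ev \<gamma> ` concat ` lists Q" if "ts \<in> lists P" for ts
    using that by (metis imageI)
  then show ?thesis by blast
qed

text \<open>The relations are a finite list of pairs of words, as enumeration needs finitely many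
  moves. The first components generate \<open>C\<close> by words over \<open>X\<close>, the second
  ones by words over \<open>Y\<close>; closure under inverses is what \<open>free_factor\<close>
  asks for.\<close>

locale presentation = coding idx S
  for idx :: "'a \<Rightarrow> nat" and S +
  fixes X Y :: "'a set" and \<gamma> :: "'a \<Rightarrow> 'g::group_add" and rels :: "('a word \<times> 'a word) list"
  assumes S: "S = X \<union> Y"
    and rels_words: "(s, t) \<in> set rels \<Longrightarrow> s \<in> words X \<and> t \<in> words Y"
    and rels_inv: "(s, t) \<in> set rels \<Longrightarrow> (inv_word s, inv_word t) \<in> set rels"
    and ev_eq_iff: "u \<in> words S \<Longrightarrow> v \<in> words S \<Longrightarrow> ev \<gamma> u = ev \<gamma> v \<longleftrightarrow> (u, v) \<in> pres_rel S (set rels)"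
    and free_X: "u \<in> words X \<Longrightarrow> v \<in> words X \<Longrightarrow> ev \<gamma> u = ev \<gamma> v \<Longrightarrow> nf u = nf v"
    and free_Y: "u \<in> words Y \<Longrightarrow> v \<in> words Y \<Longrightarrow> ev \<gamma> u = ev \<gamma> v \<Longrightarrow> nf u = nf v"
    and amalgam: "amalgam (ev \<gamma> ` words X) (ev \<gamma> ` words Y) (ev \<gamma> ` concat ` lists (fst ` set
      rels))"
begin

lemma X_S: "X \<subseteq> S" and Y_S: "Y \<subseteq> S"
  using S by auto

lemma words_S: "w \<in> words X \<Longrightarrow> w \<in> words S" "w \<in> words Y \<Longrightarrow> w \<in> words S"
  using words_mono X_S Y_S by blast+

lemma rels_ev: "(s, t) \<in> set rels \<Longrightarrow> ev \<gamma> s = ev \<gamma> t"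
  using rels_words[of s t] ev_eq_iff[of s t] words_S by (auto intro: pres_rel.relation)

definition A where "A = ev \<gamma> ` words X"
definition B where "B = ev \<gamma> ` words Y"
definition C where "C = ev \<gamma> ` concat ` lists (fst ` set rels)"
definition G where "G = ev \<gamma> ` words S"

lemma C_Y: "C = ev \<gamma> ` concat ` lists (snd ` set rels)"
  unfolding C_def
  by (intro equalityI ev_concat_mono) (use rels_ev in force)+

sublocale am: amalgam A B C
  unfolding A_def B_def C_def by (rule amalgam)

text \<open>The setting is symmetric in the factors, so results proved for \<open>X\<close> transfer
  to \<open>Y\<close>, in particular the decision of membership in \<open>C\<close> and the
  certificates for elements of \<open>B\<close>.\<close>

lemma swap: "presentation idx S Y X \<gamma> (map prod.swap rels)"
proof (intro presentation.intro presentation_axioms.intro)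
  show "coding idx S" by (rule coding_axioms)
  show "S = Y \<union> X" using S by auto
  show "s \<in> words Y \<and> t \<in> words X" "(inv_word s, inv_word t) \<in> set (map prod.swap rels)"
    if "(s, t) \<in> set (map prod.swap rels)" for s t
    using that rels_words rels_inv by force+
  have conv: "set (map prod.swap rels) = (set rels)\<inverse>" by force
  show "ev \<gamma> u = ev \<gamma> v \<longleftrightarrow> (u, v) \<in> pres_rel S (set (map prod.swap rels))"
    if "u \<in> words S" "v \<in> words S" for u v
    unfolding conv pres_rel_converse by (rule ev_eq_iff[OF that])
  have "fst ` set (map prod.swap rels) = snd ` set rels" by force
  then show "amalgam (ev \<gamma> ` words Y) (ev \<gamma> ` words X) (ev \<gamma> ` concat ` lists (fst ` set (map
    prod.swap rels)))"
    using amalgam_commute[OF am.amalgam_axioms] unfolding A_def B_def C_Y by simp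
qed (use free_X free_Y in blast)+

definition k :: nat where "k = Max (insert 0 ((\<lambda>(s, t). max (length s) (length t)) ` set rels))"

lemma rels_length: "(s, t) \<in> set rels \<Longrightarrow> length s \<le> k \<and> length t \<le> k"
proof -
  assume "(s, t) \<in> set rels"
  then have "max (length s) (length t) \<le> k" unfolding k_def by (intro Max_ge) force+
  then show ?thesis by simp
qed

sublocale fx: free_factor \<gamma> X "fst ` set rels" k
proof
  show "finite X" using finite_subset[OF X_S finite_S] .
  show "fst ` set rels \<subseteq> words X" using rels_words by force
  show "inv_word t \<in> fst ` set rels" "length t \<le> k" if "t \<in> fst ` set rels" for t
    using that rels_inv rels_length by force+
qed (rule free_X)

lemma fx_sets: "fx.A = A" "fx.C = C"
  by (simp_all add: fx.A_def fx.C_def A_def C_def)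

sublocale fy: free_factor \<gamma> Y "snd ` set rels" k
proof
  show "finite Y" using finite_subset[OF Y_S finite_S] .
  show "snd ` set rels \<subseteq> words Y" using rels_words by force
  show "inv_word t \<in> snd ` set rels" "length t \<le> k" if "t \<in> snd ` set rels" for t
    using that rels_inv rels_length by force+
qed (rule free_Y)

lemma fy_sets: "fy.A = B" "fy.C = C"
  by (simp_all add: fy.A_def fy.C_def B_def C_Y)

lemma C_sub: "C \<subseteq> A" "C \<subseteq> B"
  using am.Int by auto

text \<open>Three applications of \<open>undistorted\<close>. The first two compare lengths in the
  two factors, so that bounds can cross from one to the other; the third expresses elements of
  \<open>C\<close> by few generators, which makes membership in \<open>C\<close> decidable inside a
  factor.\<close>

lemma distortion_exists:
  "\<exists>L\<ge>1. (\<forall>n. C \<inter> ball \<gamma> X n \<subseteq> ball \<gamma> Y (L * (n + 1))) \<and> (\<forall>n. C \<inter> ball \<gamma> Y n \<subseteq> ball \<gamma> X (L * (n +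
    1)))
    \<and> (\<forall>n. C \<inter> ball \<gamma> X n \<subseteq> {ev \<gamma> (concat ts) | ts. ts \<in> lists (fst ` set rels) \<and> length ts \<le> L * (n
      + 1)})"
proof -
  have cover: "A \<subseteq> (\<Union>n. ball \<gamma> X n)" "B \<subseteq> (\<Union>n. ball \<gamma> Y n)"
    unfolding A_def B_def ball_def by auto
  have mono: "mono (ball \<gamma> Z)" for Z by (intro monoI ball_mono)
  define D where "D n = {ev \<gamma> (concat ts) | ts. ts \<in> lists (fst ` set rels) \<and> length ts \<le> n}" for n
  have D: "mono D" "C \<subseteq> (\<Union>n. D n)" unfolding D_def C_def by (auto intro!: monoI)
  have D_add: "a + b \<in> D (m + n)" if "a \<in> D m" "b \<in> D n" for a b m n
  proof -
    from that obtain xs ys where "a = ev \<gamma> (concat xs)" "b = ev \<gamma> (concat ys)" "length xs \<le> m"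
      "length ys \<le> n"
      "xs \<in> lists (fst ` set rels)" "ys \<in> lists (fst ` set rels)" unfolding D_def by blast
    then show ?thesis unfolding D_def by (intro CollectI exI[of _ "xs @ ys"]) auto
  qed
  obtain L1 where L1: "fx.C \<inter> ball \<gamma> X (2 * k + 1) \<subseteq> ball \<gamma> Y L1"
    by (rule fx.undistorted_constant[of "ball \<gamma> Y"]) (use cover C_sub mono fx_sets in auto)
  obtain L2 where L2: "fy.C \<inter> ball \<gamma> Y (2 * k + 1) \<subseteq> ball \<gamma> X L2"
    by (rule fy.undistorted_constant[of "ball \<gamma> X"]) (use cover C_sub mono fy_sets in auto)
  obtain L3 where L3: "fx.C \<inter> ball \<gamma> X (2 * k + 1) \<subseteq> D L3"
    by (rule fx.undistorted_constant[of D]) (use D fx_sets in auto)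
  define L where "L = Suc (L1 + L2 + L3)"
  have "fx.C \<inter> ball \<gamma> X (2 * k + 1) \<subseteq> ball \<gamma> Y L" using L1 ball_mono[of L1 L \<gamma> Y]
    by (auto simp: L_def)
  note 1 = fx.undistorted[of "ball \<gamma> Y", OF this mono ball_add]
  have "fy.C \<inter> ball \<gamma> Y (2 * k + 1) \<subseteq> ball \<gamma> X L" using L2 ball_mono[of L2 L \<gamma> X]
    by (auto simp: L_def)
  note 2 = fy.undistorted[of "ball \<gamma> X", OF this mono ball_add]
  have "fx.C \<inter> ball \<gamma> X (2 * k + 1) \<subseteq> D L" using L3 monoD[OF D(1), of L3 L] by (auto simp: L_def)
  note 3 = fx.undistorted[of D, OF this D(1) D_add]
  show ?thesis using 1 2 3 unfolding fx_sets fy_sets D_def[symmetric]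
    by (intro exI[of _ L]) (simp add: L_def)
qed

text \<open>Known by existence only. As a fixed number of the presentation it may nevertheless occur
  in computable bounds.\<close>

definition L :: nat where
  "L = (SOME L. L \<ge> 1 \<and> (\<forall>n. C \<inter> ball \<gamma> X n \<subseteq> ball \<gamma> Y (L * (n + 1))) \<and>
    (\<forall>n. C \<inter> ball \<gamma> Y n \<subseteq> ball \<gamma> X (L * (n + 1)))
    \<and> (\<forall>n. C \<inter> ball \<gamma> X n \<subseteq> {ev \<gamma> (concat ts) | ts. ts \<in> lists (fst ` set rels) \<and> length ts \<le> L * (n
      + 1)}))"

lemma L_ge_1: "1 \<le> L"
  and L_XY: "C \<inter> ball \<gamma> X n \<subseteq> ball \<gamma> Y (L * (n + 1))"
  and L_YX: "C \<inter> ball \<gamma> Y n \<subseteq> ball \<gamma> X (L * (n + 1))"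
  and L_rels: "C \<inter> ball \<gamma> X n \<subseteq> {ev \<gamma> (concat ts) | ts. ts \<in> lists (fst ` set rels) \<and>
    length ts \<le> L * (n + 1)}"
  using someI_ex[OF distortion_exists] unfolding L_def[symmetric] by blast+

text \<open>Dominates the codes of letters as well as the indices of relations, so that
  \<open>cb\<close> bounds the codes of words and also of lists of generators of
  \<open>C\<close>.\<close>

definition b :: nat where "b = max letter_bound (length rels)"
definition cb :: "nat \<Rightarrow> nat" where "cb n = code_bound b n"

lemma cb_mono: "m \<le> n \<Longrightarrow> cb m \<le> cb n"
  by (simp add: cb_def code_bound_mono)

lemma cb_gt: "n < cb n"
  by (simp add: cb_def code_bound_gt)

lemma W_le: "fx.W n \<le> cb n" "fy.W n \<le> cb n"
  unfolding fx.W_def fy.W_def cb_def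
  by (rule card_words_le_code_bound; use X_S Y_S in \<open>simp add: b_def\<close>)+

text \<open>The bound on generators and base points of a coset grows by \<open>step_bound m\<close> when one pair of
  syllables of length at most \<open>m\<close> is processed.\<close>

definition step_bound :: "nat \<Rightarrow> nat \<Rightarrow> nat" where
  "step_bound m n = L * (3 * (cb k * cb (L * (n + 1) + 2 * m)) + 1)"

lemma le_L: "n \<le> L * (n + 1)"
  using mult_le_mono[OF L_ge_1, of n "n + 1"] by simp

lemma step_bound_X: "3 * (fx.W k * fx.W (n + i + j)) \<le> step_bound m n" if "i \<le> m" "j \<le> m"
proof -
  have "n \<le> L * (n + 1)" by (rule le_L)
  then have "fx.W (n + i + j) \<le> cb (L * (n + 1) + 2 * m)"
    using that by (intro order_trans[OF W_le(1)] cb_mono) auto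
  then have "fx.W k * fx.W (n + i + j) \<le> cb k * cb (L * (n + 1) + 2 * m)"
    using W_le(1) mult_le_mono by blast
  then have "3 * (fx.W k * fx.W (n + i + j)) \<le> 1 * (3 * (cb k * cb (L * (n + 1) + 2 * m)) + 1)"
    by simp
  also have "\<dots> \<le> step_bound m n" unfolding step_bound_def using L_ge_1 by (rule mult_le_mono1)
  finally show ?thesis .
qed

lemma step_bound_Y: "L * (3 * (fy.W k * fy.W (L * (n + 1) + i + j)) + 1) \<le> step_bound m n"
  if "i \<le> m" "j \<le> m"
proof -
  have "fy.W (L * (n + 1) + i + j) \<le> cb (L * (n + 1) + 2 * m)"
    using that by (intro order_trans[OF W_le(2)] cb_mono) auto
  then have "fy.W k * fy.W (L * (n + 1) + i + j) \<le> cb k * cb (L * (n + 1) + 2 * m)"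
    using W_le(2) mult_le_mono by blast
  then show ?thesis unfolding step_bound_def by simp
qed

lemma step_bound_ge: "n \<le> step_bound m n"
proof -
  have "n \<le> L * (n + 1)" by (rule le_L)
  also have "\<dots> \<le> cb (L * (n + 1) + 2 * m)" using cb_gt[of "L * (n + 1) + 2 * m"] by simp
  also have "\<dots> \<le> cb k * cb (L * (n + 1) + 2 * m)" using cb_gt[of k] by simp
  also have "\<dots> \<le> 1 * (3 * (cb k * cb (L * (n + 1) + 2 * m)) + 1)" by simp
  also have "\<dots> \<le> step_bound m n" unfolding step_bound_def using L_ge_1 by (rule mult_le_mono1)
  finally show ?thesis .
qed

text \<open>Bounds are always kept with respect to \<open>X\<close>. For syllables from
  \<open>B\<close> the coset is first described over \<open>Y\<close>, intersected there and
  described over \<open>X\<close> again. \<open>step_bound\<close> pays for both changes, so one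
  function serves both factors.\<close>

lemma bounded_step:
  assumes Q: "Q \<subseteq> C" "affine Q" "bounded \<gamma> X n Q"
    and uv: "u \<in> ball \<gamma> X m \<and> v \<in> ball \<gamma> X m \<or> u \<in> ball \<gamma> Y m \<and> v \<in> ball \<gamma> Y m"
  defines "Q' \<equiv> C \<inter> (\<lambda>q. - u + q + v) ` Q"
  shows "affine Q'" "bounded \<gamma> X (step_bound m n) Q'"
proof -
  show "affine Q'" using fx.affine_inter[OF Q(2), of "- u" v] unfolding Q'_def fx_sets .
  from uv show "bounded \<gamma> X (step_bound m n) Q'"
  proof
    assume "u \<in> ball \<gamma> X m \<and> v \<in> ball \<gamma> X m"
    then obtain uw vw where w: "uw \<in> words X" "length uw \<le> m" "u = ev \<gamma> uw" "vw \<in> words X"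
      "length vw \<le> m" "v = ev \<gamma> vw"
      unfolding ball_def by blast
    have "bounded \<gamma> X (3 * (fx.W k * fx.W (n + length (inv_word uw) + length vw))) Q'"
      using fx.bounded_inter[OF Q(2,3), of "inv_word uw" vw] w unfolding Q'_def fx_sets by simp
    moreover have "ball \<gamma> X (3 * (fx.W k * fx.W (n + length (inv_word uw) + length vw))) \<subseteq> ball \<gamma> X
      (step_bound m n)"
      using step_bound_X[of "length uw" m "length vw" n] w by (intro ball_mono) simp
    ultimately show ?thesis by (rule bounded_mono[OF _ order_trans[OF Int_lower2]])
  next
    assume "u \<in> ball \<gamma> Y m \<and> v \<in> ball \<gamma> Y m"
    then obtain uw vw where w: "uw \<in> words Y" "length uw \<le> m" "u = ev \<gamma> uw" "vw \<in> words Y"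
      "length vw \<le> m" "v = ev \<gamma> vw"
      unfolding ball_def by blast
    have "bounded \<gamma> Y (L * (n + 1)) Q"
      using Q(3) by (rule bounded_mono) (use L_XY Q(1) in blast)
    then have "bounded \<gamma> Y (3 * (fy.W k * fy.W (L * (n + 1) + length (inv_word uw) + length vw)))
      Q'" (is "bounded \<gamma> Y ?N Q'")
      using fy.bounded_inter[OF Q(2), of _ "inv_word uw" vw] w unfolding Q'_def fy_sets by simp
    then have "bounded \<gamma> X (L * (?N + 1)) Q'"
      by (rule bounded_mono) (use L_YX[of ?N] in \<open>auto simp: Q'_def\<close>)
    moreover have "ball \<gamma> X (L * (?N + 1)) \<subseteq> ball \<gamma> X (step_bound m n)"
      using step_bound_Y[of "length uw" m "length vw" n] w by (intro ball_mono) simp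
    ultimately show ?thesis by (rule bounded_mono[OF _ order_trans[OF Int_lower2]])
  qed
qed

lemma chain_bounded:
  assumes "Q \<subseteq> C" "affine Q" "bounded \<gamma> X n Q"
    and "list_all2 (\<lambda>u v. u \<in> ball \<gamma> X m \<and> v \<in> ball \<gamma> X m \<or> u \<in> ball \<gamma> Y m \<and> v \<in> ball \<gamma> Y m) us vs"
  shows "bounded \<gamma> X ((step_bound m ^^ length us) n) (am.chain Q us vs)"
  using assms(4,1-3)
proof (induction us vs arbitrary: Q n rule: list_all2_induct)
  case (Cons u us v vs)
  show ?case
    using Cons.IH[of "C \<inter> (\<lambda>q. - u + q + v) ` Q" "step_bound m n"] bounded_step[OF Cons.prems
      Cons.hyps(1)]
    by (simp add: funpow_swap1)
qed simp

lemma chain_subset: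
  assumes "Q \<subseteq> C" "list_all2 R us vs" "d \<in> am.chain Q us vs"
  shows "d \<in> C \<and> (\<exists>q\<in>Q. d = - sum_list us + q + sum_list vs)"
  using assms(2,1,3)
proof (induction us vs arbitrary: Q rule: list_all2_induct)
  case (Cons u us v vs)
  from Cons.IH[of "C \<inter> (\<lambda>q. - u + q + v) ` Q"] Cons.prems obtain q where
    "d \<in> C" "q \<in> Q" "d = - sum_list us + (- u + q + v) + sum_list vs" by auto
  then show ?case by (auto simp: group_simps simp del: add_uminus_conv_diff intro!: bexI[of _ q])
qed auto

text \<open>Zero counts as a generator, so prefixing a word \<open>t\<close> of \<open>rels\<close>
  is the affine step \<open>ev \<gamma> t - 0 + c\<close>.\<close>

lemma bounded_C: "bounded \<gamma> X k C" and affine_C: "affine C"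
proof -
  show "affine C" by (auto simp: affine_def intro: subgrp_add[OF am.C] subgrp_diff[OF am.C])
  have zero: "0 \<in> C \<inter> ball \<gamma> X k" using subgrp_zero[OF am.C] zero_in_ball by blast
  have "ev \<gamma> (concat ts) \<in> affine_span (C \<inter> ball \<gamma> X k)" if "ts \<in> lists (fst ` set rels)" for ts
    using that
  proof (induction ts rule: list.induct)
    case (Cons t ts)
    have "ev \<gamma> t \<in> C" unfolding C_def using Cons.prems
      by (intro image_eqI[of _ _ t] image_eqI[of _ concat "[t]"]) auto
    moreover have "ev \<gamma> t \<in> ball \<gamma> X k" using Cons.prems fx.T by (intro in_ballI) auto
    ultimately have "ev \<gamma> t - 0 + ev \<gamma> (concat ts) \<in> affine_span (C \<inter> ball \<gamma> X k)"
      using zero Cons by (intro affine_span.step) auto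
    then show ?case by simp
  qed (use zero in \<open>auto intro: affine_span.base\<close>)
  then show "bounded \<gamma> X k C" unfolding bounded_def by (subst (1) C_def) blast
qed

text \<open>\<open>m\<close> bounds both the length and the number of syllables; the iteration
  starts at \<open>k\<close> because \<open>C\<close> is generated within radius
  \<open>k\<close>.\<close>

definition conj_bound :: "nat \<Rightarrow> nat" where "conj_bound m = (step_bound m ^^ m) k"

lemma funpow_step_bound_mono: "i \<le> j \<Longrightarrow> (step_bound m ^^ i) n \<le> (step_bound m ^^ j) n"
  by (rule lift_Suc_mono_le[of "\<lambda>i. (step_bound m ^^ i) n"]) (simp_all add: step_bound_ge)

lemma chain_C_bounded:
  assumes "am.alt us" "am.alt vs" "length us \<le> m" "set us \<union> set vs \<subseteq> ball \<gamma> X m \<union> ball \<gamma> Y m"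
    and "list_all2 (\<lambda>u v. u \<in> A \<longleftrightarrow> v \<in> A) us vs"
  shows "bounded \<gamma> X (conj_bound m) (am.chain C us vs)"
proof -
  have sub: "ball \<gamma> X m \<subseteq> A" "ball \<gamma> Y m \<subseteq> B" unfolding ball_def A_def B_def by auto
  have "u \<in> ball \<gamma> X m \<and> v \<in> ball \<gamma> X m \<or> u \<in> ball \<gamma> Y m \<and> v \<in> ball \<gamma> Y m"
    if "u \<in> set us" "v \<in> set vs" "u \<in> A \<longleftrightarrow> v \<in> A" for u v
  proof -
    have "u \<notin> C" "v \<notin> C" using that assms(1,2) by (auto simp: alternating_def)
    then show ?thesis using that assms(4) sub am.Int by blast
  qed
  then have "list_all2 (\<lambda>u v. u \<in> ball \<gamma> X m \<and> v \<in> ball \<gamma> X m \<or> u \<in> ball \<gamma> Y m \<and>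
    v \<in> ball \<gamma> Y m) us vs"
    using assms(5) by (rule_tac list.rel_mono_strong) blast+
  note chain_bounded[OF order_refl affine_C bounded_C this]
  moreover have "ball \<gamma> X ((step_bound m ^^ length us) k) \<subseteq> ball \<gamma> X (conj_bound m)"
    unfolding conj_bound_def by (intro ball_mono funpow_step_bound_mono assms(3))
  ultimately show ?thesis by (rule bounded_mono[OF _ order_trans[OF Int_lower2]])
qed

text \<open>Two elements of the final coset differ by an element of \<open>C\<close> that
  conjugation by \<open>sum_list us\<close> keeps in \<open>C\<close>, so the coset is
  \<open>{c}\<close>. Being generated by its elements in the ball, it must have \<open>c\<close>
  there.\<close>

lemma short_amalgamated_conjugator:
  assumes "am.alt us" "am.alt vs" "length us \<le> m" "set us \<union> set vs \<subseteq> ball \<gamma> X m \<union> ball \<gamma> Y m"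
    and c: "c \<in> C" "- c + sum_list us + c = sum_list vs"
    and triv: "\<And>d. d \<in> C \<Longrightarrow> sum_list us + d - sum_list us \<in> C \<Longrightarrow> d = 0"
  shows "c \<in> ball \<gamma> X (conj_bound m)"
proof -
  have eq: "c + sum_list vs = sum_list us + c" unfolding c(2)[symmetric] by (simp add: add.assoc)
  from am.alt_sum_eqD[OF assms(1,2) c(1) c(1) c(1) eq]
  have *: "list_all2 (\<lambda>u v. u \<in> A \<longleftrightarrow> v \<in> A) us vs" "c \<in> am.chain C us vs" by auto
  have "d = c" if "d \<in> am.chain C us vs" for d
  proof -
    from chain_subset[OF order_refl *(1) that] obtain q where q: "d \<in> C" "q \<in> C"
      "d = - sum_list us + q + sum_list vs" by auto
    have "c = - sum_list us + c + sum_list vs" unfolding add.assoc eq by simp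
    then have "d - c = d - (- sum_list us + c + sum_list vs)" by simp
    also have "\<dots> = - sum_list us + (q - c) + sum_list us"
      by (simp add: q(3) group_simps del: add_uminus_conv_diff)
    finally have "sum_list us + (d - c) - sum_list us = q - c"
      by (simp add: group_simps del: add_uminus_conv_diff)
    then have "d - c = 0" using triv[of "d - c"] q c(1) am.ABC_simps by metis
    then show ?thesis by simp
  qed
  then have "am.chain C us vs \<inter> ball \<gamma> X (conj_bound m) \<subseteq> {c}" by blast
  moreover have "am.chain C us vs \<inter> ball \<gamma> X (conj_bound m) \<noteq> {}"
    using chain_C_bounded[OF assms(1-4) *(1)] *(2) affine_span_empty unfolding bounded_def by force
  ultimately show ?thesis by blast
qed

text \<open>Makes triviality of the intersection testable. With \<open>us\<close> on both sides, the
  final coset consists of such elements \<open>d\<close> and contains \<open>c\<close>; if its part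
  in the ball were at most 0, so would be its span.\<close>

lemma short_intersection_element:
  assumes "am.alt us" "length us \<le> m" "set us \<subseteq> ball \<gamma> X m \<union> ball \<gamma> Y m"
    and c: "c \<in> C" "c \<noteq> 0" "sum_list us + c - sum_list us \<in> C"
  shows "\<exists>d\<in>C \<inter> ball \<gamma> X (conj_bound m). d \<noteq> 0 \<and> sum_list us + d - sum_list us \<in> C"
proof (rule ccontr)
  assume contra: "\<not> ?thesis"
  have eq: "(sum_list us + c - sum_list us) + sum_list us = sum_list us + c" by simp
  from am.alt_sum_eqD[OF assms(1,1) c(3) c(1) c(3) eq]
  have *: "list_all2 (\<lambda>u v. u \<in> A \<longleftrightarrow> v \<in> A) us us" "c \<in> am.chain C us us" by auto
  have "d = 0" if d: "d \<in> am.chain C us us \<inter> ball \<gamma> X (conj_bound m)" for d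
  proof -
    from chain_subset[OF order_refl *(1)] d obtain q where q: "d \<in> C" "q \<in> C"
      "d = - sum_list us + q + sum_list us" by blast
    have "sum_list us + d - sum_list us = q" unfolding q(3)
      by (simp add: group_simps del: add_uminus_conv_diff)
    then show ?thesis using contra q d by blast
  qed
  then have "affine_span (am.chain C us us \<inter> ball \<gamma> X (conj_bound m)) \<subseteq> {0}"
    by (intro affine_span_subset) (auto simp: affine_def)
  then show False
    using chain_C_bounded[OF assms(1,1,2) _ *(1)] assms(3) *(2) c(2) unfolding bounded_def by blast
qed

end

section \<open>Recursively enumerable predicates on words\<close>

lemma computable_list_upt [computable_intros]:
  assumes "computable f" shows "computable_list (\<lambda>n. [0..<f n])"
proof -
  have "rec_nat [] (\<lambda>i l. l @ [i]) m = [0..<m]" for m by (induction m) auto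
  moreover have "computable_list (\<lambda>n. rec_nat [] (\<lambda>i l. l @ [i]) (f n))"
    by (intro computable_intros assms)
  ultimately show ?thesis by simp
qed

lemma decidable_even [computable_intros]:
  assumes "computable f" shows "decidable (\<lambda>n. even (f n))"
proof -
  have *: "rec_nat 1 (\<lambda>_ y. 1 - y) m = (of_bool (even m) :: nat)" for m by (induction m) auto
  have "computable (\<lambda>n. rec_nat 1 (\<lambda>_ y. 1 - y) (f n))" by (intro computable_intros assms)
  then show ?thesis unfolding * decidable_def .
qed

context presentation begin

lemma AB_G: "A \<subseteq> G" "B \<subseteq> G"
  unfolding A_def B_def G_def by (intro image_mono subsetI; erule words_S)+

lemma U_eq_G: "am.U = G"
proof
  show "am.U \<subseteq> G"
  proof
    fix x assume "x \<in> am.U"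
    then obtain gs where gs: "gs \<in> lists (A \<union> B)" "x = sum_list gs" by (auto simp: am.U_def)
    from gs(1) have "sum_list gs \<in> G"
    proof (induction gs rule: lists.induct)
      case Nil
      show ?case unfolding G_def by (rule image_eqI[of _ _ "[]"]) auto
    next
      case (Cons g gs)
      from Cons.IH obtain w where w: "w \<in> words S" "sum_list gs = ev \<gamma> w" unfolding G_def
        by (metis imageE)
      have "g \<in> G" using Cons.hyps(1) AB_G by auto
      then obtain v where "v \<in> words S" "g = ev \<gamma> v" unfolding G_def by (metis imageE)
      with w show ?case unfolding G_def by (intro image_eqI[of _ _ "v @ w"]) auto
    qed
    then show "x \<in> G" by (simp add: gs)
  qed
  show "G \<subseteq> am.U"
  proof
    fix x assume "x \<in> G"
    then obtain w where w: "w \<in> words S" "x = ev \<gamma> w" by (auto simp: G_def)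
    have "ev \<gamma> [p] \<in> A \<union> B" if "p \<in> S \<times> UNIV" for p
      using that S unfolding A_def B_def by (cases p) (auto intro!: imageI)
    then have "sum_list (map (\<lambda>p. ev \<gamma> [p]) w) \<in> am.U"
      using w(1) by (intro am.sum_list_in_U) (auto simp: in_lists_conv_set)
    moreover have "sum_list (map (\<lambda>p. ev \<gamma> [p]) w) = ev \<gamma> w" by (simp add: ev_def)
    ultimately show "x \<in> am.U" using w by simp
  qed
qed

lemma G: "subgrp G"
  using am.U by (simp add: U_eq_G)

lemma computable_cb [computable_intros]: "computable f \<Longrightarrow> computable (\<lambda>n. cb (f n))"
  unfolding cb_def by (rule computable_code_bound)

lemma length_word_of_le: "length (word_of Z j) \<le> j"
proof -
  have "length (word_of Z j) \<le> length (list_decode j)" unfolding word_of_def by simp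
  then show ?thesis using length_le_list_encode[of "list_decode j"] by simp
qed

lemma all_short:
  assumes "\<forall>j<cb n. P (word_of Z j)" "w \<in> words Z" "Z \<subseteq> S" "length w \<le> n" shows "P w"
  by (rule all_short_words[of b n P Z]) (use assms in \<open>simp_all add: cb_def b_def\<close>)

text \<open>Indices out of range contribute the empty word, so every number denotes an element of
  \<open>C\<close>.\<close>

definition C_word :: "nat \<Rightarrow> 'a word" where
  "C_word j = concat (map (\<lambda>i. if i < length (map fst rels) then map fst rels ! i else [])
    (list_decode j))"

lemma C_word_in_C: "ev \<gamma> (C_word j) \<in> C"
proof -
  have "ev \<gamma> (concat (map (\<lambda>i. if i < length (map fst rels) then map fst rels ! i else []) l)) \<in> C"
    for l
  proof (induction l)
    case (Cons i l)
    have "ev \<gamma> (map fst rels ! i) \<in> C" if "i < length rels"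
      unfolding C_def using that
      by (intro image_eqI[of _ _ "fst (rels ! i)"] image_eqI[of _ concat "[fst (rels ! i)]"]) auto
    then show ?case using Cons am.ABC_simps by auto
  qed (use am.ABC_simps in auto)
  then show ?thesis unfolding C_word_def .
qed

lemma C_word_in_words: "C_word j \<in> words X"
proof -
  have "computable_word X (\<lambda>n. C_word n)"
    unfolding C_word_def using rels_words by (intro computable_word_intros computable_intros) force
  then show ?thesis by (rule computable_word_in)
qed

lemma computable_word_C_word [computable_word_intros]:
  "computable f \<Longrightarrow> computable_word X (\<lambda>n. C_word (f n))"
  unfolding C_word_def using rels_words by (intro computable_word_intros computable_intros) force+

text \<open>By \<open>L_rels\<close> the search for a product of generators equal to
  \<open>w\<close> is bounded, and equality within the free factor is a comparison of reduced words.
  This gives a decision, not merely an enumeration.\<close>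

lemma in_C_iff:
  assumes "w \<in> words X" "length w \<le> n"
  shows "ev \<gamma> w \<in> C \<longleftrightarrow> \<not> (\<forall>j<cb (L * (n + 1)). nf w \<noteq> nf (C_word j))"
proof
  assume "\<not> (\<forall>j<cb (L * (n + 1)). nf w \<noteq> nf (C_word j))"
  then obtain j where "nf w = nf (C_word j)" by blast
  then have "ev \<gamma> w = ev \<gamma> (C_word j)" by (metis ev_nf)
  then show "ev \<gamma> w \<in> C" using C_word_in_C by simp
next
  assume "ev \<gamma> w \<in> C"
  then have "ev \<gamma> w \<in> C \<inter> ball \<gamma> X n" using in_ballI[OF assms, of \<gamma>] by blast
  then obtain ts where ts: "ev \<gamma> w = ev \<gamma> (concat ts)" "ts \<in> lists (fst ` set rels)"
    "length ts \<le> L * (n + 1)"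
    using L_rels[of n] by blast
  have "\<exists>is. map (\<lambda>i. map fst rels ! i) is = ts \<and> set is \<subseteq> {..<length rels}" using ts(2)
  proof (induction ts rule: list.induct)
    case (Cons t ts)
    then obtain i "is" where "i < length rels" "t = fst (rels ! i)"
      "map (\<lambda>i. map fst rels ! i) is = ts"
      "set is \<subseteq> {..<length rels}" by (auto simp: in_set_conv_nth)
    then show ?case by (intro exI[of _ "i # is"]) auto
  qed simp
  then obtain "is" where is': "map (\<lambda>i. map fst rels ! i) is = ts" "set is \<subseteq> {..<length rels}"
    by blast
  have "list_encode is < cb (L * (n + 1))" unfolding cb_def
  proof (rule list_encode_less_code_bound)
    show "length is \<le> L * (n + 1)" using ts(3) is'(1) by auto
    show "x \<le> b" if "x \<in> set is" for x using that is'(2) by (auto simp: b_def)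
  qed
  moreover have "C_word (list_encode is) = concat ts"
    unfolding C_word_def is'(1)[symmetric] using is'(2) by (auto intro!: arg_cong[where f = concat])
  then have "nf w = nf (C_word (list_encode is))"
    by (intro free_X[OF assms(1) C_word_in_words]) (simp add: ts(1))
  ultimately show "\<not> (\<forall>j<cb (L * (n + 1)). nf w \<noteq> nf (C_word j))" by blast
qed

lemma decidable_in_C:
  assumes "computable_word X F" shows "decidable (\<lambda>n. ev \<gamma> (F n) \<in> C)"
proof -
  have "ev \<gamma> (F n) \<in> C \<longleftrightarrow> \<not> (\<forall>j<cb (L * (list_encode (codes (F n)) + 1)). \<not> (nf (F n) = nf (C_word
    j)))" for n
    by (rule in_C_iff[OF computable_word_in[OF assms] length_le_word_code])
  moreover have "decidable (\<lambda>n. \<not> (\<forall>j<cb (L * (list_encode (codes (F n)) + 1)). \<not> (nf (F n) = nf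
    (C_word j))))"
    by (intro computable_intros decidable_word_eq computable_word_mono[OF _ X_S] computable_word_nf
      X_S computable_word_comp[OF assms] computable_word_C_word
        computable_list_comp[OF computable_word_rcl[OF assms]] computable_word_rcl[OF assms])
  ultimately show ?thesis by simp
qed

text \<open>\<open>s\<close> records whether the syllables at even positions are words over
  \<open>X\<close>. Alternation then holds by construction, and only non-membership in
  \<open>C\<close> remains to be tested, which is decidable inside a factor.\<close>

definition syl :: "bool \<Rightarrow> nat \<Rightarrow> nat \<Rightarrow> 'a word" where
  "syl s i m = word_of (if even i = s then X else Y) m"

definition syls :: "bool \<Rightarrow> nat list \<Rightarrow> 'a word list" where
  "syls s l = map (\<lambda>i. syl s i (nth0 l i)) [0..<length l]"

definition alt_code :: "bool \<Rightarrow> nat list \<Rightarrow> bool" where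
  "alt_code s l \<longleftrightarrow> (\<forall>i<length l. ev \<gamma> (syl s i (nth0 l i)) \<notin> C)"

lemma length_syls [simp]: "length (syls s l) = length l"
  by (simp add: syls_def)

lemma syls_eq_Nil [simp]: "syls s l = [] \<longleftrightarrow> l = []"
  by (simp add: syls_def)

lemma syl_words: "syl s i m \<in> words (if even i = s then X else Y)" "syl s i m \<in> words S"
  unfolding syl_def using word_of_in_words[OF X_S] word_of_in_words[OF Y_S] words_S by auto

lemma alt_code_alt:
  assumes "alt_code s l" shows "am.alt (map (ev \<gamma>) (syls s l))"
    and "i < length l \<Longrightarrow> map (ev \<gamma>) (syls s l) ! i \<in> A \<longleftrightarrow> even i = s"
proof -
  have nth: "map (ev \<gamma>) (syls s l) ! i = ev \<gamma> (syl s i (nth0 l i))" if "i < length l" for i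
    using that by (simp add: syls_def)
  have in_AB: "ev \<gamma> (syl s i m) \<in> (if even i = s then A else B)" for i m
    using syl_words(1)[of s i m] by (auto simp: A_def B_def)
  have AB: "map (ev \<gamma>) (syls s l) ! i \<in> (A \<union> B) - C" "map (ev \<gamma>) (syls s l) ! i \<in> A \<longleftrightarrow> even i = s"
    if "i < length l" for i
  proof -
    have notC: "ev \<gamma> (syl s i (nth0 l i)) \<notin> C" using assms that by (simp add: alt_code_def)
    show "map (ev \<gamma>) (syls s l) ! i \<in> (A \<union> B) - C" "map (ev \<gamma>) (syls s l) ! i \<in> A \<longleftrightarrow> even i = s"
      unfolding nth[OF that] using in_AB[of i "nth0 l i"] notC am.Int by (auto split: if_splits)
  qed
  show "map (ev \<gamma>) (syls s l) ! i \<in> A \<longleftrightarrow> even i = s" if "i < length l" using AB(2)[OF that] .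
  have "set (map (ev \<gamma>) (syls s l)) \<subseteq> (A \<union> B) - C"
  proof
    fix x assume "x \<in> set (map (ev \<gamma>) (syls s l))"
    then obtain i where "i < length l" "x = map (ev \<gamma>) (syls s l) ! i"
      unfolding in_set_conv_nth by auto
    then show "x \<in> (A \<union> B) - C" using AB(1) by blast
  qed
  moreover have "successively (\<lambda>g h. g \<in> A \<longleftrightarrow> h \<notin> A) (map (ev \<gamma>) (syls s l))"
    unfolding successively_conv_nth using AB(2) by auto
  ultimately show "am.alt (map (ev \<gamma>) (syls s l))" by (simp add: alternating_def)
qed

lemma alt_code_exists:
  assumes "am.alt gs" "gs \<noteq> [] \<Longrightarrow> hd gs \<in> A \<longleftrightarrow> s"
  obtains l where "alt_code s l" "map (ev \<gamma>) (syls s l) = gs"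
proof -
  have par: "gs ! i \<in> A \<longleftrightarrow> even i = s" if "i < length gs" for i
    using that
  proof (induction i)
    case 0
    then show ?case using assms(2) by (cases gs) auto
  next
    case (Suc i)
    then show ?case using assms(1) unfolding alternating_def successively_conv_nth by auto
  qed
  have "\<exists>m. ev \<gamma> (syl s i m) = gs ! i" if "i < length gs" for i
  proof -
    have "gs ! i \<in> (A \<union> B) - C" using assms(1) nth_mem[OF that] unfolding alternating_def by blast
    then have "gs ! i \<in> ev \<gamma> ` words (if even i = s then X else Y)"
      using par[OF that] by (auto simp: A_def B_def)
    then obtain w where w: "gs ! i = ev \<gamma> w" "w \<in> words (if even i = s then X else Y)"
      by (rule imageE)
    have "syl s i (list_encode (codes w)) = w"
      unfolding syl_def by (rule word_of_wc[OF w(2)]) (simp add: X_S Y_S)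
    then show ?thesis using w(1) by metis
  qed
  then obtain f where f: "\<And>i. i < length gs \<Longrightarrow> ev \<gamma> (syl s i (f i)) = gs ! i" by metis
  let ?l = "map f [0..<length gs]"
  have "map (ev \<gamma>) (syls s ?l) = gs"
    by (rule nth_equalityI) (simp_all add: syls_def nth0_def f)
  moreover have "alt_code s ?l"
  proof -
    have "gs ! i \<notin> C" if "i < length gs" for i
      using assms(1) nth_mem[OF that] unfolding alternating_def by blast
    then show ?thesis unfolding alt_code_def using f by (simp add: nth0_def)
  qed
  ultimately show thesis using that by blast
qed

text \<open>The factors alternate with the parity of the position, so the two ends differ exactly
  for an even number of syllables.\<close>

lemma cyc_code_iff:
  assumes "alt_code s l" "l \<noteq> []" shows "am.cyc (map (ev \<gamma>) (syls s l)) \<longleftrightarrow> even (length l)"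
proof -
  let ?g = "map (ev \<gamma>) (syls s l)"
  have ne: "?g \<noteq> []" using assms(2) by (simp add: syls_def)
  have "hd ?g \<in> A \<longleftrightarrow> s" using alt_code_alt(2)[OF assms(1), of 0] assms(2) ne
    by (simp add: hd_conv_nth)
  moreover have "last ?g \<in> A \<longleftrightarrow> even (length l - 1) = s"
    using alt_code_alt(2)[OF assms(1), of "length l - 1"] assms(2) ne by (simp add: last_conv_nth)
  moreover have "even (length l - 1) \<longleftrightarrow> odd (length l)" using assms(2) by (cases l) auto
  ultimately show ?thesis unfolding am.cyc_def using alt_code_alt(1)[OF assms(1)] ne by auto
qed

lemma ev_syls: "ev \<gamma> (concat (syls s l)) = sum_list (map (ev \<gamma>) (syls s l))"
  by (rule ev_concat)

lemma syls_short:
  "set (map (ev \<gamma>) (syls s l)) \<subseteq> ball \<gamma> X (length (concat (syls s l))) \<union> ball \<gamma> Y (length (concat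
    (syls s l)))"
proof -
  have "length w \<le> length (concat (syls s l))" if "w \<in> set (syls s l)" for w
    using that by (auto simp: length_concat intro: member_le_sum_list)
  moreover have "w \<in> words X \<or> w \<in> words Y" if "w \<in> set (syls s l)" for w
  proof -
    from that obtain i where "w = syl s i (nth0 l i)" by (auto simp: syls_def)
    then show ?thesis using syl_words(1)[of s i "nth0 l i"] by (cases "even i = s") simp_all
  qed
  ultimately have "ev \<gamma> w \<in> ball \<gamma> X (length (concat (syls s l))) \<union> ball \<gamma> Y (length (concat (syls s
    l)))"
    if "w \<in> set (syls s l)" for w
    using that in_ballI[of w X _ \<gamma>] in_ballI[of w Y _ \<gamma>] by blast
  then show ?thesis by auto
qed

lemma length_code_le: "alt_code s l \<Longrightarrow> length l \<le> length (concat (syls s l))"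
proof -
  assume *: "alt_code s l"
  have "1 \<le> length w" if "w \<in> set (syls s l)" for w
  proof -
    from that obtain i where i: "i < length l" "w = syl s i (nth0 l i)" by (auto simp: syls_def)
    then have "ev \<gamma> w \<notin> C" using * by (simp add: alt_code_def)
    then have "w \<noteq> []" using am.ABC_simps by auto
    then show ?thesis by (cases w) auto
  qed
  then have "length (syls s l) \<le> sum_list (map length (syls s l))"
    using sum_list_mono[of "syls s l" "\<lambda>_. 1" length] by (simp add: sum_list_triv)
  then show ?thesis by (simp add: length_concat)
qed

lemma decidable_in_C_Y:
  assumes "computable_word Y F" shows "decidable (\<lambda>n. ev \<gamma> (F n) \<in> C)"
proof -
  interpret sw: presentation idx S Y X \<gamma> "map prod.swap rels" by (rule swap)
  have "fst ` set (map prod.swap rels) = snd ` set rels" by force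
  then have "sw.C = C" unfolding sw.C_def C_Y by simp
  then show ?thesis using sw.decidable_in_C[OF assms] by simp
qed

lemma decidable_alt_code:
  assumes "computable_list l" shows "decidable (\<lambda>n. alt_code s (l n))"
proof -
  have "alt_code s l \<longleftrightarrow> (\<forall>i<length l. (even i = s \<longrightarrow> ev \<gamma> (word_of X (nth0 l i)) \<in> C \<longrightarrow> False) \<and>
      (\<not> (even i = s) \<longrightarrow> ev \<gamma> (word_of Y (nth0 l i)) \<in> C \<longrightarrow> False))" for l
    unfolding alt_code_def syl_def by auto
  moreover have "decidable (\<lambda>n. even (f n) = s)" if "computable f" for f
    using decidable_even[OF that] decidable_not[OF decidable_even[OF that]] by (cases s) auto
  moreover have "decidable (\<lambda>n. \<forall>i<length (l n). (even i = s \<longrightarrow> ev \<gamma> (word_of X (nth0 (l n) i)) \<in> C \<longrightarrow>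
    False) \<and>
      (\<not> (even i = s) \<longrightarrow> ev \<gamma> (word_of Y (nth0 (l n) i)) \<in> C \<longrightarrow> False))"
    by (intro decidable_ball decidable_conj decidable_imp decidable_not decidable_const
      decidable_in_C decidable_in_C_Y computable_word_word_of computable_intros calculation(2)
        assms computable_list_comp[OF assms] X_S Y_S)
  ultimately show ?thesis by simp
qed

lemma computable_word_concat_syls [computable_word_intros]:
  assumes "computable_list l" shows "computable_word S (\<lambda>n. concat (syls s (l n)))"
proof -
  have ev: "decidable (\<lambda>n. even (f n) = s)" if "computable f" for f
    using decidable_even[OF that] decidable_not[OF decidable_even[OF that]] by (cases s) auto
  have "syl s i m = (if even i = s then word_of X m else word_of Y m)" for i m
    by (simp add: syl_def)
  then show ?thesis unfolding syls_def
    by (simp only:) (intro computable_word_intros computable_intros assms computable_list_comp[OF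
      assms] ev computable_word_mono[OF computable_word_word_of X_S] computable_word_mono[OF
      computable_word_word_of Y_S] X_S Y_S)
qed

lemma enumerable_ev_eq [enumerable_intros]:
  assumes "computable_word S F" "computable_word S H"
    shows "enumerable (\<lambda>n. ev \<gamma> (F n) = ev \<gamma> (H n))"
proof -
  have "enumerable (\<lambda>n. (F n, H n) \<in> pres_rel S (set rels))"
  proof (intro enumerable_pres_rel assms)
    show "set rels \<subseteq> words S \<times> words S"
    proof
      fix x assume "x \<in> set rels"
      then show "x \<in> words S \<times> words S"
        using rels_words[of "fst x" "snd x"] words_S by (simp add: mem_Times_iff)
    qed
  qed simp
  then show ?thesis
    using ev_eq_iff[OF computable_word_in[OF assms(1)] computable_word_in[OF assms(2)]] by simp
qed

text \<open>For arbitrary elements, non-membership in \<open>C\<close> is witnessed by a nonempty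
  alternating product: equality with it is enumerable, and its syllables are tested inside the
  factors.\<close>

lemma notin_C_iff:
  assumes "w \<in> words S"
  shows "ev \<gamma> w \<notin> C \<longleftrightarrow> (\<exists>m. (list_decode m \<noteq> [] \<and> alt_code True (list_decode m)) \<and>
    ev \<gamma> w = ev \<gamma> (concat (syls True (list_decode m))))
    \<or> (\<exists>m. (list_decode m \<noteq> [] \<and> alt_code False (list_decode m)) \<and> ev \<gamma> w = ev \<gamma> (concat (syls False
      (list_decode m))))"
    (is "?l \<longleftrightarrow> ?r")
proof
  assume ?l
  moreover have "ev \<gamma> w \<in> am.U" using assms by (auto simp: U_eq_G G_def)
  ultimately obtain gs where gs: "am.alt gs" "gs \<noteq> []" "sum_list gs = ev \<gamma> w" using am.alt_form
    by metis
  define s where "s \<longleftrightarrow> hd gs \<in> A"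
  obtain l where l: "alt_code s l" "map (ev \<gamma>) (syls s l) = gs"
    using alt_code_exists[OF gs(1), of s] by (auto simp: s_def)
  have "list_decode (list_encode l) \<noteq> []" using l(2) gs(2) by (auto simp: syls_def)
  then show ?r using l gs(3) ev_syls[of s l] by (cases s) (metis list_encode_inverse)+
next
  assume ?r
  then obtain s m where "list_decode m \<noteq> []" "alt_code s (list_decode m)"
    "ev \<gamma> w = ev \<gamma> (concat (syls s (list_decode m)))" by blast
  then show ?l using am.alternating_sum[OF alt_code_alt(1)] ev_syls by (simp add: syls_def)
qed

lemma enumerable_notin_C [enumerable_intros]:
  assumes "computable_word S F" shows "enumerable (\<lambda>n. ev \<gamma> (F n) \<notin> C)"
  unfolding notin_C_iff[OF computable_word_in[OF assms]]
  by (intro enumerable_disj enumerable_ex enumerable_conj enumerable_ev_eq enumerable_dec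
    computable_word_comp[OF assms] computable_word_intros decidable_conj decidable_alt_code
    computable_intros)

lemma in_C_iff_ex: "g \<in> C \<longleftrightarrow> (\<exists>j. g = ev \<gamma> (C_word j))"
proof
  assume "g \<in> C"
  then obtain w where w: "w \<in> words X" "g = ev \<gamma> w" using C_sub by (auto simp: A_def)
  then show "\<exists>j. g = ev \<gamma> (C_word j)"
    using in_C_iff[OF w(1) order_refl] \<open>g \<in> C\<close> by (metis ev_nf)
qed (use C_word_in_C in auto)

lemma enumerable_in_C [enumerable_intros]:
  assumes "computable_word S F" shows "enumerable (\<lambda>n. ev \<gamma> (F n) \<in> C)"
  unfolding in_C_iff_ex
  by (intro enumerable_ex enumerable_ev_eq computable_word_comp[OF assms] computable_word_mono[OF
    computable_word_C_word X_S] computable_intros)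

text \<open>The negative half of the word problem. Outside \<open>C\<close> the previous enumeration
  applies; an element of \<open>C\<close> is a word over \<open>X\<close>, where nontriviality is
  visible from the reduced word.\<close>

lemma ev_neq_0_iff:
  assumes "w \<in> words S"
  shows "ev \<gamma> w \<noteq> 0 \<longleftrightarrow> ev \<gamma> w \<notin> C \<or> (\<exists>j. ev \<gamma> w = ev \<gamma> (word_of X j) \<and> \<not> (nf (word_of X j) = nf []))"
    (is "?l \<longleftrightarrow> ?r")
proof
  assume l: ?l
  show ?r
  proof (cases "ev \<gamma> w \<in> C")
    case True
    then obtain j where j: "ev \<gamma> w = ev \<gamma> (C_word j)" using in_C_iff_ex by blast
    have "nf (C_word j) \<noteq> nf []" using l j by (metis ev_Nil ev_nf)
    then show ?thesis using j word_of_wc[OF C_word_in_words X_S] by metis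
  qed simp
next
  assume ?r
  then show ?l
  proof
    assume "\<exists>j. ev \<gamma> w = ev \<gamma> (word_of X j) \<and> \<not> (nf (word_of X j) = nf [])"
    then show ?thesis using free_X[of "word_of X _" "[]"] word_of_in_words[OF X_S] by fastforce
  qed (use am.ABC_simps in auto)
qed

lemma enumerable_ev_neq [enumerable_intros]:
  assumes "computable_word S F" "computable_word S H"
    shows "enumerable (\<lambda>n. ev \<gamma> (F n) \<noteq> ev \<gamma> (H n))"
proof -
  have FH: "computable_word S (\<lambda>n. F n @ inv_word (H n))" using assms
    by (intro computable_word_intros)
  have "ev \<gamma> (F n) \<noteq> ev \<gamma> (H n) \<longleftrightarrow> ev \<gamma> (F n @ inv_word (H n)) \<noteq> 0" for n by simp
  moreover have "enumerable (\<lambda>n. ev \<gamma> (F n @ inv_word (H n)) \<noteq> 0)"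
    unfolding ev_neq_0_iff[OF computable_word_in[OF FH]]
    by (intro enumerable_disj enumerable_notin_C FH enumerable_ex enumerable_conj enumerable_ev_eq
      computable_word_comp[OF FH] computable_word_word_of enumerable_dec decidable_not
      decidable_word_eq computable_word_nf
        computable_word_const computable_intros X_S order_refl computable_word_mono[OF
          computable_word_word_of X_S]) auto
  ultimately show ?thesis by (simp only:)
qed

end

section \<open>Certificates of non-conjugacy\<close>

context coding begin

lemma ex_word_code: "w \<in> words Z \<Longrightarrow> Z \<subseteq> S \<Longrightarrow> \<exists>j. word_of Z j = w"
  using word_of_wc by blast

end

context presentation begin

text \<open>Covers the bounds of \<open>short_conjugator\<close> and
  \<open>short_conjugator_into_C\<close> at once: the words coded by \<open>m\<close> and
  \<open>n\<close> have lengths at most \<open>m\<close> and \<open>n\<close>, and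
  \<open>cb m\<close> replaces the number \<open>W\<close> of short words. The outer
  \<open>cb\<close> turns the bound for lengths into one for codes.\<close>

definition search_bound :: "nat \<Rightarrow> nat \<Rightarrow> nat" where "search_bound m n = cb (k + 2 * cb m + n)"

definition conj_word :: "'a word \<Rightarrow> 'a word \<Rightarrow> 'a word" where "conj_word U w = inv_word w @ U @ w"

lemma ev_conj_word: "ev \<gamma> (conj_word U w) = - ev \<gamma> w + ev \<gamma> U + ev \<gamma> w"
  by (simp add: conj_word_def add.assoc)

definition not_conj_in :: "'a set \<Rightarrow> nat \<Rightarrow> 'a word \<Rightarrow> 'a word \<Rightarrow> bool" where
  "not_conj_in Z g U V \<longleftrightarrow> (\<exists>s. ev \<gamma> V = ev \<gamma> (word_of Z s) \<and> (\<forall>j<search_bound g s. ev \<gamma> (conj_word U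
    (word_of Z j)) \<noteq> ev \<gamma> V))"

definition regular_in :: "'a set \<Rightarrow> nat \<Rightarrow> 'a word \<Rightarrow> bool" where
  "regular_in Z g U \<longleftrightarrow> ev \<gamma> U = ev \<gamma> (word_of Z g) \<and>
     (\<forall>j<search_bound g 0. ev \<gamma> (word_of Z j) \<in> C \<or> ev \<gamma> (conj_word U (word_of Z j)) \<notin> C)"

definition avoids_C :: "nat \<Rightarrow> 'a word \<Rightarrow> bool" where
  "avoids_C g U \<longleftrightarrow> ev \<gamma> U = ev \<gamma> (word_of X g) \<and> (\<forall>j<search_bound g 0. ev \<gamma> (conj_word U (word_of X
    j)) \<notin> C)"

definition cyc_code :: "nat \<Rightarrow> 'a word \<Rightarrow> bool" where
  "cyc_code m V \<longleftrightarrow> (list_decode m \<noteq> [] \<and> even (length (list_decode m)) \<and>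
    alt_code True (list_decode m)) \<and>
     ev \<gamma> V = ev \<gamma> (concat (syls True (list_decode m)))"

text \<open>A code is at least the length of its word. This gives a computable bound for the length
  of the concatenation, and thereby for the number and the length of the syllables.\<close>

definition code_bd :: "nat \<Rightarrow> nat" where
  "code_bd m = list_encode (codes (concat (syls True (list_decode m))))"

definition malnormal_code :: "nat \<Rightarrow> 'a word \<Rightarrow> bool" where
  "malnormal_code m U \<longleftrightarrow> (\<forall>j<cb (conj_bound (code_bd m)).
     (ev \<gamma> (word_of X j) = ev \<gamma> [] \<or> ev \<gamma> (word_of X j) \<notin> C) \<or> ev \<gamma> (U @ word_of X j @ inv_word U) \<notin>
       C)"

text \<open>Letters are rotated, not syllables. The rotations of the syllable list are among these,
  and a rotation of letters is still a conjugate, so the additional conditions hold whenever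
  \<open>U\<close> and \<open>V\<close> are not conjugate.\<close>

definition not_conj_rotations :: "nat \<Rightarrow> nat \<Rightarrow> 'a word \<Rightarrow> bool" where
  "not_conj_rotations m m' U \<longleftrightarrow> (\<forall>i<Suc (code_bd m'). \<forall>j<cb (conj_bound (code_bd m + code_bd m')).
     ev \<gamma> (word_of X j) \<notin> C \<or> ev \<gamma> (conj_word U (word_of X j)) \<noteq> ev \<gamma> (rotate i (concat (syls True
       (list_decode m')))))"

text \<open>The three certificates cover cyclically reduced elements \<open>U\<close> of length one, zero
  and at least two.\<close>

definition cert_factor :: "'a word \<Rightarrow> 'a word \<Rightarrow> bool" where
  "cert_factor U V \<longleftrightarrow> (\<exists>g. avoids_C g U \<and>
     ((\<exists>m. cyc_code m V) \<or> (\<exists>s. ev \<gamma> V = ev \<gamma> (word_of Y s)) \<or> not_conj_in X g U V))"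

definition cert_amalgamated :: "'a word \<Rightarrow> 'a word \<Rightarrow> bool" where
  "cert_amalgamated U V \<longleftrightarrow> (\<exists>g g'. (regular_in X g U \<and> regular_in Y g' U) \<and>
     ((\<exists>m. cyc_code m V) \<or> not_conj_in X g U V \<or> not_conj_in Y g' U V))"

definition cert_cyclic :: "'a word \<Rightarrow> 'a word \<Rightarrow> bool" where
  "cert_cyclic U V \<longleftrightarrow> (\<exists>m. (cyc_code m U \<and> malnormal_code m U) \<and>
     ((\<exists>s. ev \<gamma> V = ev \<gamma> (word_of X s)) \<or> (\<exists>s. ev \<gamma> V = ev \<gamma> (word_of Y s)) \<or>
      (\<exists>m'. cyc_code m' V \<and> not_conj_rotations m m' U)))"

lemma computable_bd [computable_intros]: "computable f \<Longrightarrow> computable h \<Longrightarrow>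
  computable (\<lambda>n. search_bound (f n) (h n))"
  unfolding search_bound_def by (intro computable_intros)

lemma computable_conj_bound [computable_intros]: "computable f \<Longrightarrow> computable (\<lambda>n. conj_bound (f n))"
proof -
  assume f: "computable f"
  have "conj_bound m = rec_nat k (\<lambda>_ y. step_bound m y) m" for m
  proof -
    have "(step_bound m ^^ i) k = rec_nat k (\<lambda>_ y. step_bound m y) i" for i by (induction i) auto
    then show ?thesis by (simp add: conj_bound_def)
  qed
  moreover have "computable (\<lambda>n. rec_nat k (\<lambda>_ y. step_bound (f n) y) (f n))"
    unfolding step_bound_def by (intro computable_intros f computable_comp[OF f])
  ultimately show ?thesis by simp
qed

lemma computable_code_bd [computable_intros]: "computable f \<Longrightarrow> computable (\<lambda>n. code_bd (f n))"
  unfolding code_bd_def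
    by (intro computable_list_encode computable_word_rcl[OF computable_word_concat_syls]
    computable_intros)

lemma computable_word_conj_word [computable_word_intros]: "computable_word S F \<Longrightarrow>
  computable_word S H \<Longrightarrow> computable_word S (\<lambda>n. conj_word (F n) (H n))"
  unfolding conj_word_def by (intro computable_word_intros)

lemma computable_word_word_of_S: "Z \<subseteq> S \<Longrightarrow> computable f \<Longrightarrow> computable_word S (\<lambda>n. word_of Z (f n))"
  by (rule computable_word_mono[OF computable_word_word_of])

lemma enumerable_not_conj_in:
  assumes Z: "Z \<subseteq> S" and f: "computable f" and F: "computable_word S F" and H: "computable_word S H"
  shows "enumerable (\<lambda>n. not_conj_in Z (f n) (F n) (H n))"
  unfolding not_conj_in_def
  by (intro enumerable_intros computable_word_conj_word computable_word_word_of_S[OF Z] F H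
    computable_word_comp[OF F] computable_word_comp[OF H] f computable_comp[OF f] computable_intros)

lemma enumerable_regular_in:
  assumes Z: "Z \<subseteq> S" and f: "computable f" and F: "computable_word S F"
  shows "enumerable (\<lambda>n. regular_in Z (f n) (F n))"
  unfolding regular_in_def
  by (intro enumerable_intros computable_word_conj_word computable_word_word_of_S[OF Z] F
    computable_word_comp[OF F] f computable_comp[OF f] computable_intros)

lemma enumerable_avoids_C:
  assumes f: "computable f" and F: "computable_word S F"
    shows "enumerable (\<lambda>n. avoids_C (f n) (F n))"
  unfolding avoids_C_def
  by (intro enumerable_intros computable_word_conj_word computable_word_word_of_S[OF X_S] F
    computable_word_comp[OF F] f computable_comp[OF f] computable_intros)

lemma enumerable_cyc_code:
  assumes f: "computable f" and F: "computable_word S F"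
    shows "enumerable (\<lambda>n. cyc_code (f n) (F n))"
  unfolding cyc_code_def
  by (intro enumerable_conj enumerable_ev_eq computable_word_concat_syls enumerable_dec
    decidable_conj decidable_alt_code F f computable_intros)

lemma enumerable_malnormal_code:
  assumes f: "computable f" and F: "computable_word S F"
    shows "enumerable (\<lambda>n. malnormal_code (f n) (F n))"
  unfolding malnormal_code_def
  by (intro enumerable_intros computable_word_word_of_S[OF X_S] computable_word_append
    computable_word_inv_word computable_word_const F computable_word_comp[OF F] f computable_comp[OF
    f] computable_intros
      lists.Nil)

lemma enumerable_not_conj_rotations:
  assumes f: "computable f" and h: "computable h" and F: "computable_word S F"
  shows "enumerable (\<lambda>n. not_conj_rotations (f n) (h n) (F n))"
  unfolding not_conj_rotations_def
  by (intro enumerable_intros computable_word_word_of_S[OF X_S] computable_word_conj_word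
    computable_word_rotate computable_word_concat_syls F computable_word_comp[OF F]
      f computable_comp[OF f] h computable_comp[OF h] computable_intros)

lemma enumerable_cert_factor:
  assumes F: "computable_word S F" and H: "computable_word S H"
    shows "enumerable (\<lambda>n. cert_factor (F n) (H n))"
  unfolding cert_factor_def
  by (intro enumerable_ex enumerable_conj enumerable_disj enumerable_ev_eq enumerable_avoids_C
    enumerable_cyc_code enumerable_not_conj_in X_S computable_word_word_of_S[OF Y_S]
      computable_word_comp[OF F] computable_word_comp[OF H] computable_intros)

lemma enumerable_cert_amalgamated:
  assumes F: "computable_word S F" and H: "computable_word S H"
    shows "enumerable (\<lambda>n. cert_amalgamated (F n) (H n))"
  unfolding cert_amalgamated_def
  by (intro enumerable_ex enumerable_conj enumerable_disj enumerable_regular_in enumerable_cyc_code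
    enumerable_not_conj_in X_S Y_S
      computable_word_comp[OF F] computable_word_comp[OF H] computable_intros)

lemma enumerable_cert_cyclic:
  assumes F: "computable_word S F" and H: "computable_word S H"
    shows "enumerable (\<lambda>n. cert_cyclic (F n) (H n))"
  unfolding cert_cyclic_def
  by (intro enumerable_ex enumerable_conj enumerable_disj enumerable_ev_eq enumerable_cyc_code
    enumerable_malnormal_code enumerable_not_conj_rotations
      computable_word_word_of_S[OF X_S] computable_word_word_of_S[OF Y_S] computable_word_comp[OF F]
        computable_word_comp[OF H] computable_intros)

section \<open>Soundness of the certificates\<close>

lemma short_in:
  assumes "free_factor \<gamma> Z T k" "Z \<subseteq> S"
  shows "free_factor.W Z n \<le> cb n"
  unfolding free_factor.W_def[OF assms(1)] cb_def
  by (rule card_words_le_code_bound) (use assms in \<open>simp_all add: b_def\<close>)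

lemma not_conj_in_sound:
  assumes ff: "free_factor \<gamma> Z T k" and Z: "Z \<subseteq> S"
    and "ev \<gamma> U = ev \<gamma> (word_of Z g)" "not_conj_in Z g U V" "h \<in> ev \<gamma> ` words Z"
  shows "- h + ev \<gamma> U + h \<noteq> ev \<gamma> V"
proof
  assume *: "- h + ev \<gamma> U + h = ev \<gamma> V"
  obtain s where s: "ev \<gamma> V = ev \<gamma> (word_of Z s)"
    "\<forall>j<search_bound g s. ev \<gamma> (conj_word U (word_of Z j)) \<noteq> ev \<gamma> V"
    using assms(4) by (auto simp: not_conj_in_def)
  have "h \<in> free_factor.A \<gamma> Z" using assms(5) by (simp add: free_factor.A_def[OF ff])
  from free_factor.short_conjugator[OF ff word_of_in_words[OF Z] word_of_in_words[OF Z] this, of g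
    s]
  obtain w where w: "w \<in> words Z"
    "length w \<le> length (word_of Z s) + free_factor.W Z (length (word_of Z g))"
    "- ev \<gamma> w + ev \<gamma> U + ev \<gamma> w = ev \<gamma> V"
    using * s(1) assms(3) by (auto simp: ball_def)
  have "free_factor.W Z (length (word_of Z g)) \<le> cb g"
    by (rule order_trans[OF short_in[OF ff Z] cb_mono[OF length_word_of_le]])
  then have "length w \<le> k + 2 * cb g + s" using w(2) length_word_of_le[of Z s] by simp
  from all_short[OF s(2)[unfolded search_bound_def] w(1) Z this] show False using w(3)
    by (simp add: ev_conj_word)
qed

lemma short_into_C:
  assumes ff: "free_factor \<gamma> Z T k" and Z: "Z \<subseteq> S" and C: "free_factor.C \<gamma> T = C"
    and "ev \<gamma> U = ev \<gamma> (word_of Z g)" "D = {} \<or> D = C"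
    and all: "\<forall>j<search_bound g 0. ev \<gamma> (word_of Z j) \<in> D \<or> ev \<gamma> (conj_word U (word_of Z j)) \<notin> C"
    and "h \<in> ev \<gamma> ` words Z" "h \<notin> D"
  shows "- h + ev \<gamma> U + h \<notin> C"
proof
  assume *: "- h + ev \<gamma> U + h \<in> C"
  have "h \<in> free_factor.A \<gamma> Z" using assms(7) by (simp add: free_factor.A_def[OF ff])
  from free_factor.short_conjugator_into_C[OF ff word_of_in_words[OF Z] this assms(8), of g]
  obtain w where w: "w \<in> words Z" "length w \<le> k + 2 * free_factor.W Z (length (word_of Z g))"
    "ev \<gamma> w \<notin> D" "- ev \<gamma> w + ev \<gamma> U + ev \<gamma> w \<in> C"
    using * assms(4,5) C by (auto simp: ball_def)
  have "free_factor.W Z (length (word_of Z g)) \<le> cb g"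
    by (rule order_trans[OF short_in[OF ff Z] cb_mono[OF length_word_of_le]])
  then have "length w \<le> k + 2 * cb g + 0" using w(2) by simp
  from all_short[OF all[unfolded search_bound_def] w(1) Z this] show False using w(3,4)
    by (simp add: ev_conj_word)
qed

lemma cyc_codeD:
  assumes "cyc_code m V"
  obtains l where "list_decode m = l" "alt_code True l" "am.cyc (map (ev \<gamma>) (syls True l))"
    "sum_list (map (ev \<gamma>) (syls True l)) = ev \<gamma> V" "l \<noteq> []"
  using assms cyc_code_iff[of True "list_decode m"] ev_syls unfolding cyc_code_def by metis

lemma cyc_codeI:
  assumes "am.cyc gs" "hd gs \<in> A" "sum_list gs = ev \<gamma> V"
  obtains m where "cyc_code m V" "map (ev \<gamma>) (syls True (list_decode m)) = gs"
proof -
  have gs: "am.alt gs" "gs \<noteq> []" using assms by (auto simp: am.cyc_def)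
  obtain l where l: "alt_code True l" "map (ev \<gamma>) (syls True l) = gs"
    using alt_code_exists[OF gs(1), of True] assms(2) by auto
  have ne: "l \<noteq> []" using l(2) gs(2) by auto
  then have "cyc_code (list_encode l) V"
    using l assms cyc_code_iff[OF l(1) ne] by (simp add: cyc_code_def ev_syls)
  then show thesis using that[of "list_encode l"] l by simp
qed

text \<open>By \<open>cyc_conjugate\<close> the factor element would be conjugate to a rotation of
  \<open>vs\<close> by an element of \<open>C\<close>. Such a conjugation does not leave the factor,
  but the rotation has at least two syllables.\<close>

lemma cyc_not_conj_factor:
  assumes "am.cyc vs" "u \<in> A \<union> B" "h \<in> G" "- h + u + h = sum_list vs" shows False
proof -
  have "- h \<in> am.U" using assms(3) subgrp_minus[OF G] by (simp add: U_eq_G)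
  then obtain c hs where h: "c \<in> C" "am.alt hs" "- h = c + sum_list hs" using am.alt_form' by metis
  have "u = - (c + sum_list hs) + sum_list vs + (c + sum_list hs)"
    unfolding assms(4)[symmetric] h(3)[symmetric]
      by (simp add: group_simps del: add_uminus_conv_diff)
  from am.cyc_conjugate[OF assms(1) h(2,1) this] assms(2)
  obtain d r where d: "d \<in> C" "u = - d + sum_list (rotate r vs) + d" by blast
  have "sum_list (rotate r vs) = d + u + - d" unfolding d(2)
    by (simp add: group_simps del: add_uminus_conv_diff)
  also have "\<dots> \<in> A \<union> B" using assms(2) d(1) subgrp_minus[OF am.C d(1)]
    by (simp only: Un_iff am.C_iffs)
  finally have "length (rotate r vs) \<le> 1"
    using am.alt_sum_in_factor am.cyc_rotate[OF assms(1)] unfolding am.cyc_def by blast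
  then show False using am.cyc_length[OF assms(1)] by simp
qed

text \<open>\<open>factor_conjugate\<close> confines every conjugator that leads into a factor to
  \<open>A\<close>. If \<open>V\<close> lay in \<open>B\<close>, it would then lie in
  \<open>C\<close>, contrary to \<open>avoids_C\<close>; inside \<open>A\<close> the bounded search
  of \<open>not_conj_in\<close> is exhaustive.\<close>

lemma cert_factor_sound:
  assumes "cert_factor U V" "h \<in> G" shows "- h + ev \<gamma> U + h \<noteq> ev \<gamma> V"
proof
  assume *: "- h + ev \<gamma> U + h = ev \<gamma> V"
  obtain g where g: "avoids_C g U"
    "(\<exists>m. cyc_code m V) \<or> (\<exists>s. ev \<gamma> V = ev \<gamma> (word_of Y s)) \<or> not_conj_in X g U V"
    using assms(1) by (auto simp: cert_factor_def)
  have u: "ev \<gamma> U = ev \<gamma> (word_of X g)" using g(1) by (simp add: avoids_C_def)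
  have uA: "ev \<gamma> U \<in> A" unfolding u A_def using word_of_in_words[OF X_S] by blast
  have avoid: "- a + ev \<gamma> U + a \<notin> C" if "a \<in> A" for a
    by (rule short_into_C[OF fx.free_factor_axioms X_S fx_sets(2) u, of "{}"])
      (use g(1) that in \<open>auto simp: avoids_C_def A_def\<close>)
  obtain c hs where h: "c \<in> C" "am.alt hs" "h = c + sum_list hs"
    using am.alt_form' assms(2) unfolding U_eq_G by metis
  have inA: "h \<in> A" if "ev \<gamma> V \<in> A \<union> B"
    using am.factor_conjugate[OF uA avoid h(2,1,3)] * that by simp
  from g(2) show False
  proof (elim disjE exE)
    fix m assume "cyc_code m V"
    then show False using cyc_not_conj_factor[OF _ _ assms(2), of _ "ev \<gamma> U"] uA *
      by (metis UnI1 cyc_codeD)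
  next
    fix s assume "ev \<gamma> V = ev \<gamma> (word_of Y s)"
    then have B: "ev \<gamma> V \<in> B" unfolding B_def using word_of_in_words[OF Y_S] by auto
    then have "h \<in> A" using inA by blast
    then have "ev \<gamma> V \<in> A" unfolding *[symmetric] using uA
      by (auto intro: subgrp_add[OF am.A] subgrp_minus[OF am.A])
    then have "ev \<gamma> V \<in> C" using B am.Int by blast
    then show False using avoid[OF \<open>h \<in> A\<close>] * by simp
  next
    assume nc: "not_conj_in X g U V"
    then have "ev \<gamma> V \<in> A" unfolding A_def not_conj_in_def using word_of_in_words[OF X_S] by auto
    then have "h \<in> A" using inA by blast
    then show False using not_conj_in_sound[OF fx.free_factor_axioms X_S u nc] *
      by (simp add: A_def)
  qed
qed

lemma cert_amalgamated_sound:
  assumes "cert_amalgamated U V" "h \<in> G" shows "- h + ev \<gamma> U + h \<noteq> ev \<gamma> V"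
proof
  assume *: "- h + ev \<gamma> U + h = ev \<gamma> V"
  obtain g g' where g: "regular_in X g U" "regular_in Y g' U"
    "(\<exists>m. cyc_code m V) \<or> not_conj_in X g U V \<or> not_conj_in Y g' U V"
    using assms(1) by (auto simp: cert_amalgamated_def)
  have u: "ev \<gamma> U = ev \<gamma> (word_of X g)" "ev \<gamma> U = ev \<gamma> (word_of Y g')" using g
    by (simp_all add: regular_in_def)
  have uA: "ev \<gamma> U \<in> A" unfolding u(1) A_def using word_of_in_words[OF X_S] by blast
  have uB: "ev \<gamma> U \<in> B" unfolding u(2) B_def using word_of_in_words[OF Y_S] by blast
  have uC: "ev \<gamma> U \<in> C" using uA uB am.Int by blast
  have avoid: "- a + ev \<gamma> U + a \<notin> C" if "a \<in> (A \<union> B) - C" for a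
  proof (cases "a \<in> A")
    case True
    then show ?thesis
      using short_into_C[OF fx.free_factor_axioms X_S fx_sets(2) u(1), of C a] g(1) that
      by (simp add: regular_in_def A_def)
  next
    case False
    then show ?thesis
      using short_into_C[OF fy.free_factor_axioms Y_S fy_sets(2) u(2), of C a] g(2) that
      by (simp add: regular_in_def B_def)
  qed
  obtain c hs where h: "c \<in> C" "am.alt hs" "h = c + sum_list hs"
    using am.alt_form' assms(2) unfolding U_eq_G by metis
  have inAB: "h \<in> A \<union> B" if "ev \<gamma> V \<in> A \<union> B"
    using am.amalgamated_conjugate[OF uC avoid h(2,1,3)] * that by simp
  \<comment> \<open>A conjugator from one factor that takes \<open>U\<close> into the other factor
    takes it into \<open>C\<close> and therefore belongs to \<open>C\<close>. So \<open>h\<close>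
    lies in the factor of \<open>V\<close> in any case.\<close>
  have cross: "h \<in> C" if "h \<in> B \<and> ev \<gamma> V \<in> A \<or> h \<in> A \<and> ev \<gamma> V \<in> B"
  proof (rule ccontr)
    assume "h \<notin> C"
    have "h \<in> A \<Longrightarrow> ev \<gamma> V \<in> A" "h \<in> B \<Longrightarrow> ev \<gamma> V \<in> B"
      unfolding *[symmetric] using uA uB
      by (auto intro: subgrp_add[OF am.A] subgrp_minus[OF am.A] subgrp_add[OF am.B] subgrp_minus[OF
        am.B])
    then have "ev \<gamma> V \<in> C" using that am.Int by blast
    then show False using avoid[of h] that \<open>h \<notin> C\<close> * by auto
  qed
  from g(3) show False
  proof (elim disjE exE)
    fix m assume "cyc_code m V"
    then show False using cyc_not_conj_factor[OF _ _ assms(2), of _ "ev \<gamma> U"] uA *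
      by (metis UnI1 cyc_codeD)
  next
    assume nc: "not_conj_in X g U V"
    then have V: "ev \<gamma> V \<in> A" unfolding A_def not_conj_in_def using word_of_in_words[OF X_S] by auto
    then have "h \<in> A" using inAB cross C_sub by blast
    then show False using not_conj_in_sound[OF fx.free_factor_axioms X_S u(1) nc] *
      by (simp add: A_def)
  next
    assume nc: "not_conj_in Y g' U V"
    then have V: "ev \<gamma> V \<in> B" unfolding B_def not_conj_in_def using word_of_in_words[OF Y_S] by auto
    then have "h \<in> B" using inAB cross C_sub by blast
    then show False using not_conj_in_sound[OF fy.free_factor_axioms Y_S u(2) nc] *
      by (simp add: B_def)
  qed
qed

lemma concat_rotate: "\<exists>i. concat (rotate r ws) = rotate i (concat ws)"
proof (induction r)
  case 0
  show ?case by (rule exI[of _ 0]) simp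
next
  case (Suc r)
  then obtain i where i: "concat (rotate r ws) = rotate i (concat ws)" by blast
  have "concat (rotate1 vs) = rotate (length (hd vs)) (concat vs)" for vs :: "'b list list"
    by (cases vs) (simp_all add: rotate_append)
  then show ?case using i by (simp add: rotate_rotate) blast
qed

lemma code_bd_ge: "list_decode m = l \<Longrightarrow> length (concat (syls True l)) \<le> code_bd m"
  unfolding code_bd_def using length_le_word_code by simp

lemma syls_in_balls:
  assumes "length (concat (syls True l)) \<le> n"
  shows "set (map (ev \<gamma>) (syls True l)) \<subseteq> ball \<gamma> X n \<union> ball \<gamma> Y n"
  using syls_short[of True l] ball_mono[OF assms, of \<gamma> X] ball_mono[OF assms, of \<gamma> Y] by blast

lemma cert_cyclic_sound:
  assumes "cert_cyclic U V" "h \<in> G" shows "- h + ev \<gamma> U + h \<noteq> ev \<gamma> V"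
proof
  assume *: "- h + ev \<gamma> U + h = ev \<gamma> V"
  obtain m where m: "cyc_code m U" "malnormal_code m U"
    "(\<exists>s. ev \<gamma> V = ev \<gamma> (word_of X s)) \<or> (\<exists>s. ev \<gamma> V = ev \<gamma> (word_of Y s)) \<or> (\<exists>m'. cyc_code m' V \<and>
      not_conj_rotations m m' U)"
    using assms(1) by (auto simp: cert_cyclic_def)
  obtain l where l: "list_decode m = l" "alt_code True l" "am.cyc (map (ev \<gamma>) (syls True l))"
    "sum_list (map (ev \<gamma>) (syls True l)) = ev \<gamma> U" "l \<noteq> []" using m(1) by (rule cyc_codeD)
  let ?us = "map (ev \<gamma>) (syls True l)"
  have search_bound: "length (concat (syls True l)) \<le> code_bd m" by (rule code_bd_ge[OF l(1)])
  have alt: "am.alt ?us" using l(3) by (simp add: am.cyc_def)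
  have len: "length ?us \<le> code_bd m" using length_code_le[OF l(2)] search_bound by simp
  \<comment> \<open>By \<open>short_intersection_element\<close> the finite check of
    \<open>malnormal_code\<close> settles triviality for all of \<open>C\<close>.\<close>
  have triv: "d = 0" if d: "d \<in> C" "sum_list ?us + d - sum_list ?us \<in> C" for d
  proof (rule ccontr)
    assume "d \<noteq> 0"
    from short_intersection_element[OF alt len syls_in_balls[OF search_bound] d(1) this d(2)]
    obtain w where w: "w \<in> words X" "length w \<le> conj_bound (code_bd m)" "ev \<gamma> w \<in> C" "ev \<gamma> w \<noteq> 0"
      "ev \<gamma> U + ev \<gamma> w - ev \<gamma> U \<in> C" unfolding l(4) ball_def by blast
    from all_short[OF m(2)[unfolded malnormal_code_def] w(1) X_S w(2)] show False
      using w(3-5) by (simp add: add_diff_eq)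
  qed
  have not_AB: "ev \<gamma> V \<notin> A \<union> B"
  proof
    assume "ev \<gamma> V \<in> A \<union> B"
    then show False
      using cyc_not_conj_factor[OF l(3), of "ev \<gamma> V" "- h"] subgrp_minus[OF G assms(2)]
      unfolding *[symmetric] l(4) by (simp add: group_simps del: add_uminus_conv_diff)
  qed
  from m(3) show False
  proof (elim disjE exE conjE)
    fix s assume "ev \<gamma> V = ev \<gamma> (word_of X s)"
    then show False using not_AB word_of_in_words[OF X_S] by (simp add: A_def)
  next
    fix s assume "ev \<gamma> V = ev \<gamma> (word_of Y s)"
    then show False using not_AB word_of_in_words[OF Y_S] by (simp add: B_def)
  next
    fix m' assume m': "cyc_code m' V" "not_conj_rotations m m' U"
    obtain l' where l': "list_decode m' = l'" "alt_code True l'"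
      "am.cyc (map (ev \<gamma>) (syls True l'))"
      "sum_list (map (ev \<gamma>) (syls True l')) = ev \<gamma> V" "l' \<noteq> []" using m'(1) by (rule cyc_codeD)
    let ?vs = "map (ev \<gamma>) (syls True l')"
    have bd': "length (concat (syls True l')) \<le> code_bd m'" by (rule code_bd_ge[OF l'(1)])
    have "- h \<in> am.U" using assms(2) subgrp_minus[OF G] by (simp add: U_eq_G)
    then obtain c hs where h: "c \<in> C" "am.alt hs" "- h = c + sum_list hs" using am.alt_form'
      by metis
    have "ev \<gamma> U = - (c + sum_list hs) + sum_list ?vs + (c + sum_list hs)"
      unfolding l'(4) *[symmetric] h(3)[symmetric]
        by (simp add: group_simps del: add_uminus_conv_diff)
    from am.cyc_conjugate[OF l'(3) h(2,1) this] l(3,4)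
    obtain d r where d: "d \<in> C" "ev \<gamma> U = - d + sum_list (rotate r ?vs) + d" by blast
    \<comment> \<open>\<open>cyc_conjugate\<close> was applied from \<open>V\<close> to
      \<open>U\<close>, so the conjugator from \<open>U\<close> to the rotation is
      \<open>- d\<close>.\<close>
    have eq: "- (- d) + sum_list ?us + - d = sum_list (rotate r ?vs)"
      unfolding l(4) d(2) by (simp add: group_simps del: add_uminus_conv_diff)
    define n where "n = code_bd m + code_bd m'"
    have altr: "am.alt (rotate r ?vs)" using am.cyc_rotate[OF l'(3)] by (simp add: am.cyc_def)
    have sub: "set ?us \<union> set (rotate r ?vs) \<subseteq> ball \<gamma> X n \<union> ball \<gamma> Y n"
      using syls_in_balls[of l n] syls_in_balls[of l' n] search_bound bd' by (simp add: n_def)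
    have "length ?us \<le> n" using len by (simp add: n_def)
    from short_amalgamated_conjugator[OF alt altr this sub subgrp_minus[OF am.C d(1)] eq triv]
    obtain w where w: "w \<in> words X" "length w \<le> conj_bound n" "- d = ev \<gamma> w"
      by (auto simp: ball_def)
    obtain i where i: "concat (rotate r (syls True l')) = rotate i (concat (syls True l'))"
      using concat_rotate by blast
    \<comment> \<open>Reduction modulo the length brings the rotation into the range checked by
      \<open>not_conj_rotations\<close>, whose bound is computed from the code alone.\<close>
    define i' where "i' = i mod length (concat (syls True l'))"
    have "rotate i (concat (syls True l')) = rotate i' (concat (syls True l'))"
      unfolding i'_def by (rule rotate_conv_mod)
    then have ri: "sum_list (rotate r ?vs) = ev \<gamma> (rotate i' (concat (syls True l')))"
      using i ev_concat[of \<gamma> "rotate r (syls True l')"] by (simp add: rotate_map)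
    have "i' < Suc (code_bd m')"
    proof (cases "concat (syls True l') = []")
      case True
      then show ?thesis using length_code_le[OF l'(2)] l'(5) unfolding True by simp
    next
      case False
      then have "i' < length (concat (syls True l'))" unfolding i'_def
        by (intro mod_less_divisor) blast
      then show ?thesis using bd' by simp
    qed
    then have "\<forall>j<cb (conj_bound n). ev \<gamma> (word_of X j) \<notin> C \<or>
      ev \<gamma> (conj_word U (word_of X j)) \<noteq> ev \<gamma> (rotate i' (concat (syls True l')))"
      using m'(2) unfolding not_conj_rotations_def l'(1) n_def by blast
    from all_short[OF this w(1) X_S w(2)] have
      "ev \<gamma> w \<notin> C \<or> - ev \<gamma> w + ev \<gamma> U + ev \<gamma> w \<noteq> sum_list (rotate r ?vs)"
      unfolding ri ev_conj_word .
    then show False using eq subgrp_minus[OF am.C d(1)] unfolding w(3)[symmetric] l(4) by blast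
  qed
qed

section \<open>Completeness of the certificates\<close>

lemma conjugate_of_V:
  assumes "V \<in> words S"
  obtains y where "y \<in> words S" "ev \<gamma> (conj_word V y) \<in> A \<union> B \<or> (\<exists>m. cyc_code m (conj_word V y))"
proof -
  have "ev \<gamma> V \<in> am.U" using assms by (simp add: U_eq_G G_def)
  then obtain x g where x: "x \<in> G" "ev \<gamma> V = - x + g + x" "g \<in> A \<union> B \<or> (\<exists>gs. am.cyc gs \<and> hd gs \<in> A \<and>
    sum_list gs = g)"
    using am.cyc_form unfolding U_eq_G by metis
  obtain w where w: "w \<in> words S" "x = ev \<gamma> w" using x(1) unfolding G_def by blast
  have "ev \<gamma> (conj_word V (inv_word w)) = g"
    unfolding ev_conj_word x(2) w(2) by (simp add: group_simps del: add_uminus_conv_diff)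
  then show thesis using that[of "inv_word w"] w(1) x(3) cyc_codeI by (metis inv_word_in_words)
qed

lemma conjugates_differ:
  assumes "\<And>h. h \<in> G \<Longrightarrow> - h + u + h \<noteq> ev \<gamma> V" "y \<in> words S" "h \<in> G"
  shows "- h + u + h \<noteq> ev \<gamma> (conj_word V y)"
proof
  assume *: "- h + u + h = ev \<gamma> (conj_word V y)"
  have y: "ev \<gamma> y \<in> G" using assms(2) by (simp add: G_def)
  have "- (h - ev \<gamma> y) + u + (h - ev \<gamma> y) = ev \<gamma> y + (- h + u + h) - ev \<gamma> y"
    by (simp add: group_simps del: add_uminus_conv_diff)
  also have "\<dots> = ev \<gamma> V" unfolding * ev_conj_word
    by (simp add: group_simps del: add_uminus_conv_diff)
  finally show False using assms(1)[of "h - ev \<gamma> y"] subgrp_diff[OF G assms(3) y] by blast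
qed

lemma word_of_in_G: "Z \<subseteq> S \<Longrightarrow> ev \<gamma> (word_of Z j) \<in> G"
  unfolding G_def by (intro imageI words_mono[OF word_of_in_words])

lemma factor_code:
  assumes "g \<in> ev \<gamma> ` words Z" "Z \<subseteq> S" shows "\<exists>s. g = ev \<gamma> (word_of Z s)"
proof -
  from assms(1) obtain w where "g = ev \<gamma> w" "w \<in> words Z" by (rule imageE)
  with ex_word_code[OF this(2) assms(2)] show ?thesis by metis
qed

lemma A_code: "g \<in> A \<Longrightarrow> \<exists>s. g = ev \<gamma> (word_of X s)" and B_code: "g \<in> B \<Longrightarrow> \<exists>s. g = ev \<gamma> (word_of Y s)"
  unfolding A_def B_def by (rule factor_code; simp add: X_S Y_S)+

text \<open>The bounded checks of the certificate are instances of the unbounded statements that are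
  assumed. What has to be found is a conjugate of \<open>V\<close> that is in a factor or cyclically
  alternating.\<close>

lemma cert_factor_complete:
  assumes "V \<in> words S" "ev \<gamma> U \<in> A" "\<And>a. a \<in> A \<Longrightarrow> - a + ev \<gamma> U + a \<notin> C"
    and nc: "\<And>h. h \<in> G \<Longrightarrow> - h + ev \<gamma> U + h \<noteq> ev \<gamma> V"
  shows "\<exists>y\<in>words S. cert_factor U (conj_word V y)"
proof -
  obtain g where g: "ev \<gamma> U = ev \<gamma> (word_of X g)" using A_code[OF assms(2)] by blast
  have "ev \<gamma> (word_of X j) \<in> A" for j unfolding A_def using word_of_in_words[OF X_S] by blast
  then have "avoids_C g U" unfolding avoids_C_def ev_conj_word using g assms(3) by blast
  moreover obtain y where y: "y \<in> words S" "ev \<gamma> (conj_word V y) \<in> A \<union> B \<or>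
    (\<exists>m. cyc_code m (conj_word V y))"
    using assms(1) by (rule conjugate_of_V)
  moreover have "not_conj_in X g U (conj_word V y)" if in_fac: "ev \<gamma> (conj_word V y) \<in> A"
  proof -
    obtain s where "ev \<gamma> (conj_word V y) = ev \<gamma> (word_of X s)" using A_code[OF in_fac] by blast
    then show ?thesis unfolding not_conj_in_def ev_conj_word[of U]
      using conjugates_differ[OF nc y(1) word_of_in_G[OF X_S]] by blast
  qed
  moreover have "\<exists>s. ev \<gamma> (conj_word V y) = ev \<gamma> (word_of Y s)" if "ev \<gamma> (conj_word V y) \<in> B"
    using B_code[OF that] by blast
  ultimately show ?thesis unfolding cert_factor_def by blast
qed

lemma cert_amalgamated_complete:
  assumes "V \<in> words S" "ev \<gamma> U \<in> C" "\<And>a. a \<in> (A \<union> B) - C \<Longrightarrow> - a + ev \<gamma> U + a \<notin> C"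
    and nc: "\<And>h. h \<in> G \<Longrightarrow> - h + ev \<gamma> U + h \<noteq> ev \<gamma> V"
  shows "\<exists>y\<in>words S. cert_amalgamated U (conj_word V y)"
proof -
  obtain g where g: "ev \<gamma> U = ev \<gamma> (word_of X g)"
    using A_code[OF subsetD[OF C_sub(1) assms(2)]] by blast
  obtain g' where g': "ev \<gamma> U = ev \<gamma> (word_of Y g')"
    using B_code[OF subsetD[OF C_sub(2) assms(2)]] by blast
  have "ev \<gamma> (word_of X j) \<in> A" "ev \<gamma> (word_of Y j) \<in> B" for j
    unfolding A_def B_def using word_of_in_words[OF X_S] word_of_in_words[OF Y_S] by blast+
  then have "regular_in X g U" "regular_in Y g' U"
    unfolding regular_in_def ev_conj_word using g g' assms(3) by blast+
  moreover obtain y where y: "y \<in> words S" "ev \<gamma> (conj_word V y) \<in> A \<union> B \<or>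
    (\<exists>m. cyc_code m (conj_word V y))"
    using assms(1) by (rule conjugate_of_V)
  moreover have "not_conj_in X g U (conj_word V y)" if in_fac: "ev \<gamma> (conj_word V y) \<in> A"
  proof -
    obtain s where "ev \<gamma> (conj_word V y) = ev \<gamma> (word_of X s)" using A_code[OF in_fac] by blast
    then show ?thesis unfolding not_conj_in_def ev_conj_word[of U]
      using conjugates_differ[OF nc y(1) word_of_in_G[OF X_S]] by blast
  qed
  moreover have "not_conj_in Y g' U (conj_word V y)" if in_fac: "ev \<gamma> (conj_word V y) \<in> B"
  proof -
    obtain s where "ev \<gamma> (conj_word V y) = ev \<gamma> (word_of Y s)" using B_code[OF in_fac] by blast
    then show ?thesis unfolding not_conj_in_def ev_conj_word[of U]
      using conjugates_differ[OF nc y(1) word_of_in_G[OF Y_S]] by blast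
  qed
  ultimately show ?thesis unfolding cert_amalgamated_def by blast
qed

lemma rotate_conj: "\<exists>x\<in>words S. ev \<gamma> (rotate i w) = - ev \<gamma> x + ev \<gamma> w + ev \<gamma> x" if "w \<in> words S"
proof -
  define n where "n = i mod length w"
  have "rotate i w = drop n w @ take n w" unfolding n_def by (rule rotate_drop_take)
  moreover have "ev \<gamma> w = ev \<gamma> (take n w) + ev \<gamma> (drop n w)" by (simp flip: ev_append)
  moreover have "take n w \<in> words S" using that by (auto dest: in_set_takeD)
  ultimately show ?thesis
    by (intro bexI[of _ "take n w"]) (simp_all add: group_simps del: add_uminus_conv_diff)
qed

lemma cert_cyclic_complete:
  assumes "V \<in> words S" "am.cyc us" "hd us \<in> A" "sum_list us = ev \<gamma> U"
    and triv: "\<And>d. d \<in> C \<Longrightarrow> ev \<gamma> U + d - ev \<gamma> U \<in> C \<Longrightarrow> d = 0"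
    and nc: "\<And>h. h \<in> G \<Longrightarrow> - h + ev \<gamma> U + h \<noteq> ev \<gamma> V"
  shows "\<exists>y\<in>words S. cert_cyclic U (conj_word V y)"
proof -
  obtain m where m: "cyc_code m U" by (rule cyc_codeI[OF assms(2-4)])
  have "malnormal_code m U" unfolding malnormal_code_def
  proof (intro allI impI)
    fix j
    have "ev \<gamma> (U @ word_of X j @ inv_word U) = ev \<gamma> U + ev \<gamma> (word_of X j) - ev \<gamma> U"
      by (simp add: group_simps del: add_uminus_conv_diff)
    then show "(ev \<gamma> (word_of X j) = ev \<gamma> [] \<or> ev \<gamma> (word_of X j) \<notin> C) \<or>
      ev \<gamma> (U @ word_of X j @ inv_word U) \<notin> C"
      using triv[of "ev \<gamma> (word_of X j)"] by auto
  qed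
  moreover obtain y where y: "y \<in> words S" "ev \<gamma> (conj_word V y) \<in> A \<union> B \<or>
    (\<exists>m. cyc_code m (conj_word V y))"
    using assms(1) by (rule conjugate_of_V)
  moreover have "\<exists>s. ev \<gamma> (conj_word V y) = ev \<gamma> (word_of X s)" if "ev \<gamma> (conj_word V y) \<in> A"
    using A_code[OF that] by blast
  moreover have "\<exists>s. ev \<gamma> (conj_word V y) = ev \<gamma> (word_of Y s)" if "ev \<gamma> (conj_word V y) \<in> B"
    using B_code[OF that] by blast
  moreover have "not_conj_rotations m m' U" if m': "cyc_code m' (conj_word V y)" for m'
    unfolding not_conj_rotations_def
  proof (intro allI impI disjI2)
    fix i j
    let ?w = "concat (syls True (list_decode m'))"
    have wS: "?w \<in> words S"
      using computable_word_in[OF computable_word_concat_syls[OF computable_list_list_decode[OF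
      computable_id]]] .
    obtain x where x: "x \<in> words S" "ev \<gamma> (rotate i ?w) = - ev \<gamma> x + ev \<gamma> ?w + ev \<gamma> x"
      using rotate_conj[OF wS] by blast
    have "ev \<gamma> (rotate i ?w) = ev \<gamma> (conj_word V (y @ x))"
    proof -
      have "ev \<gamma> ?w = - ev \<gamma> y + ev \<gamma> V + ev \<gamma> y" using m' by (simp add: cyc_code_def ev_conj_word)
      then show ?thesis unfolding x(2) ev_conj_word
        by (simp add: group_simps del: add_uminus_conv_diff)
    qed
    then show "ev \<gamma> (conj_word U (word_of X j)) \<noteq> ev \<gamma> (rotate i ?w)"
      unfolding ev_conj_word[of U]
        using conjugates_differ[OF nc, of "y @ x"] y(1) x(1) word_of_in_G[OF X_S] by auto
  qed
  ultimately show ?thesis using m unfolding cert_cyclic_def by blast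
qed

text \<open>What cyclic reduction and regularity provide for the identity, an element of
  \<open>C\<close>, a single syllable and several syllables. The identity is listed separately,
  since no conjugation takes it out of \<open>C\<close>.\<close>

definition tractable :: "'g \<Rightarrow> bool" where
  "tractable u \<longleftrightarrow> u = 0 \<or> (u \<in> C \<and> (\<forall>a\<in>(A \<union> B) - C. - a + u + a \<notin> C)) \<or>
     (u \<in> A \<union> B \<and> (\<forall>h\<in>G. - h + u + h \<notin> C)) \<or>
     (\<exists>gs. am.cyc gs \<and> sum_list gs = u \<and> (\<forall>d\<in>C. u + d - u \<in> C \<longrightarrow> d = 0))"

definition search_answer :: "'a word \<Rightarrow> 'a word \<Rightarrow> nat \<Rightarrow> bool" where
  "search_answer U V r \<longleftrightarrow> (case r of 0 \<Rightarrow> \<not> (\<exists>h\<in>G. - h + ev \<gamma> U + h = ev \<gamma> V)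
     | Suc m \<Rightarrow> \<exists>w\<in>words S. m = word_code idx w \<and> - ev \<gamma> w + ev \<gamma> U + ev \<gamma> w = ev \<gamma> V)"

theorem conjugacy_search:
  obtains f where "partial_recursive f"
    "\<And>U V. U \<in> words S \<Longrightarrow> V \<in> words S \<Longrightarrow> \<exists>x\<in>G. tractable (- x + ev \<gamma> U + x) \<Longrightarrow>
       f (pair (word_code idx U) (word_code idx V)) \<noteq> None"
    "\<And>U V r. U \<in> words S \<Longrightarrow> V \<in> words S \<Longrightarrow> f (pair (word_code idx U) (word_code idx V)) = Some r \<Longrightarrow>
       search_answer U V r"
proof -
  interpret sw: presentation idx S Y X \<gamma> "map prod.swap rels" by (rule swap)
  have "fst ` set (map prod.swap rels) = snd ` set rels" by force
  then have sw: "sw.A = B" "sw.B = A" "sw.C = C"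
    unfolding sw.A_def A_def sw.B_def B_def sw.C_def C_Y by simp_all
  \<comment> \<open>The \<open>sw\<close> versions handle single syllables from \<open>B\<close> and
    cyclic forms that begin in \<open>B\<close>; the certificate for elements of \<open>C\<close>
    already treats both factors alike.\<close>
  define cert where "cert U V \<longleftrightarrow> (ev \<gamma> U = ev \<gamma> [] \<and> ev \<gamma> V \<noteq> ev \<gamma> []) \<or> cert_factor U V \<or>
    sw.cert_factor U V \<or>
    cert_amalgamated U V \<or> cert_cyclic U V \<or> sw.cert_cyclic U V" for U V
  have sound: "- h + ev \<gamma> U + h \<noteq> ev \<gamma> V" if "cert U V" "h \<in> G" for U V h
    using that cert_factor_sound sw.cert_factor_sound cert_amalgamated_sound cert_cyclic_sound
      sw.cert_cyclic_sound
    unfolding cert_def sw by auto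
  have cyc_sw: "sw.am.cyc gs" "gs \<noteq> []" "hd gs \<notin> A \<Longrightarrow> hd gs \<in> B" if "am.cyc gs" for gs
  proof -
    have alt: "am.alt gs" "gs \<noteq> []" using that by (auto simp: am.cyc_def)
    then have "hd gs \<in> (A \<union> B) - C" "last gs \<in> (A \<union> B) - C"
      using hd_in_set last_in_set unfolding alternating_def by blast+
    then have hB: "hd gs \<in> B \<longleftrightarrow> hd gs \<notin> A" "last gs \<in> B \<longleftrightarrow> last gs \<notin> A"
      using am.in_A_iff by blast+
    have c: "hd gs \<in> A \<longleftrightarrow> last gs \<notin> A" using that by (simp only: am.cyc_def)
    show "hd gs \<notin> A \<Longrightarrow> hd gs \<in> B" using hB by blast
    show "sw.am.cyc gs"
      unfolding sw.am.cyc_def unfolding sw alternating_commute[OF am.Int] using alt hB c by blast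
    show "gs \<noteq> []" by (rule alt(2))
  qed
  have complete: "\<exists>y\<in>words S. cert U (conj_word V y)"
    if "V \<in> words S" "tractable (ev \<gamma> U)" and nc: "\<And>h. h \<in> G \<Longrightarrow> - h + ev \<gamma> U + h \<noteq> ev \<gamma> V" for U V
    using that(2) unfolding tractable_def
  proof (elim disjE exE conjE)
    assume "ev \<gamma> U = 0"
    moreover have "ev \<gamma> V \<noteq> 0" using nc[of 0] subgrp_zero[OF G] \<open>ev \<gamma> U = 0\<close> by auto
    ultimately have "cert U (conj_word V [])" by (simp add: cert_def conj_word_def)
    then show ?thesis by (intro bexI[of _ "[]"]) auto
  next
    assume "ev \<gamma> U \<in> C" "\<forall>a\<in>(A \<union> B) - C. - a + ev \<gamma> U + a \<notin> C"
    then show ?thesis using cert_amalgamated_complete[OF that(1) _ _ nc] unfolding cert_def by blast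
  next
    assume *: "ev \<gamma> U \<in> A \<union> B" "\<forall>h\<in>G. - h + ev \<gamma> U + h \<notin> C"
    then show ?thesis
      using cert_factor_complete[OF that(1) _ _ nc] sw.cert_factor_complete[OF that(1), unfolded sw,
        OF _ _ nc] AB_G
      unfolding cert_def by blast
  next
    fix gs assume gs: "am.cyc gs" "sum_list gs = ev \<gamma> U" "\<forall>d\<in>C. ev \<gamma> U + d - ev \<gamma> U \<in> C \<longrightarrow> d = 0"
    show ?thesis
    proof (cases "hd gs \<in> A")
      case True
      then show ?thesis using cert_cyclic_complete[OF that(1) gs(1) True gs(2) _ nc] gs(3)
        unfolding cert_def by blast
    next
      case False
      then show ?thesis
        using sw.cert_cyclic_complete[OF that(1) cyc_sw(1)[OF gs(1)], unfolded sw, OF cyc_sw(3)[OF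
          gs(1)] gs(2) _ nc] gs(3)
        unfolding cert_def by blast
    qed
  qed
  have enumerable_cert: "enumerable (\<lambda>n. cert (F n) (H n))" if F: "computable_word S F"
    and H: "computable_word S H" for F H
    unfolding cert_def
    by (intro enumerable_disj enumerable_conj enumerable_ev_eq enumerable_ev_neq F H
      computable_word_const enumerable_cert_factor sw.enumerable_cert_factor
        enumerable_cert_amalgamated enumerable_cert_cyclic sw.enumerable_cert_cyclic lists.Nil)
  \<comment> \<open>Non-conjugacy may be certified for any conjugates of the two inputs, since it
    does not change under conjugation; the search itself finds suitable ones.\<close>
  define P where "P n r \<longleftrightarrow> (\<exists>j. r = Suc (list_encode (codes (word_of S j))) \<and>
    ev \<gamma> (conj_word (word_of S (p1 n)) (word_of S j)) = ev \<gamma> (word_of S (p2 n)))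
    \<or> (r = 0 \<and> (\<exists>x y. cert (conj_word (word_of S (p1 n)) (word_of S x)) (conj_word (word_of S (p2
      n)) (word_of S y))))" for n r
  have "enumerable (\<lambda>m. P (p1 m) (p2 m))"
    unfolding P_def
    by (intro enumerable_disj enumerable_conj enumerable_ex enumerable_dec decidable_eq
      enumerable_ev_eq enumerable_cert computable_word_conj_word computable_word_word_of_S[OF
      order_refl] computable_intros
        computable_word_rcl[OF computable_word_word_of_S[OF order_refl]])
  then obtain f where f: "partial_recursive f" "\<And>n r. f n = Some r \<Longrightarrow> P n r"
    "\<And>n r. P n r \<Longrightarrow> f n \<noteq> None"
    by (rule enumerable_selection) (rule that)
  have dwS: "word_of S (word_code idx W) = W" if "W \<in> words S" for W
    unfolding word_code_eq by (rule word_of_wc[OF that order_refl])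
  have dwG: "ev \<gamma> (word_of S j) \<in> G" for j by (rule word_of_in_G) simp
  show thesis
  proof (rule that[OF f(1)])
    fix U V assume UV: "U \<in> words S" "V \<in> words S" and "\<exists>x\<in>G. tractable (- x + ev \<gamma> U + x)"
    then obtain x where x: "x \<in> words S" "tractable (ev \<gamma> (conj_word U x))"
      unfolding G_def ev_conj_word by blast
    have Udw: "word_of S (p1 (pair (word_code idx U) (word_code idx V))) = U"
      "word_of S (p2 (pair (word_code idx U) (word_code idx V))) = V" using dwS UV by simp_all
    have "\<exists>r. P (pair (word_code idx U) (word_code idx V)) r"
    proof (cases "\<exists>h\<in>G. - h + ev \<gamma> U + h = ev \<gamma> V")
      case True
      then obtain w where w: "w \<in> words S" "ev \<gamma> (conj_word U w) = ev \<gamma> V"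
        unfolding G_def ev_conj_word by blast
      obtain j where "word_of S j = w" using ex_word_code[OF w(1) order_refl] by blast
      then show ?thesis unfolding P_def Udw using w(2) by blast
    next
      case False
      have "- h + ev \<gamma> (conj_word U x) + h \<noteq> ev \<gamma> V" if "h \<in> G" for h
      proof -
        have "- h + ev \<gamma> (conj_word U x) + h = - (ev \<gamma> x + h) + ev \<gamma> U + (ev \<gamma> x + h)"
          unfolding ev_conj_word by (simp add: group_simps del: add_uminus_conv_diff)
        moreover have "ev \<gamma> x + h \<in> G" using that x(1) subgrp_add[OF G] by (simp add: G_def)
        ultimately show ?thesis using False by auto
      qed
      from complete[OF UV(2) x(2) this] obtain y where y: "y \<in> words S"
        "cert (conj_word U x) (conj_word V y)" by blast
      obtain i j where "word_of S i = x" "word_of S j = y"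
        using ex_word_code[OF _ order_refl] x(1) y(1) by metis
      then show ?thesis unfolding P_def Udw using y(2) by blast
    qed
    then show "f (pair (word_code idx U) (word_code idx V)) \<noteq> None" using f(3) by blast
  next
    fix U V r assume UV: "U \<in> words S" "V \<in> words S"
      and "f (pair (word_code idx U) (word_code idx V)) = Some r"
    then have "P (pair (word_code idx U) (word_code idx V)) r" using f(2) by blast
    moreover have "word_of S (p1 (pair (word_code idx U) (word_code idx V))) = U"
      "word_of S (p2 (pair (word_code idx U) (word_code idx V))) = V" using dwS UV by simp_all
    ultimately consider (conj) j where "r = Suc (list_encode (codes (word_of S j)))"
      "ev \<gamma> (conj_word U (word_of S j)) = ev \<gamma> V"
      | (cert) x y where "r = 0" "cert (conj_word U (word_of S x)) (conj_word V (word_of S y))"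
      unfolding P_def by auto
    then show "search_answer U V r"
    proof cases
      case conj
      then show ?thesis using word_of_in_words[OF order_refl]
        by (auto simp: search_answer_def word_code_eq ev_conj_word intro!: bexI[of _ "word_of S j"])
    next
      case cert
      have "- h + ev \<gamma> U + h \<noteq> ev \<gamma> V" if "h \<in> G" for h
      proof
        assume *: "- h + ev \<gamma> U + h = ev \<gamma> V"
        let ?h = "- ev \<gamma> (word_of S x) + h + ev \<gamma> (word_of S y)"
        have "?h \<in> G" using that dwG subgrp_add[OF G] subgrp_minus[OF G] by blast
        moreover have "- ?h + ev \<gamma> (conj_word U (word_of S x)) + ?h = ev \<gamma> (conj_word V (word_of S
          y))"
          unfolding ev_conj_word *[symmetric] by (simp add: group_simps del: add_uminus_conv_diff)
        ultimately show False using sound[OF cert(2)] by blast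
      qed
      then show ?thesis using cert(1) by (auto simp: search_answer_def)
    qed
  qed
qed

end

section \<open>The presentation as an amalgamated product\<close>

lemma ev_cong: "w \<in> words X \<Longrightarrow> (\<And>x. x \<in> X \<Longrightarrow> \<gamma> x = \<gamma>' x) \<Longrightarrow> ev \<gamma> w = ev \<gamma>' w"
  unfolding ev_def by (intro arg_cong[where f = sum_list] map_cong) (auto simp: in_lists_conv_set)

lemma ev_hom:
  assumes "w \<in> words X" "subgrp F" "\<And>x. x \<in> X \<Longrightarrow> \<sigma> x \<in> F"
    and add: "\<And>a b. a \<in> F \<Longrightarrow> b \<in> F \<Longrightarrow> h (a + b) = h a + (h b :: 'h::group_add)"
  shows "ev (\<lambda>x. h (\<sigma> x)) w = h (ev \<sigma> w) \<and> ev \<sigma> w \<in> F"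
proof -
  note F = subgrpD[OF assms(2)]
  have zero: "h 0 = 0" using add[of 0 0] F(1) add_left_imp_eq[of "h 0" "h 0" 0] by simp
  have minus: "h (- a) = - h a" if "a \<in> F" for a
    using add[of a "- a"] that F(3)[OF that] zero by (simp add: minus_unique)
  show ?thesis using assms(1)
  proof (induction w rule: lists.induct)
    case (Cons p w)
    have "ev (\<lambda>x. h (\<sigma> x)) [p] = h (ev \<sigma> [p]) \<and> ev \<sigma> [p] \<in> F"
      using Cons.hyps(1) assms(3)[of "fst p"] by (auto simp: ev_def minus F)
    then show ?case using Cons.IH ev_Cons[of _ p w] add F(2) by metis
  qed (simp_all add: zero F)
qed

locale amalgamated_presentation =
  fixes X Y :: "'a set"
    and C :: "('c, 'm) monoid_scheme"
    and Z :: "'c set"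
    and \<phi> \<psi> :: "'c \<Rightarrow> 'a word set"
  assumes finite_X: "finite X" and finite_Y: "finite Y" and disjoint: "X \<inter> Y = {}"
    and group_C: "group C"
    and finite_Z: "finite Z" and Z: "Z \<subseteq> carrier C" "generate C Z = carrier C"
    and \<phi>: "\<phi> \<in> mon C (free_group X)"
    and \<psi>: "\<psi> \<in> mon C (free_group Y)"
begin

definition S where "S = X \<union> Y"
definition R where "R = amalgam_rels Z \<phi> \<psi>"
definition G where "G = presented_group S R"

sublocale C: group C by (rule group_C)
sublocale FX: group "free_group X" unfolding free_group_def by (rule group_presented_group)
sublocale FY: group "free_group Y" unfolding free_group_def by (rule group_presented_group)
sublocale G: group G unfolding G_def by (rule group_presented_group)

definition factor :: "bool \<Rightarrow> 'a word set monoid" where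
  "factor i = free_group (if i then Y else X)"

definition emb :: "bool \<Rightarrow> 'c \<Rightarrow> 'a word set" where "emb i = (if i then \<psi> else \<phi>)"

lemma group_factor: "group (factor i)"
  unfolding factor_def free_group_def by (rule group_presented_group)

lemma emb: "emb i \<in> mon C (factor i)"
  using \<phi> \<psi> by (simp add: emb_def factor_def)

lemma emb_hom: "emb i \<in> hom C (factor i)" and emb_inj: "inj_on (emb i) (carrier C)"
  using emb[of i] by (auto simp: mon_def)

lemma emb_closed: "c \<in> carrier C \<Longrightarrow> emb i c \<in> carrier (factor i)"
  using emb_hom[of i] by (auto simp: hom_def)

definition F :: "bool \<Rightarrow> 'a word set bijection set" where
  "F i = cay (factor i) ` carrier (factor i)"

definition K :: "'c bijection set" where "K = cay C ` carrier C"

definition \<iota> :: "bool \<Rightarrow> 'c bijection \<Rightarrow> 'a word set bijection" where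
  "\<iota> i a = cay (factor i) (emb i (inv_into (carrier C) (cay C) a))"

lemma \<iota>_cay: "c \<in> carrier C \<Longrightarrow> \<iota> i (cay C c) = cay (factor i) (emb i c)"
  unfolding \<iota>_def by (subst inv_into_f_f) (auto simp: inj_on_def C.cay_eq_iff)

lemma subgrp_cay:
  assumes "group H" shows "subgrp (cay H ` carrier H)"
proof -
  interpret group H by (rule assms)
  show ?thesis unfolding subgrp_def by (auto simp flip: cay_mult cay_inv cay_one)
qed

sublocale ad: amalgam_data F K \<iota>
proof
  fix i
  interpret f: group "factor i" by (rule group_factor)
  show "subgrp (F i)" unfolding F_def by (rule subgrp_cay[OF group_factor])
  show "subgrp K" unfolding K_def by (rule subgrp_cay[OF group_C])
  show "\<iota> i k \<in> F i" if "k \<in> K" for k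
    using that emb_closed by (auto simp: K_def F_def \<iota>_cay)
  show "\<iota> i (k + l) = \<iota> i k + \<iota> i l" if "k \<in> K" "l \<in> K" for k l
  proof -
    obtain c d where cd: "c \<in> carrier C" "d \<in> carrier C" "k = cay C c" "l = cay C d"
      using \<open>k \<in> K\<close> \<open>l \<in> K\<close> by (auto simp: K_def)
    have "k + l = cay C (c \<otimes>\<^bsub>C\<^esub> d)" using cd by (simp add: C.cay_mult)
    then show ?thesis
      using cd emb_closed by (simp add: \<iota>_cay hom_mult[OF emb_hom] f.cay_mult)
  qed
  show "inj_on (\<iota> i) K"
    unfolding K_def inj_on_def using emb_closed emb_inj[of i]
    by (auto simp: \<iota>_cay f.cay_eq_iff inj_on_def)
qed

section \<open>The presented group acts on normal forms\<close>

definition letters :: "bool \<Rightarrow> 'a set" where "letters i = (if i then Y else X)"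

definition cls :: "bool \<Rightarrow> 'a word \<Rightarrow> 'a word set bijection" where
  "cls i w = cay (factor i) (word_elem (letters i) {} w)"

lemma factor_eq: "factor i = presented_group (letters i) {}"
  by (simp add: factor_def letters_def free_group_def)

lemma cls_in_F: "w \<in> words (letters i) \<Longrightarrow> cls i w \<in> F i"
  by (auto simp: cls_def F_def factor_eq carrier_presented_group)

lemma cls_eq_iff:
  assumes "u \<in> words (letters i)" "v \<in> words (letters i)"
  shows "cls i u = cls i v \<longleftrightarrow> nf u = nf v"
proof -
  have "word_elem (letters i) {} w \<in> carrier (factor i)" if "w \<in> words (letters i)" for w
    using that by (auto simp: factor_eq carrier_presented_group)
  then show ?thesis
    using assms unfolding cls_def
    by (simp add: group.cay_eq_iff[OF group_factor] word_elem_eq_iff pres_rel_free_iff)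
qed

text \<open>Generators are sent to their action on normal forms. As the relations are respected,
  \<open>\<delta>\<close> factors through the presented group and serves to distinguish its
  elements; disjointness of \<open>X\<close> and \<open>Y\<close> makes the choice of the factor
  unambiguous.\<close>

definition \<delta> where
  "\<delta> x = (if x \<in> Y then ad.act_bij True (cls True [(x, False)]) else ad.act_bij False (cls False
    [(x, False)]))"

lemma ev_\<delta>: "w \<in> words (letters i) \<Longrightarrow> ev \<delta> w = ad.act_bij i (cls i w)"
proof -
  assume w: "w \<in> words (letters i)"
  have "ev \<delta> w = ev (\<lambda>x. ad.act_bij i (cls i [(x, False)])) w"
    using w by (rule ev_cong) (use disjoint in \<open>auto simp: \<delta>_def letters_def split: if_splits\<close>)
  also have "\<dots> = ad.act_bij i (ev (\<lambda>x. cls i [(x, False)]) w)"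
    using ev_hom[OF w ad.F[of i], of "\<lambda>x. cls i [(x, False)]"
      "ad.act_bij i"] cls_in_F ad.act_bij_add by auto
  also have "ev (\<lambda>x. cls i [(x, False)]) w = cls i w"
    unfolding cls_def factor_eq by (rule ev_cay[OF w])
  finally show ?thesis .
qed

lemma cls_emb:
  assumes "c \<in> carrier C" "w \<in> emb i c" shows "w \<in> words (letters i)" "cls i w = \<iota> i (cay C c)"
proof -
  obtain v where v: "v \<in> words (letters i)" "emb i c = word_elem (letters i) {} v"
    using emb_closed[OF assms(1), of i] by (auto simp: factor_eq carrier_presented_group)
  then have vw: "(v, w) \<in> pres_rel (letters i) {}" using assms(2) by (simp add: word_elem_def)
  then show w: "w \<in> words (letters i)"
    using equiv_pres_rel[of "letters i" "{}"] by (auto simp: equiv_def refl_on_def)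
  then have "word_elem (letters i) {} w = emb i c"
    using vw v by (simp add: word_elem_eq_iff pres_rel.sym)
  then show "cls i w = \<iota> i (cay C c)" using assms(1) by (simp add: cls_def \<iota>_cay)
qed

lemma emb_nonempty: "c \<in> carrier C \<Longrightarrow> \<exists>w. w \<in> emb i c"
proof -
  assume "c \<in> carrier C"
  then obtain v where "v \<in> words (letters i)" "emb i c = word_elem (letters i) {} v"
    using emb_closed[of c i] by (auto simp: factor_eq carrier_presented_group)
  then show ?thesis by (auto simp: word_elem_def intro: pres_rel.refl)
qed

lemma R_iff: "(r, s) \<in> R \<longleftrightarrow> (\<exists>z\<in>Z. r \<in> emb False z \<and> s \<in> emb True z)"
  by (auto simp: R_def amalgam_rels_def emb_def)

lemma ev_\<delta>_pres_rel: "(u, v) \<in> pres_rel S R \<Longrightarrow> ev \<delta> u = ev \<delta> v"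
proof (rule ev_pres_rel, assumption)
  fix r s assume "(r, s) \<in> R"
  then obtain z where z: "z \<in> carrier C" "r \<in> emb False z" "s \<in> emb True z"
    using Z(1) by (auto simp: R_iff)
  then have "ev \<delta> r = ad.act_bij False (\<iota> False (cay C z))"
    "ev \<delta> s = ad.act_bij True (\<iota> True (cay C z))"
    using ev_\<delta>[OF cls_emb(1)[OF z(1,2)]] cls_emb(2)[OF z(1,2)]
      ev_\<delta>[OF cls_emb(1)[OF z(1,3)]] cls_emb(2)[OF z(1,3)] by simp_all
  moreover have "cay C z \<in> K" using z by (simp add: K_def)
  ultimately show "ev \<delta> r = ev \<delta> s" using ad.act_bij_\<iota> by metis
qed

definition \<gamma> where "\<gamma> x = cay G (word_elem S R [(x, False)])"

lemma ev_\<gamma>: "w \<in> words S \<Longrightarrow> ev \<gamma> w = cay G (word_elem S R w)"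
  unfolding \<gamma>_def G_def by (rule ev_cay)

lemma word_elem_carrier: "w \<in> words S \<Longrightarrow> word_elem S R w \<in> carrier G"
  by (auto simp: G_def carrier_presented_group)

lemma ev_\<gamma>_iff: "u \<in> words S \<Longrightarrow> v \<in> words S \<Longrightarrow> ev \<gamma> u = ev \<gamma> v \<longleftrightarrow> (u, v) \<in> pres_rel S R"
  by (simp add: ev_\<gamma> G.cay_eq_iff word_elem_carrier word_elem_eq_iff)

lemma ev_\<gamma>_\<delta>: "u \<in> words S \<Longrightarrow> v \<in> words S \<Longrightarrow> ev \<gamma> u = ev \<gamma> v \<Longrightarrow> ev \<delta> u = ev \<delta> v"
  using ev_\<gamma>_iff ev_\<delta>_pres_rel by blast

lemma letters_S: "letters i \<subseteq> S"
  by (simp add: letters_def S_def)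

lemma words_letters_S: "w \<in> words (letters i) \<Longrightarrow> w \<in> words S"
  by (rule words_mono[OF _ letters_S])

text \<open>The factors embed: words of one factor that are equal in \<open>G\<close> act alike on
  normal forms, and each factor acts faithfully.\<close>

lemma free_letters:
  assumes "u \<in> words (letters i)" "v \<in> words (letters i)" "ev \<gamma> u = ev \<gamma> v" shows "nf u = nf v"
proof -
  have "ad.act_bij i (cls i u) = ad.act_bij i (cls i v)"
    using ev_\<gamma>_\<delta>[OF words_letters_S words_letters_S] assms ev_\<delta> by metis
  then have "cls i u = cls i v" using ad.act_bij_inj cls_in_F assms by blast
  then show ?thesis using cls_eq_iff assms by blast
qed

section \<open>Finitely many relations suffice\<close>

definition rel_word :: "bool \<Rightarrow> 'c \<Rightarrow> 'a word" where "rel_word i c = (SOME w. w \<in> emb i c)"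

lemma rel_word: "c \<in> carrier C \<Longrightarrow> rel_word i c \<in> emb i c"
  unfolding rel_word_def using emb_nonempty by (rule someI_ex)

text \<open>\<open>R\<close> relates all representatives of the two images of a generator. One on
  each side is enough, because the others are freely equal to it; the inverses are added because
  \<open>presentation\<close> asks for closure under them.\<close>

definition pairs :: "('a word \<times> 'a word) set" where
  "pairs = (\<Union>z\<in>Z. {(rel_word False z, rel_word True z), (inv_word (rel_word False z), inv_word
    (rel_word True z))})"

lemma finite_pairs: "finite pairs"
  unfolding pairs_def using finite_Z by simp

lemma cls_append: "u \<in> words (letters i) \<Longrightarrow> v \<in> words (letters i) \<Longrightarrow>
  cls i (u @ v) = cls i u + cls i v"
proof -
  assume uv: "u \<in> words (letters i)" "v \<in> words (letters i)"
  have ev: "ev (\<lambda>x. cls i [(x, False)]) w = cls i w" if "w \<in> words (letters i)" for w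
    unfolding cls_def factor_eq by (rule ev_cay[OF that])
  show ?thesis using ev[OF uv(1)] ev[OF uv(2)] ev[of "u @ v"] uv by simp
qed

lemma cls_inv_word: "u \<in> words (letters i) \<Longrightarrow> cls i (inv_word u) = - cls i u"
proof -
  assume u: "u \<in> words (letters i)"
  have ev: "ev (\<lambda>x. cls i [(x, False)]) w = cls i w" if "w \<in> words (letters i)" for w
    unfolding cls_def factor_eq by (rule ev_cay[OF that])
  show ?thesis using ev[OF u] ev[of "inv_word u"] u by simp
qed

lemma cls_Nil: "cls i [] = 0"
  using ev_cay[of "[]" "letters i" "{}"] by (simp add: cls_def factor_eq)

lemma pairs_cls:
  assumes "(s, t) \<in> pairs"
  obtains c where "c \<in> carrier C" "s \<in> words (letters False)" "t \<in> words (letters True)"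
    "cls False s = \<iota> False (cay C c)" "cls True t = \<iota> True (cay C c)"
proof -
  obtain z where z: "z \<in> Z" and st: "(s = rel_word False z \<and> t = rel_word True z) \<or>
      (s = inv_word (rel_word False z) \<and> t = inv_word (rel_word True z))"
    using assms by (auto simp: pairs_def)
  have zC: "z \<in> carrier C" using z Z(1) by blast
  note rw = cls_emb[OF zC rel_word[OF zC]]
  from st show thesis
  proof
    assume "s = rel_word False z \<and> t = rel_word True z"
    then show thesis using that[of z] zC rw by blast
  next
    assume st: "s = inv_word (rel_word False z) \<and> t = inv_word (rel_word True z)"
    have "cls i (inv_word (rel_word i z)) = \<iota> i (cay C (inv\<^bsub>C\<^esub> z))" for i
      using zC rw[of i] ad.\<iota>_minus[of "cay C z" i] by (simp add: cls_inv_word C.cay_inv K_def)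
    then show thesis using that[of "inv\<^bsub>C\<^esub> z"] zC rw(1) st by simp
  qed
qed

lemma pairs_pres_rel: "(s, t) \<in> pairs \<Longrightarrow> (s, t) \<in> pres_rel S R"
proof -
  assume "(s, t) \<in> pairs"
  then obtain z where z: "z \<in> Z" and st: "(s = rel_word False z \<and> t = rel_word True z) \<or>
      (s = inv_word (rel_word False z) \<and> t = inv_word (rel_word True z))"
    by (auto simp: pairs_def)
  have zC: "z \<in> carrier C" using z Z(1) by blast
  have w: "rel_word i z \<in> words S" for i
    using words_letters_S[OF cls_emb(1)[OF zC rel_word[OF zC]]] .
  have *: "(rel_word False z, rel_word True z) \<in> pres_rel S R"
    by (rule pres_rel.relation) (use z rel_word[OF zC] w in \<open>auto simp: R_iff\<close>)
  then have "ev \<gamma> (rel_word False z) = ev \<gamma> (rel_word True z)" using ev_\<gamma>_iff[OF w w] by blast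
  then have "ev \<gamma> (inv_word (rel_word False z)) = ev \<gamma> (inv_word (rel_word True z))" by simp
  then have "(inv_word (rel_word False z), inv_word (rel_word True z)) \<in> pres_rel S R"
    using ev_\<gamma>_iff[of "inv_word (rel_word False z)" "inv_word (rel_word True z)"] w by simp
  then show ?thesis using * st by auto
qed

lemma pres_rel_pairs: "pres_rel S pairs = pres_rel S R"
proof (intro equalityI subrelI)
  fix u v assume "(u, v) \<in> pres_rel S pairs"
  then show "(u, v) \<in> pres_rel S R" by (rule pres_rel_mono) (rule pairs_pres_rel)
next
  fix u v assume "(u, v) \<in> pres_rel S R"
  then show "(u, v) \<in> pres_rel S pairs"
  proof (rule pres_rel_mono)
    fix r s assume "(r, s) \<in> R"
    then obtain z where z: "z \<in> Z" "r \<in> emb False z" "s \<in> emb True z" by (auto simp: R_iff)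
    then have zC: "z \<in> carrier C" using Z(1) by blast
    have free: "(w, rel_word i z) \<in> pres_rel S pairs" if "w \<in> emb i z" for i w
    proof -
      have "nf w = nf (rel_word i z)"
        using cls_emb[OF zC that] cls_emb[OF zC rel_word[OF zC]] cls_eq_iff by metis
      moreover have "w \<in> words S" "rel_word i z \<in> words S"
        using words_letters_S cls_emb(1)[OF zC] that rel_word[OF zC] by blast+
      ultimately have "(w, rel_word i z) \<in> pres_rel S {}" by (simp add: pres_rel_free_iff)
      then show ?thesis by (rule pres_rel_mono) simp
    qed
    have "rel_word False z \<in> words S" "rel_word True z \<in> words S"
      using words_letters_S cls_emb(1)[OF zC rel_word[OF zC]] by blast+
    then have "(rel_word False z, rel_word True z) \<in> pres_rel S pairs"
      using z(1) by (intro pres_rel.relation) (auto simp: pairs_def)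
    then show "(r, s) \<in> pres_rel S pairs"
      using free[OF z(2)] free[OF z(3)] by (meson pres_rel.trans pres_rel.sym)
  qed
qed

section \<open>The amalgamated subgroup and the normal form theorem\<close>

definition Cs where "Cs = ev \<gamma> ` concat ` lists (fst ` pairs)"

lemma concat_pairs_cls:
  assumes "ts \<in> lists (fst ` pairs)"
  shows "concat ts \<in> words (letters False)" "cls False (concat ts) \<in> \<iota> False ` K"
proof -
  have "concat ts \<in> words (letters False) \<and> cls False (concat ts) \<in> \<iota> False ` K"
    using assms
  proof (induction ts rule: lists.induct)
    case Nil
    show ?case using subgrp_zero[OF ad.\<iota>_image] by (simp add: cls_Nil)
  next
    case (Cons s ts)
    then obtain t where "(s, t) \<in> pairs" by auto
    then obtain c where "c \<in> carrier C" "s \<in> words (letters False)"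
      "cls False s = \<iota> False (cay C c)"
      by (rule pairs_cls)
    then have s: "s \<in> words (letters False)" "cls False s \<in> \<iota> False ` K" by (auto simp: K_def)
    show ?case using Cons.IH s by (simp add: cls_append subgrp_add[OF ad.\<iota>_image])
  qed
  then show "concat ts \<in> words (letters False)" "cls False (concat ts) \<in> \<iota> False ` K" by auto
qed

lemma carrier_C_pairs:
  assumes "c \<in> carrier C"
  shows "\<exists>ps\<in>lists pairs. cls False (concat (map fst ps)) = \<iota> False (cay C c) \<and>
      cls True (concat (map snd ps)) = \<iota> True (cay C c)"
proof -
  have words: "concat (map fst ps) \<in> words (letters False) \<and>
    concat (map snd ps) \<in> words (letters True)"
    if "ps \<in> lists pairs" for ps
    using that
  proof (induction ps rule: lists.induct)
    case (Cons p ps)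
    obtain s t where p: "p = (s, t)" by force
    then have "(s, t) \<in> pairs" using Cons by simp
    then have "s \<in> words (letters False) \<and> t \<in> words (letters True)" by (rule pairs_cls) simp
    then show ?case using Cons.IH p by simp
  qed simp
  have "c \<in> generate C Z" using assms Z(2) by simp
  then show ?thesis
  proof (induction rule: generate.induct)
    case one
    show ?case by (rule bexI[of _ "[]"]) (simp_all add: cls_Nil C.cay_one)
  next
    case (incl z)
    then have zC: "z \<in> carrier C" using Z(1) by blast
    show ?case
      by (rule bexI[of _ "[(rel_word False z, rel_word True z)]"])
        (use incl cls_emb(2)[OF zC rel_word[OF zC]] in \<open>auto simp: pairs_def\<close>)
  next
    case (inv z)
    then have zC: "z \<in> carrier C" using Z(1) by blast
    have "cls i (inv_word (rel_word i z)) = \<iota> i (cay C (inv\<^bsub>C\<^esub> z))" for i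
      using zC cls_emb[OF zC rel_word[OF zC], of i] ad.\<iota>_minus[of "cay C z" i]
      by (simp add: cls_inv_word C.cay_inv K_def)
    then show ?case
      by (intro bexI[of _ "[(inv_word (rel_word False z), inv_word (rel_word True z))]"])
        (use inv in \<open>auto simp: pairs_def\<close>)
  next
    case (eng c d)
    then obtain ps qs where ps: "ps \<in> lists pairs"
      "cls False (concat (map fst ps)) = \<iota> False (cay C c)"
        "cls True (concat (map snd ps)) = \<iota> True (cay C c)"
      and qs: "qs \<in> lists pairs" "cls False (concat (map fst qs)) = \<iota> False (cay C d)"
        "cls True (concat (map snd qs)) = \<iota> True (cay C d)" by blast
    have cd: "c \<in> carrier C" "d \<in> carrier C" using eng.hyps Z(2) by auto
    then have "\<iota> i (cay C (c \<otimes>\<^bsub>C\<^esub> d)) = \<iota> i (cay C c) + \<iota> i (cay C d)" for i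
      by (simp add: C.cay_mult ad.\<iota>_add K_def)
    then show ?case
      using ps qs words[OF ps(1)] words[OF qs(1)]
      by (intro bexI[of _ "ps @ qs"]) (simp_all add: cls_append)
  qed
qed

lemma cls_in_image_Cs:
  assumes "w \<in> words (letters i)" "cls i w \<in> \<iota> i ` K" shows "ev \<gamma> w \<in> Cs"
proof -
  obtain c where c: "c \<in> carrier C" "cls i w = \<iota> i (cay C c)" using assms(2) by (auto simp: K_def)
  obtain ps where ps: "ps \<in> lists pairs" "cls False (concat (map fst ps)) = \<iota> False (cay C c)"
      "cls True (concat (map snd ps)) = \<iota> True (cay C c)" using carrier_C_pairs[OF c(1)] by blast
  have w: "concat (map fst ps) \<in> words (letters False) \<and> concat (map snd ps) \<in> words (letters True)
    \<and>
      ev \<gamma> (concat (map fst ps)) = ev \<gamma> (concat (map snd ps))"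
    using ps(1)
  proof (induction ps rule: lists.induct)
    case (Cons p ps)
    obtain s t where p: "p = (s, t)" by force
    then have st: "(s, t) \<in> pairs" using Cons by simp
    then have "s \<in> words (letters False) \<and> t \<in> words (letters True)" by (rule pairs_cls) simp
    moreover from this have "ev \<gamma> s = ev \<gamma> t"
      using pairs_pres_rel[OF st] ev_\<gamma>_iff words_letters_S by blast
    ultimately show ?case using Cons.IH p by simp
  qed simp
  have "ev \<gamma> w = ev \<gamma> (concat (map fst ps))"
  proof (cases i)
    case True
    then have "nf w = nf (concat (map snd ps))" using cls_eq_iff assms(1) w c ps by metis
    then show ?thesis using w by (metis ev_nf)
  next
    case False
    then have "nf w = nf (concat (map fst ps))" using cls_eq_iff assms(1) w c ps by metis
    then show ?thesis by (metis ev_nf)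
  qed
  moreover have "map fst ps \<in> lists (fst ` pairs)" using ps(1) by (auto simp: in_lists_conv_set)
  ultimately show ?thesis unfolding Cs_def by blast
qed

text \<open>An element of \<open>Cs\<close> changes only the coefficient of the base point; this
  separates \<open>Cs\<close> from the alternating products.\<close>

lemma Cs_act:
  assumes "w \<in> words S" "ev \<gamma> w \<in> Cs" shows "snd (app (ev \<delta> w) (0, [])) = []"
proof -
  obtain ts where ts: "ts \<in> lists (fst ` pairs)" "ev \<gamma> w = ev \<gamma> (concat ts)" using assms(2)
    by (auto simp: Cs_def)
  note cts = concat_pairs_cls[OF ts(1)]
  have "ev \<delta> w = ad.act_bij False (cls False (concat ts))"
    using ev_\<gamma>_\<delta>[OF assms(1) words_letters_S[OF cts(1)] ts(2)] ev_\<delta>[OF cts(1)] by simp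
  moreover obtain k where "k \<in> K" "cls False (concat ts) = \<iota> False k" using cts(2) by auto
  ultimately show ?thesis
    using ad.base_normal by (simp add: ad.app_act_bij ad.\<iota>_in ad.act_\<iota>)
qed

text \<open>The image of the base point decides: an element of both factors outside
  \<open>Cs\<close> would send it to a single syllable from either factor at once, and a nonempty
  alternating product sends it to a form with syllables, which no element of \<open>Cs\<close>
  does.\<close>

lemma amalgam_Cs: "amalgam (ev \<gamma> ` words X) (ev \<gamma> ` words Y) Cs"
proof
  have lF: "letters False = X" and lT: "letters True = Y" by (simp_all add: letters_def)
  show "subgrp (ev \<gamma> ` words X)" "subgrp (ev \<gamma> ` words Y)" by (rule subgrp_ev_words)+
  have "Cs \<subseteq> ev \<gamma> ` words X"
    unfolding Cs_def using concat_pairs_cls(1) by (auto simp: lF)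
  moreover have "Cs \<subseteq> ev \<gamma> ` words Y"
  proof -
    have "Cs \<subseteq> ev \<gamma> ` concat ` lists (words Y)"
      unfolding Cs_def
    proof (rule ev_concat_mono)
      fix s assume "s \<in> fst ` pairs"
      then obtain t where st: "(s, t) \<in> pairs" by auto
      then have "s \<in> words X \<and> t \<in> words Y" by (rule pairs_cls) (simp add: lF lT)
      moreover from this have "ev \<gamma> s = ev \<gamma> t"
        using pairs_pres_rel[OF st] ev_\<gamma>_iff words_letters_S[of s False] words_letters_S[of t True]
          by (simp add: lF lT)
      ultimately show "\<exists>t\<in>words Y. ev \<gamma> s = ev \<gamma> t" by blast
    qed
    moreover have "concat ts \<in> words Y" if "ts \<in> lists (words Y)" for ts
      using that by (induction ts rule: lists.induct) auto
    ultimately show ?thesis by blast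
  qed
  moreover have "g \<in> Cs" if gX: "g \<in> ev \<gamma> ` words X" and gY: "g \<in> ev \<gamma> ` words Y" for g
  proof (rule ccontr)
    assume "g \<notin> Cs"
    obtain u where u: "g = ev \<gamma> u" "u \<in> words (letters False)" using gX unfolding lF
      by (rule imageE)
    obtain v where v: "g = ev \<gamma> v" "v \<in> words (letters True)" using gY unfolding lT by (rule imageE)
    have "cls False u \<notin> \<iota> False ` K" "cls True v \<notin> \<iota> True ` K"
      using cls_in_image_Cs[OF u(2)] cls_in_image_Cs[OF v(2)] \<open>g \<notin> Cs\<close>
      unfolding u(1)[symmetric] v(1)[symmetric] by blast+
    then have "map fst (snd (app (ad.act_bij False (cls False u)) (0, []))) = [False]"
      "map fst (snd (app (ad.act_bij True (cls True v)) (0, []))) = [True]"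
      using ad.app_sum_list[of "[(False, cls False u)]"] ad.app_sum_list[of "[(True, cls True v)]"]
        cls_in_F u(2) v(2) by auto
    moreover have "ad.act_bij False (cls False u) = ad.act_bij True (cls True v)"
      using ev_\<gamma>_\<delta>[of u v] words_letters_S u v ev_\<delta> by metis
    ultimately show False by simp
  qed
  ultimately show "ev \<gamma> ` words X \<inter> ev \<gamma> ` words Y = Cs" by blast
  fix gs assume alt: "alternating (ev \<gamma> ` words X) (ev \<gamma> ` words Y) Cs gs" and ne: "gs \<noteq> []"
  let ?i = "\<lambda>g. g \<notin> ev \<gamma> ` words X"
  have gs: "g \<in> ev \<gamma> ` words X \<union> ev \<gamma> ` words Y" "g \<notin> Cs" if "g \<in> set gs" for g
    using alt that by (auto simp: alternating_def)
  have "\<exists>w. w \<in> words (letters (?i g)) \<and> ev \<gamma> w = g" if "g \<in> set gs" for g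
    using gs(1)[OF that] by (cases "?i g") (auto simp: letters_def)
  then obtain f where f: "\<And>g. g \<in> set gs \<Longrightarrow> f g \<in> words (letters (?i g)) \<and> ev \<gamma> (f g) = g" by metis
  let ?ps = "map (\<lambda>g. (?i g, cls (?i g) (f g))) gs"
  have "successively (\<lambda>p q. fst p \<noteq> fst q) ?ps"
    using alt unfolding alternating_def successively_map by (auto elim: successively_mono)
  moreover have "a \<in> F i \<and> a \<notin> \<iota> i ` K" if ia: "(i, a) \<in> set ?ps" for i a
  proof -
    obtain g where g: "g \<in> set gs" "i = ?i g" "a = cls i (f g)" using ia by auto
    then have "f g \<in> words (letters i)" "ev \<gamma> (f g) \<notin> Cs" using f[OF g(1)] gs(2)[OF g(1)] by auto
    then show ?thesis using cls_in_F cls_in_image_Cs unfolding g(3) by blast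
  qed
  ultimately have "map fst (snd (app (sum_list (map (\<lambda>(i, a). ad.act_bij i a) ?ps)) (0, []))) = map
    fst ?ps"
    using ad.app_sum_list[of ?ps] by fastforce
  moreover have "map (\<lambda>(i, a). ad.act_bij i a) ?ps = map (\<lambda>g. ev \<delta> (f g)) gs"
    using ev_\<delta>[OF conjunct1[OF f]] by simp
  then have "sum_list (map (\<lambda>(i, a). ad.act_bij i a) ?ps) = ev \<delta> (concat (map f gs))"
    by (simp only: ev_concat map_map o_def)
  ultimately have "snd (app (ev \<delta> (concat (map f gs))) (0, [])) \<noteq> []" using ne by auto
  moreover have "f g \<in> words S" if "g \<in> set gs" for g using f[OF that] words_letters_S by blast
  then have "set (map f gs) \<subseteq> words S" by auto
  then have "concat (map f gs) \<in> words S" by (rule concat_words)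
  moreover have "ev \<gamma> (concat (map f gs)) = sum_list gs"
    using f by (simp add: ev_concat o_def map_idI)
  ultimately show "sum_list gs \<notin> Cs" using Cs_act by metis
qed

lemma presentation:
  assumes "inj_on idx S" "set rels = pairs" shows "presentation idx S X Y \<gamma> rels"
proof (intro presentation.intro presentation_axioms.intro coding.intro)
  have lF: "letters False = X" and lT: "letters True = Y" by (simp_all add: letters_def)
  show "inj_on idx S" by (rule assms)
  show "finite S" using finite_X finite_Y by (simp add: S_def)
  show "S = X \<union> Y" by (rule S_def)
  show "s \<in> words X \<and> t \<in> words Y" if "(s, t) \<in> set rels" for s t
    using that unfolding assms(2) by (rule pairs_cls) (simp add: lF lT)
  show "(inv_word s, inv_word t) \<in> set rels" if "(s, t) \<in> set rels" for s t
    using that unfolding assms(2) pairs_def by auto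
  show "ev \<gamma> u = ev \<gamma> v \<longleftrightarrow> (u, v) \<in> pres_rel S (set rels)" if "u \<in> words S" "v \<in> words S" for u v
    unfolding assms(2) pres_rel_pairs by (rule ev_\<gamma>_iff[OF that])
  show "nf u = nf v" if "u \<in> words X" "v \<in> words X" "ev \<gamma> u = ev \<gamma> v" for u v
    using free_letters[of u False v] that by (simp add: lF)
  show "nf u = nf v" if "u \<in> words Y" "v \<in> words Y" "ev \<gamma> u = ev \<gamma> v" for u v
    using free_letters[of u True v] that by (simp add: lT)
  show "amalgam (ev \<gamma> ` words X) (ev \<gamma> ` words Y) (ev \<gamma> ` concat ` lists (fst ` set rels))"
    using amalgam_Cs unfolding Cs_def assms(2) .
qed

end

section \<open>Transfer to the group of the theorem\<close>

lemma (in group) cay_conj_elem: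
  assumes "h \<in> carrier G" "g \<in> carrier G"
  shows "cay G (conj_elem G h g) = - cay G g + cay G h + cay G g"
  using assms by (simp add: conj_elem_def cay_mult cay_inv)

lemma (in group) conj_elem_closed: "h \<in> carrier G \<Longrightarrow> g \<in> carrier G \<Longrightarrow> conj_elem G h g \<in> carrier G"
  by (simp add: conj_elem_def)

lemma (in group) cay_foldr:
  "set gs \<subseteq> carrier G \<Longrightarrow> foldr (\<otimes>) gs \<one> \<in> carrier G \<and> cay G (foldr (\<otimes>) gs \<one>) = sum_list (map (cay G)
    gs)"
  by (induction gs) (simp_all add: cay_one cay_mult)

theorem corollary4p19:
  fixes X Y :: "'a set"
    and C :: "('c, 'm) monoid_scheme"
    and Z :: "'c set"
    and \<phi> \<psi> :: "'c \<Rightarrow> 'a word set"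
    and idx :: "'a \<Rightarrow> nat"
  assumes "finite X" and "finite Y" and "X \<inter> Y = {}"
    and "group C"
    and "finite Z" and "Z \<subseteq> carrier C" and "generate C Z = carrier C"
    and "\<phi> \<in> mon C (free_group X)"
    and "\<psi> \<in> mon C (free_group Y)"
    and "inj_on idx (X \<union> Y)"
  shows "let S = X \<union> Y;
             R = amalgam_rels Z \<phi> \<psi>;
             G = presented_group S R;
             A' = word_elem S R ` words X;
             B' = word_elem S R ` words Y;
             C' = A' \<inter> B'
         in CSP_decidable_on idx S R (CR G A' B' C' \<times> carrier G)"
proof -
  interpret ap: amalgamated_presentation X Y C Z \<phi> \<psi>
    by (rule amalgamated_presentation.intro; rule assms)
  obtain rels where rels: "set rels = ap.pairs" using finite_list[OF ap.finite_pairs] by blast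
  interpret pres: presentation idx ap.S X Y ap.\<gamma> rels
    by (rule ap.presentation[OF _ rels]) (use assms(10) in \<open>simp add: ap.S_def\<close>)
  define A' where "A' = word_elem ap.S ap.R ` words X"
  define B' where "B' = word_elem ap.S ap.R ` words Y"
  define C' where "C' = A' \<inter> B'"
  have carr: "A' \<subseteq> carrier ap.G" "B' \<subseteq> carrier ap.G" "C' \<subseteq> carrier ap.G"
    unfolding A'_def B'_def C'_def using pres.words_S ap.word_elem_carrier by blast+
  have inj: "inj_on (cay ap.G) (carrier ap.G)" by (simp add: inj_on_def ap.G.cay_eq_iff)
  have A: "pres.A = cay ap.G ` A'" and B: "pres.B = cay ap.G ` B'"
    unfolding pres.A_def pres.B_def A'_def B'_def image_image
    using pres.words_S ap.ev_\<gamma> by (auto intro!: image_cong)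
  have C: "pres.C = cay ap.G ` C'"
    using pres.am.Int unfolding A B C'_def using inj_on_image_Int[OF inj carr(1,2)] by simp
  have G: "pres.G = cay ap.G ` carrier ap.G"
    unfolding pres.G_def using ap.ev_\<gamma>
      by (auto simp: ap.G_def carrier_presented_group image_image intro!: image_cong)
  have cay_in: "cay ap.G x \<in> pres.A \<longleftrightarrow> x \<in> A'" "cay ap.G x \<in> pres.B \<longleftrightarrow> x \<in> B'" "cay ap.G x \<in> pres.C \<longleftrightarrow>
    x \<in> C'"
    if "x \<in> carrier ap.G" for x
    unfolding A B C using inj_on_image_mem_iff[OF inj that] carr by blast+
  \<comment> \<open>Here regularity is translated: for length zero it is used that \<open>g\<close>
    is not in \<open>Z_set\<close>, for length at least two that \<open>g\<close> is not in
    \<open>N_star\<close>. For length one the definition of cyclic reduction supplies the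
    property.\<close>
  have tractable: "pres.tractable (cay ap.G g)"
    if cr: "cyclically_reduced ap.G A' B' C' g" and reg: "regular ap.G C' g" for g
  proof -
    have g: "g \<in> carrier ap.G" "g \<notin> N_star ap.G C' - C'" "g \<notin> Z_set ap.G C'"
      using reg by (auto simp: regular_def singular_def)
    obtain c gs where c: "c \<in> C'" "set gs \<subseteq> (A' \<union> B') - C'"
      "successively (different_factors A' B') gs"
      "g = c \<otimes>\<^bsub>ap.G\<^esub> foldr (\<otimes>\<^bsub>ap.G\<^esub>) gs \<one>\<^bsub>ap.G\<^esub>"
      and cases: "length gs = 0 \<or> length gs = 1 \<and> \<not> (\<exists>h\<in>C'. conjugate_in ap.G g h) \<or>
        length gs \<ge> 2 \<and> different_factors A' B' (hd gs) (last gs)"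
      using cr unfolding cyclically_reduced_def reduced_form_def by blast
    have gs: "set gs \<subseteq> carrier ap.G" using c(2) carr by blast
    have cC: "c \<in> carrier ap.G" using c(1) carr by blast
    have cay_g: "cay ap.G g = cay ap.G c + sum_list (map (cay ap.G) gs)"
      unfolding c(4) using ap.G.cay_foldr[OF gs] cC by (simp add: ap.G.cay_mult)
    have cc: "cay ap.G c \<in> pres.C" using cay_in(3)[OF cC] c(1) by simp
    from cases show ?thesis
    proof (elim disjE conjE)
      assume "length gs = 0"
      then have gC: "cay ap.G g \<in> pres.C" using cay_g cc by simp
      have "- a + cay ap.G g + a \<notin> pres.C" if a: "a \<in> (pres.A \<union> pres.B) - pres.C"
        and ne: "cay ap.G g \<noteq> 0" for a
      proof
        assume conj: "- a + cay ap.G g + a \<in> pres.C"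
        have "a \<in> pres.G" using a pres.AB_G by blast
        then obtain x where x: "x \<in> carrier ap.G" "a = cay ap.G x" unfolding G by blast
        have xC: "x \<notin> C'" using a x cay_in(3) by simp
        let ?h = "conj_elem ap.G g x"
        have h: "?h \<in> carrier ap.G" "cay ap.G ?h = - a + cay ap.G g + a"
          using x g(1) by (simp_all add: ap.G.conj_elem_closed ap.G.cay_conj_elem)
        have hC: "?h \<in> C'" using cay_in(3)[OF h(1)] h(2) conj by simp
        have gC': "g \<in> C'" using cay_in(3)[OF g(1)] gC by simp
        have "?h \<noteq> \<one>\<^bsub>ap.G\<^esub>"
        proof
          assume "?h = \<one>\<^bsub>ap.G\<^esub>"
          then have "- a + cay ap.G g + a = 0" using h(2) ap.G.cay_one by simp
          then have "a + (- a + cay ap.G g + a) - a = 0" by simp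
          then show False using ne by (simp add: group_simps del: add_uminus_conv_diff)
        qed
        \<comment> \<open>\<open>?h\<close> is a nontrivial common element of \<open>C'\<close> and
          its conjugate by \<open>x\<close>, so \<open>x\<close> is in \<open>N_star\<close> outside
          \<open>C'\<close>. Conjugating \<open>?h\<close> back by the inverse of \<open>x\<close>
          gives \<open>g\<close>, which puts \<open>g\<close> into \<open>Z_set\<close>.\<close>
        moreover have "?h \<in> conj_set ap.G C' x" using gC' by (simp add: conj_set_def)
        ultimately have "x \<in> N_star ap.G C' - C'" using x(1) hC xC by (auto simp: N_star_def)
        moreover have "conj_elem ap.G ?h (inv\<^bsub>ap.G\<^esub> x) = g"
        proof (rule ap.G.cay_eq_iff[THEN iffD1])
          show "cay ap.G (conj_elem ap.G ?h (inv\<^bsub>ap.G\<^esub> x)) = cay ap.G g"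
            using x h g(1)
              by (simp add: ap.G.cay_conj_elem ap.G.cay_inv group_simps del: add_uminus_conv_diff)
        qed (use x h g(1) in \<open>simp_all add: ap.G.conj_elem_closed\<close>)
        then have "g \<in> conj_set ap.G C' (inv\<^bsub>ap.G\<^esub> x)" using hC unfolding conj_set_def by force
        ultimately have "g \<in> Z_set ap.G C'" using gC' unfolding Z_set_def by blast
        then show False using g(3) by blast
      qed
      then show ?thesis using gC unfolding pres.tractable_def by blast
    next
      assume "length gs = 1" and nc: "\<not> (\<exists>h\<in>C'. conjugate_in ap.G g h)"
      then obtain a where a: "gs = [a]" by (cases gs) auto
      have aG: "a \<in> carrier ap.G" "a \<in> A' \<union> B'" using gs c(2) a by auto
      have "cay ap.G g = cay ap.G c + cay ap.G a" using cay_g a by simp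
      moreover have "cay ap.G a \<in> pres.A \<union> pres.B" using cay_in[OF aG(1)] aG(2) by blast
      ultimately have "cay ap.G g \<in> pres.A \<union> pres.B" using pres.am.C_iffs[OF cc] by simp
      moreover have "- h + cay ap.G g + h \<notin> pres.C" if "h \<in> pres.G" for h
      proof
        assume *: "- h + cay ap.G g + h \<in> pres.C"
        obtain x where x: "x \<in> carrier ap.G" "h = cay ap.G x" using \<open>h \<in> pres.G\<close> unfolding G
          by blast
        have "conj_elem ap.G g x \<in> C'"
          using * cay_in(3)[OF ap.G.conj_elem_closed[OF g(1) x(1)]] x g(1)
            by (simp add: ap.G.cay_conj_elem)
        then show False using nc x(1) unfolding conjugate_in_def by blast
      qed
      ultimately show ?thesis unfolding pres.tractable_def by blast
    next
      assume len: "2 \<le> length gs" and df: "different_factors A' B' (hd gs) (last gs)"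
      obtain a zs where a: "gs = a # zs" "zs \<noteq> []"
        using len by (cases gs rule: remdups_adj.cases) auto
      have diff: "cay ap.G x \<in> pres.A \<longleftrightarrow> cay ap.G y \<notin> pres.A"
        if "different_factors A' B' x y" "x \<in> set gs" "y \<in> set gs" for x y
      proof -
        have "x \<in> (A' \<union> B') - C'" "y \<in> (A' \<union> B') - C'" using that(2,3) c(2) by auto
        moreover have "x \<in> carrier ap.G" "y \<in> carrier ap.G" using that(2,3) gs by auto
        ultimately show ?thesis using that(1) cay_in(1) unfolding different_factors_def C'_def
          by blast
      qed
      have "successively (\<lambda>x y. cay ap.G x \<in> pres.A \<longleftrightarrow> cay ap.G y \<notin> pres.A) gs"
        by (rule successively_mono[OF c(3)]) (use diff in blast)
      moreover have "cay ap.G x \<in> (pres.A \<union> pres.B) - pres.C" if "x \<in> set gs" for x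
        using that c(2) gs cay_in[of x] by auto
      ultimately have alt: "pres.am.alt (map (cay ap.G) gs)"
        unfolding alternating_def successively_map by auto
      \<comment> \<open>The coefficient \<open>c\<close> is absorbed into the first syllable, which
        stays in its factor and outside \<open>pres.C\<close>.\<close>
      let ?us = "(cay ap.G c + cay ap.G a) # map (cay ap.G) zs"
      have ends: "cay ap.G a \<in> pres.A \<longleftrightarrow> cay ap.G (last zs) \<notin> pres.A" using diff[OF df] a by simp
      have "pres.am.alt ?us" using alt a pres.am.C_iffs[OF cc] by (simp add: pres.am.alt_Cons) blast
      then have cyc: "pres.am.cyc ?us"
        using ends a(2) pres.am.C_iffs[OF cc] by (simp add: pres.am.cyc_def last_map)
      have sum: "sum_list ?us = cay ap.G g" unfolding cay_g a(1) by (simp add: add.assoc)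
      have "cay ap.G g \<notin> pres.C" unfolding sum[symmetric]
        using pres.am.alternating_sum \<open>pres.am.alt ?us\<close> by blast
      then have "g \<notin> C'" using cay_in(3)[OF g(1)] by simp
      \<comment> \<open>Regularity excludes \<open>g\<close> from \<open>N_star\<close> minus
        \<open>C'\<close>; as \<open>g\<close> is outside \<open>C'\<close>, it is not in
        \<open>N_star\<close> at all.\<close>
      then have N: "C' \<inter> conj_set ap.G C' g = {\<one>\<^bsub>ap.G\<^esub>}" using g(1,2) by (auto simp: N_star_def)
      have "d = 0" if d: "d \<in> pres.C" "cay ap.G g + d - cay ap.G g \<in> pres.C" for d
      proof -
        obtain x where x: "x \<in> C'" "d = cay ap.G x" using d(1) unfolding C by blast
        obtain y where y: "y \<in> C'" "cay ap.G g + d - cay ap.G g = cay ap.G y" using d(2) unfolding C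
          by blast
        have xy: "x \<in> carrier ap.G" "y \<in> carrier ap.G" using x y carr by auto
        have "cay ap.G (conj_elem ap.G y g) = cay ap.G x"
          using xy g(1) x(2)
            by (simp add: ap.G.cay_conj_elem y(2)[symmetric] group_simps del: add_uminus_conv_diff)
        then have "conj_elem ap.G y g = x"
          using ap.G.cay_eq_iff[OF ap.G.conj_elem_closed[OF xy(2) g(1)] xy(1)] by simp
        then have "x \<in> C' \<inter> conj_set ap.G C' g" using x y unfolding conj_set_def by blast
        then have "x = \<one>\<^bsub>ap.G\<^esub>" unfolding N by simp
        then show ?thesis using x(2) ap.G.cay_one by simp
      qed
      then show ?thesis using cyc sum unfolding pres.tractable_def by blast
    qed
  qed
  obtain f where f: "partial_recursive f"
    "\<And>U V. U \<in> words ap.S \<Longrightarrow> V \<in> words ap.S \<Longrightarrow> \<exists>x\<in>pres.G. pres.tractable (- x + ev ap.\<gamma> U + x) \<Longrightarrow>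
       f (prod_encode (word_code idx U, word_code idx V)) \<noteq> None"
    "\<And>U V r. U \<in> words ap.S \<Longrightarrow> V \<in> words ap.S \<Longrightarrow> f (prod_encode (word_code idx U, word_code idx V)) =
      Some r \<Longrightarrow>
       pres.search_answer U V r"
    using pres.conjugacy_search by blast
  have conj_iff: "- ev ap.\<gamma> w + ev ap.\<gamma> u + ev ap.\<gamma> w = ev ap.\<gamma> v \<longleftrightarrow>
      conj_elem ap.G (word_elem ap.S ap.R u) (word_elem ap.S ap.R w) = word_elem ap.S ap.R v"
    if "u \<in> words ap.S" "v \<in> words ap.S" "w \<in> words ap.S" for u v w
    using that ap.word_elem_carrier
    by (simp add: ap.ev_\<gamma> ap.G.cay_conj_elem[symmetric] ap.G.cay_eq_iff ap.G.conj_elem_closed)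
  have "CSP_decidable_on idx ap.S ap.R (CR ap.G A' B' C' \<times> carrier ap.G)"
    unfolding CSP_decidable_on_def Let_def
  proof (intro exI[of _ f] conjI ballI allI impI)
    show "partial_recursive f" by (rule f(1))
  next
    fix u v assume uv: "u \<in> words ap.S" "v \<in> words ap.S"
      and in_CR: "(word_elem ap.S ap.R u, word_elem ap.S ap.R v) \<in> CR ap.G A' B' C' \<times> carrier ap.G"
    then obtain g x where g: "cyclically_reduced ap.G A' B' C' g" "regular ap.G C' g"
      "x \<in> carrier ap.G" "conj_elem ap.G (word_elem ap.S ap.R u) x = g"
      by (auto simp: CR_def conjugate_in_def)
    have "cay ap.G g = - cay ap.G x + ev ap.\<gamma> u + cay ap.G x"
      unfolding g(4)[symmetric] using g(3) uv ap.word_elem_carrier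
        by (simp add: ap.G.cay_conj_elem ap.ev_\<gamma>)
    then have "\<exists>x\<in>pres.G. pres.tractable (- x + ev ap.\<gamma> u + x)"
      using tractable[OF g(1,2)] g(3) unfolding G by (intro bexI[of _ "cay ap.G x"]) auto
    then show "f (prod_encode (word_code idx u, word_code idx v)) \<noteq> None" using f(2)[OF uv] by blast
  next
    fix u v r assume uv: "u \<in> words ap.S" "v \<in> words ap.S"
      and "f (prod_encode (word_code idx u, word_code idx v)) = Some r"
    then have ans: "pres.search_answer u v r" using f(3) by blast
    show "CSP_answer idx ap.S ap.R u v r"
    proof (cases r)
      case 0
      have "\<not> conjugate_in ap.G (word_elem ap.S ap.R u) (word_elem ap.S ap.R v)"
      proof
        assume "conjugate_in ap.G (word_elem ap.S ap.R u) (word_elem ap.S ap.R v)"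
        then obtain w where w: "w \<in> words ap.S"
          "conj_elem ap.G (word_elem ap.S ap.R u) (word_elem ap.S ap.R w) = word_elem ap.S ap.R v"
          by (auto simp: conjugate_in_def ap.G_def carrier_presented_group)
        then have "- ev ap.\<gamma> w + ev ap.\<gamma> u + ev ap.\<gamma> w = ev ap.\<gamma> v" using conj_iff[OF uv] by blast
        moreover have "ev ap.\<gamma> w \<in> pres.G" using w(1) unfolding pres.G_def by blast
        ultimately show False using ans 0 unfolding pres.search_answer_def by auto
      qed
      then show ?thesis using 0 by (simp add: CSP_answer_def ap.G_def)
    next
      case (Suc m)
      then show ?thesis using ans conj_iff[OF uv]
        by (auto simp: CSP_answer_def pres.search_answer_def ap.G_def)
    qed
  qed
  then show ?thesis
    unfolding Let_def ap.G_def A'_def B'_def C'_def ap.S_def ap.R_def .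
qed

end
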